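(* Let $F$ be a $\rho$-regular set of $\mathbb{R}^2$ for some $\rho>0$ and let $W\in\mathscr{W}$ be a polyrectangle such that $F\cap W$ is bounded, $\partial F\cap\mathrm{corners}(W)=\emptyset$, and for every $x\in\partial F\cap\partial W$ the vector $\mathbf{n}_F(x)$ is not collinear with $\mathbf{n}_W(x)$. Then $F\cap W\in\mathcal{A}$, and there is $\varepsilon(F,W)>0$ such that for every $0<\varepsilon<\varepsilon(F,W)$, $$\chi(F\cap W)=\chi^{\varepsilon}([F\cap W]^{\varepsilon})=\sum_{x\in\varepsilon\mathbb{Z}^2}\chi^{\varepsilon}(x;F\cap W)=\varepsilon^{-2}\int_{\mathbb{R}^2}\chi^{\varepsilon}(x;F\cap W)\,dx$$ $$=\varepsilon^{-2}\Big(\delta_0^{-\varepsilon\mathbf{u}_1,-\varepsilon\mathbf{u}_2}(F\cap W)-\delta_{\varepsilon\mathbf{u}_1,\varepsilon\mathbf{u}_2}^{0}(F\cap W)\Big).$$ Moreover $\varepsilon(F,W)$ can be chosen so that $\varepsilon(F,W)=\varepsilon(F+x,W+x)$ for all $x\in\mathbb{R}^2$.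
   Context: $\mathbf{u}_1,\mathbf{u}_2$ are the canonical basis vectors of $\mathbb{R}^2$, $\mathrm{Vol}$ is Lebesgue measure, $B(x,r)$ the closed Euclidean ball. Euler characteristic: for $A\subseteq\mathbb{R}^2$, $\Gamma(A)$ is the family of bounded connected components of $A$, where connectedness is meant by continuous paths. $\mathcal{A}$ is the class of sets $A$ such that $\Gamma(A)$ and $\Gamma(A^c)$ are finite; for $A\in\mathcal{A}$, $\chi(A)=\#\Gamma(A)-\#\Gamma(A^c)$. Lattice version: $Z_\varepsilon=\varepsilon\mathbb{Z}^2$; two points of $Z_\varepsilon$ are neighbours if at distance $\varepsilon$ (and each point is its own neighbour), which defines grid-connectedness through finite paths of neighbours. For $M\subseteq Z_\varepsilon$, $\Gamma^\varepsilon(M)$ is the class of finite grid-connected components of $M$, and $\chi^\varepsilon(M)=\#\Gamma^\varepsilon(M)-\#\Gamma^\varepsilon(Z_\varepsilon\setminus M)$ for $M$ bounded with $\Gamma^\varepsilon(M),\Gamma^\varepsilon(Z_\varepsilon\setminus M)$ finite. For $A\subseteq\mathbb{R}^2$, $[A]^\varepsilon=A\cap Z_\varepsilon$. For $x\in\mathbb{R}^2$, $$\chi^\varepsilon(x;A)=\mathbf{1}_{\{x\in A,\,x+\varepsilon\mathbf{u}_1\notin A,\,x+\varepsilon\mathbf{u}_2\notin A\}}-\mathbf{1}_{\{x\notin A,\,x-\varepsilon\mathbf{u}_1\in A,\,x-\varepsilon\mathbf{u}_2\in A\}}.$$ Polyvariograms: for measurable $A\subseteq\mathbb{R}^2$,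 $$\delta_{x_1,\dots,x_q}^{y_1,\dots,y_m}(A)=\mathrm{Vol}\big((A+x_1)\cap\dots\cap(A+x_q)\cap(A+y_1)^c\cap\dots\cap(A+y_m)^c\big).$$ Regular sets: let $A^{\oplus r}=\{x+y:x\in A,\,y\in B(0,r)\}$ and $A^{\ominus r}=\{x\in A:B(x,r)\subseteq A\}$. A closed set $F$ has an inside rolling ball of radius $\rho$ if each $x\in F$ belongs to a closed Euclidean ball of radius $\rho$ contained in $F$; it has an outside rolling ball of radius $\rho$ if $\mathrm{cl}(F^c)$ has an inside rolling ball of radius $\rho$. A compact set $F\subseteq\mathbb{R}^2$ is $\rho$-regular if it has finitely many connected components and satisfies (i) $\partial F$ is a compact 1-dimensional $\mathcal{C}^1$ submanifold of $\mathbb{R}^2$ and the outward unit normal map $x\mapsto\mathbf{n}_F(x)$ on $\partial F$ is $\rho^{-1}$-Lipschitz; (ii) $F$ has inside and outside rolling balls of radius $\rho$; (iii) $(F^{\ominus r})^{\oplus r}=(F^{\oplus r})^{\ominus r}=F$ for $r<\rho$. (For compact connected $F$, conditions (i), (ii), (iii) are equivalent by Blaschke's theorem.) Polyrectangles: an admissible rectangle is a set $I\times J$ with $I,J$ closed (possibly infinite) intervals of $\mathbb{R}$ with non-empty interior; $\mathrm{corners}(I\times J)$ is its set of corners. A polyrectangle is a finite union $W=\bigcup_iW_i$ of admissible rectangles with $\mathrm{corners}(W_i)\cap\mathrm{corners}(W_j)=\emptyset$ for $i\neq j$; $\mathscr{W}$ is the class of polyrectangles. An edge of $W$ is a maximal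 segment of $\partial W$. $\mathrm{corners}(W)$ is the set of the points of $\bigcup_i\mathrm{corners}(W_i)$ lying on $\partial W$, together with the endpoints of the edges of $W$. For $x\in\partial W\setminus\mathrm{corners}(W)$, $\mathbf{n}_W(x)$ is the outward unit normal vector to $W$ at $x$. *)

theory Defs
  imports "HOL-Analysis.Analysis"
begin

text \<open>
  The plane is \<^typ>\<open>real \<times> real\<close>, whose norm is the Euclidean one
  (\<open>norm_prod_def\<close>) and in which a rectangle is literally a product \<open>I \<times> J\<close>.
\<close>

type_synonym plane = "real \<times> real"

definition u1 :: plane where "u1 = (1, 0)"
definition u2 :: plane where "u2 = (0, 1)"

definition translate :: "plane \<Rightarrow> plane set \<Rightarrow> plane set" where
  "translate x A = (\<lambda>a. a + x) ` A"


section \<open>Euler characteristic\<close>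

definition bounded_components :: "plane set \<Rightarrow> plane set set" where
  "bounded_components A = {C. bounded C \<and> (\<exists>x\<in>A. C = path_component_set A x)}"

definition euler_class :: "plane set set" where
  "euler_class = {A. finite (bounded_components A) \<and> finite (bounded_components (- A))}"

definition euler_char :: "plane set \<Rightarrow> int" where
  "euler_char A = int (card (bounded_components A)) - int (card (bounded_components (- A)))"


section \<open>Lattice Euler characteristic\<close>

definition grid :: "real \<Rightarrow> plane set" where
  "grid \<epsilon> = {(\<epsilon> * of_int i, \<epsilon> * of_int j) | i j :: int. True}"

definition grid_step :: "real \<Rightarrow> plane set \<Rightarrow> plane \<Rightarrow> plane \<Rightarrow> bool" where
  "grid_step \<epsilon> M x y \<longleftrightarrow> x \<in> M \<and> y \<in> M \<and> (x = y \<or> dist x y = \<epsilon>)"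

definition grid_components :: "real \<Rightarrow> plane set \<Rightarrow> plane set set" where
  "grid_components \<epsilon> M = {C. \<exists>x\<in>M. C = {y. (grid_step \<epsilon> M)\<^sup>*\<^sup>* x y}}"

definition finite_grid_components :: "real \<Rightarrow> plane set \<Rightarrow> plane set set" where
  "finite_grid_components \<epsilon> M = {C \<in> grid_components \<epsilon> M. finite C}"

text \<open>The sets on which the lattice Euler characteristic is defined.\<close>

definition grid_euler_class :: "real \<Rightarrow> plane set set" where
  "grid_euler_class \<epsilon> = {M. M \<subseteq> grid \<epsilon> \<and> bounded M
     \<and> finite (finite_grid_components \<epsilon> M)
     \<and> finite (finite_grid_components \<epsilon> (grid \<epsilon> - M))}"

definition grid_euler_char :: "real \<Rightarrow> plane set \<Rightarrow> int" where
  "grid_euler_char \<epsilon> M = int (card (finite_grid_components \<epsilon> M))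
     - int (card (finite_grid_components \<epsilon> (grid \<epsilon> - M)))"

definition grid_trace :: "real \<Rightarrow> plane set \<Rightarrow> plane set" where
  "grid_trace \<epsilon> A = A \<inter> grid \<epsilon>"

definition local_euler :: "real \<Rightarrow> plane \<Rightarrow> plane set \<Rightarrow> real" where
  "local_euler \<epsilon> x A =
     of_bool (x \<in> A \<and> x + \<epsilon> *\<^sub>R u1 \<notin> A \<and> x + \<epsilon> *\<^sub>R u2 \<notin> A)
     - of_bool (x \<notin> A \<and> x - \<epsilon> *\<^sub>R u1 \<in> A \<and> x - \<epsilon> *\<^sub>R u2 \<in> A)"


section \<open>Polyvariograms\<close>

text \<open>
  The volume is taken in \<^typ>\<open>real\<close>; it is finite whenever \<open>A\<close> is bounded and
  \<open>xs\<close> is non-empty.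
\<close>

definition polyvariogram :: "plane list \<Rightarrow> plane list \<Rightarrow> plane set \<Rightarrow> real" where
  "polyvariogram xs ys A = measure lebesgue
     ((\<Inter>x\<in>set xs. translate x A) \<inter> (\<Inter>y\<in>set ys. - translate y A))"


section \<open>Smooth boundaries and outward normals\<close>

definition C1_regular_on :: "plane set \<Rightarrow> (plane \<Rightarrow> real) \<Rightarrow> (plane \<Rightarrow> plane) \<Rightarrow> bool" where
  "C1_regular_on U f g \<longleftrightarrow>
     open U \<and> (\<forall>y\<in>U. GDERIV f y :> g y \<and> g y \<noteq> 0) \<and> continuous_on U g"

text \<open>One-dimensional submanifolds of the plane, as local level sets of C1 submersions.\<close>

definition C1_curve :: "plane set \<Rightarrow> bool" where
  "C1_curve S \<longleftrightarrow> (\<forall>x\<in>S. \<exists>U f g. x \<in> U \<and> C1_regular_on U f g \<and>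
     S \<inter> U = {y \<in> U. f y = 0})"

text \<open>
  \<open>n\<close> is the outward unit normal to \<open>F\<close> at \<open>x\<close>: near \<open>x\<close> the set \<open>F\<close> is the
  sublevel set \<open>f \<le> 0\<close> of a C1 submersion with \<open>f x = 0\<close>, and \<open>n\<close> is the normalized
  gradient of \<open>f\<close> at \<open>x\<close>. Such an \<open>n\<close> need not exist but is unique (proved below).
\<close>

definition is_outward_normal :: "plane set \<Rightarrow> plane \<Rightarrow> plane \<Rightarrow> bool" where
  "is_outward_normal F x n \<longleftrightarrow> (\<exists>U f g. x \<in> U \<and> C1_regular_on U f g \<and> f x = 0 \<and>
     F \<inter> U = {y \<in> U. f y \<le> 0} \<and> n = sgn (g x))"

definition outward_normal :: "plane set \<Rightarrow> plane \<Rightarrow> plane" where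
  "outward_normal F x = (THE n. is_outward_normal F x n)"

lemma gderiv_line:
  fixes f :: "plane \<Rightarrow> real"
  assumes "GDERIV f x :> d"
  shows "((\<lambda>t. f (x + t *\<^sub>R v)) has_real_derivative inner v d) (at 0)"
proof -
  have "(f has_derivative (\<lambda>h. inner h d)) (at (x + 0 *\<^sub>R v))"
    using assms by (simp add: gderiv_def)
  moreover have "((\<lambda>t. x + t *\<^sub>R v) has_derivative (\<lambda>t. t *\<^sub>R v)) (at 0)"
    by (auto intro!: derivative_eq_intros)
  ultimately have "((\<lambda>t. f (x + t *\<^sub>R v)) has_derivative (\<lambda>t. inner (t *\<^sub>R v) d)) (at 0)"
    by (rule has_derivative_compose[rotated])
  then show ?thesis
    by (simp add: has_field_derivative_def mult_commute_abs)
qed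

lemma is_outward_normal_halfplane:
  assumes n: "is_outward_normal F x n" and m: "is_outward_normal F x m"
    and v: "inner v n < 0"
  shows "inner v m \<le> 0"
proof (rule ccontr)
  assume "\<not> inner v m \<le> 0"
  then have vm: "inner v m > 0" by simp
  obtain U f g where U: "x \<in> U" "C1_regular_on U f g" "f x = 0"
      "F \<inter> U = {y \<in> U. f y \<le> 0}" "n = sgn (g x)"
    using n unfolding is_outward_normal_def by blast
  obtain V p q where V: "x \<in> V" "C1_regular_on V p q" "p x = 0"
      "F \<inter> V = {y \<in> V. p y \<le> 0}" "m = sgn (q x)"
    using m unfolding is_outward_normal_def by blast
  have gq: "inner v (g x) < 0" "inner v (q x) > 0"
    using v vm unfolding U(5) V(5) sgn_div_norm by (auto simp: zero_less_mult_iff mult_less_0_iff)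
  have df: "((\<lambda>t. f (x + t *\<^sub>R v)) has_real_derivative inner v (g x)) (at 0)"
    and dp: "((\<lambda>t. p (x + t *\<^sub>R v)) has_real_derivative inner v (q x)) (at 0)"
    using U V gderiv_line unfolding C1_regular_on_def by blast+
  obtain d1 where d1: "d1 > 0" "\<And>h. 0 < h \<Longrightarrow> h < d1 \<Longrightarrow> f (x + h *\<^sub>R v) < 0"
    using DERIV_neg_dec_right[OF df gq(1)] U(3) by auto
  obtain d2 where d2: "d2 > 0" "\<And>h. 0 < h \<Longrightarrow> h < d2 \<Longrightarrow> p (x + h *\<^sub>R v) > 0"
    using DERIV_pos_inc_right[OF dp gq(2)] V(3) by auto
  have "((\<lambda>t. x + t *\<^sub>R v) \<longlongrightarrow> x + 0 *\<^sub>R v) (at_right 0)"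
    by (intro tendsto_intros)
  moreover have "open (U \<inter> V)" "x \<in> U \<inter> V"
    using U V unfolding C1_regular_on_def by auto
  ultimately have "\<forall>\<^sub>F t in at_right 0. x + t *\<^sub>R v \<in> U \<inter> V"
    by (auto dest: topological_tendstoD)
  moreover have "\<forall>\<^sub>F t in at_right 0. 0 < t \<and> t < min d1 d2"
    using d1(1) d2(1) eventually_at_right_real[of 0 "min d1 d2"] by (auto elim: eventually_mono)
  ultimately have "\<forall>\<^sub>F t in at_right (0::real). False"
  proof eventually_elim
    case (elim t)
    then have "f (x + t *\<^sub>R v) < 0" "p (x + t *\<^sub>R v) > 0"
      using d1(2) d2(2) by auto
    moreover have "x + t *\<^sub>R v \<in> F \<inter> U"
      unfolding U(4) using elim \<open>f (x + t *\<^sub>R v) < 0\<close> by simp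
    then have "x + t *\<^sub>R v \<in> F \<inter> V"
      using elim by blast
    then have "p (x + t *\<^sub>R v) \<le> 0"
      unfolding V(4) by simp
    ultimately show False by simp
  qed
  then show False by simp
qed

lemma is_outward_normal_unique:
  assumes n: "is_outward_normal F x n" and m: "is_outward_normal F x m"
  shows "n = m"
proof (rule ccontr)
  assume "n \<noteq> m"
  have nn: "norm n = 1" "norm m = 1"
    using n m unfolding is_outward_normal_def C1_regular_on_def by (auto simp: norm_sgn)
  then have s: "inner n n = 1" "inner m m = 1" by (simp_all add: norm_eq_1)
  have "inner (m - n) (m - n) > 0" using \<open>n \<noteq> m\<close> by simp
  then have "inner m n < 1"
    by (simp add: inner_diff_left inner_diff_right s inner_commute[of n m])
  moreover have "inner (m - n) n = inner m n - 1" "inner (m - n) m = 1 - inner m n"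
    by (simp_all add: inner_diff_left s inner_commute[of n m])
  ultimately show False
    using is_outward_normal_halfplane[OF n m, of "m - n"] by linarith
qed

lemma outward_normal_eq: "is_outward_normal F x n \<Longrightarrow> outward_normal F x = n"
  unfolding outward_normal_def using is_outward_normal_unique by blast


section \<open>Regular sets\<close>

definition dilation :: "real \<Rightarrow> plane set \<Rightarrow> plane set" where
  "dilation r A = {x + y | x y. x \<in> A \<and> y \<in> cball 0 r}"

definition erosion :: "real \<Rightarrow> plane set \<Rightarrow> plane set" where
  "erosion r A = {x \<in> A. cball x r \<subseteq> A}"

definition inside_rolling_ball :: "real \<Rightarrow> plane set \<Rightarrow> bool" where
  "inside_rolling_ball \<rho> F \<longleftrightarrow> (\<forall>x\<in>F. \<exists>c. x \<in> cball c \<rho> \<and> cball c \<rho> \<subseteq> F)"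

definition outside_rolling_ball :: "real \<Rightarrow> plane set \<Rightarrow> bool" where
  "outside_rolling_ball \<rho> F \<longleftrightarrow> inside_rolling_ball \<rho> (closure (- F))"

text \<open>The opening/closing condition is over radii \<open>r \<ge> 0\<close>, since balls of negative radius are empty.\<close>

definition regular_set :: "real \<Rightarrow> plane set \<Rightarrow> bool" where
  "regular_set \<rho> F \<longleftrightarrow>
     compact F \<and> finite (components F) \<and>
     compact (frontier F) \<and> C1_curve (frontier F) \<and>
     (\<forall>x\<in>frontier F. \<exists>n. is_outward_normal F x n) \<and>
     (1 / \<rho>)-lipschitz_on (frontier F) (outward_normal F) \<and>
     inside_rolling_ball \<rho> F \<and> outside_rolling_ball \<rho> F \<and>
     (\<forall>r. 0 \<le> r \<and> r < \<rho> \<longrightarrow>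
        dilation r (erosion r F) = F \<and> erosion r (dilation r F) = F)"


section \<open>Polyrectangles\<close>

definition admissible_interval :: "real set \<Rightarrow> bool" where
  "admissible_interval I \<longleftrightarrow> is_interval I \<and> closed I \<and> interior I \<noteq> {}"

definition admissible_rectangle :: "plane set \<Rightarrow> bool" where
  "admissible_rectangle R \<longleftrightarrow>
     (\<exists>I J. admissible_interval I \<and> admissible_interval J \<and> R = I \<times> J)"

text \<open>For \<open>R = I \<times> J\<close>, the frontiers are the sets of finite endpoints of \<open>I\<close> and \<open>J\<close>.\<close>

definition rect_corners :: "plane set \<Rightarrow> plane set" where
  "rect_corners R = frontier (fst ` R) \<times> frontier (snd ` R)"

text \<open>
  The corners of a polyrectangle depend on how it is presented as a union, so
  the presenting family \<open>\<R>\<close> is kept as an argument.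
\<close>

definition polyrectangle :: "plane set set \<Rightarrow> plane set \<Rightarrow> bool" where
  "polyrectangle \<R> W \<longleftrightarrow> finite \<R> \<and> (\<forall>R\<in>\<R>. admissible_rectangle R) \<and>
     pairwise (\<lambda>R S. rect_corners R \<inter> rect_corners S = {}) \<R> \<and> W = \<Union>\<R>"

text \<open>
  Edges are non-degenerate and may be unbounded (half-lines or lines); the
  endpoints of an edge are its extreme points.
\<close>

definition boundary_segment :: "plane set \<Rightarrow> plane set \<Rightarrow> bool" where
  "boundary_segment W s \<longleftrightarrow>
     s \<subseteq> frontier W \<and> convex s \<and> collinear s \<and> (\<exists>a\<in>s. \<exists>b\<in>s. a \<noteq> b)"

definition edge :: "plane set \<Rightarrow> plane set \<Rightarrow> bool" where
  "edge W s \<longleftrightarrow> boundary_segment W s \<and> (\<forall>t. boundary_segment W t \<and> s \<subseteq> t \<longrightarrow> t = s)"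

definition corners :: "plane set set \<Rightarrow> plane set \<Rightarrow> plane set" where
  "corners \<R> W = {x \<in> frontier W. \<exists>R\<in>\<R>. x \<in> rect_corners R}
     \<union> {x. \<exists>s. edge W s \<and> x extreme_point_of s}"

end

theory Submission
  imports Defs
begin

text \<open>
  Call a set \<open>A\<close> tame if every point has arbitrarily small rectangular neighbourhoods \<open>B\<close> in which \<open>A \<inter> B\<close>
  and \<open>B - A\<close> are connected, both by paths and along every sufficiently fine shifted grid. For fine
  grids, \<open>C \<mapsto> C \<inter> grid\<close> is then a bijection between path components and grid components, of \<open>A\<close> as
  well as of its complement, and it matches bounded components with finite ones. The trace of \<open>A\<close> on the
  grid has no \<open>2 \<times> 2\<close> block with exactly two diagonally opposite points, and for a finite set of
  cells without such blocks the number of components minus the number of holes equals vertices minus edges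
  plus full squares, hence the sum of the corner terms. Since the bounds are uniform in the position of
  the grid, integrating over one period gives the identity for the volumes.

  Under the hypotheses \<open>F \<inter> W\<close> is tame: away from the corners of \<open>W\<close> it is locally, up to a symmetry of
  the grid, a sublevel set that is monotone along columns, cut by at most one vertical line (here transversality
  is used); near a corner of \<open>W\<close> the set \<open>F\<close> is locally empty or everything, and \<open>W\<close> is a union of
  quadrants which are not just two opposite ones.
\<close>

section \<open>Components of a relation on a set\<close>

text \<open>Side steps in a set of cells are paired with diagonal steps in its complement: with this
  pair the count of components and holes is valid for every finite set of cells, so cells can be
  added one by one although the intermediate sets need not satisfy \<open>no_cross\<close>. The crux
  is a discrete Jordan curve statement: when the last cell is put next to two occupied neighbours
  with an empty cell diagonally between them, these neighbours are already linked iff a hole is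
  closed off. One direction uses a winding number computed from a flow, which, unlike a simple
  closed path, can be added up freely; the other uses parity. Neither relies on the Jordan curve
  theorem of the plane. On the continuous side nothing is triangulated or deformed. Only components
  are compared, so it is enough that every local picture is connected in both senses and that no
  piece slips between grid points. Shifted grids are built in from the start because a translate of
  the set over a fixed grid looks like the set over a shifted grid; this also makes the final bound
  invariant under translation.\<close>

definition linked :: "('a \<Rightarrow> 'a \<Rightarrow> bool) \<Rightarrow> 'a set \<Rightarrow> 'a \<Rightarrow> 'a \<Rightarrow> bool" where
  "linked R S = (\<lambda>x y. x \<in> S \<and> y \<in> S \<and> R x y)\<^sup>*\<^sup>*"

definition comp_of :: "('a \<Rightarrow> 'a \<Rightarrow> bool) \<Rightarrow> 'a set \<Rightarrow> 'a \<Rightarrow> 'a set" where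
  "comp_of R S x = {y. linked R S x y}"

definition comps :: "('a \<Rightarrow> 'a \<Rightarrow> bool) \<Rightarrow> 'a set \<Rightarrow> 'a set set" where
  "comps R S = comp_of R S ` S"

lemma linked_refl [simp]: "linked R S x x"
  by (simp add: linked_def)

lemma linked_trans: "linked R S x y \<Longrightarrow> linked R S y z \<Longrightarrow> linked R S x z"
  unfolding linked_def by (rule rtranclp_trans)

lemma linked_step: "x \<in> S \<Longrightarrow> y \<in> S \<Longrightarrow> R x y \<Longrightarrow> linked R S x y"
  unfolding linked_def by (rule r_into_rtranclp) simp

lemma linked_induct [consumes 1, case_names base step]:
  assumes "linked R S x y" "P x"
    and "\<And>y z. linked R S x y \<Longrightarrow> y \<in> S \<Longrightarrow> z \<in> S \<Longrightarrow> R y z \<Longrightarrow> P y \<Longrightarrow> P z"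
  shows "P y"
  using assms(1) unfolding linked_def
  by (induction rule: rtranclp_induct) (use assms(2,3) in \<open>auto simp: linked_def\<close>)

lemma linked_mem: "linked R S x y \<Longrightarrow> x \<in> S \<Longrightarrow> y \<in> S"
  by (induction rule: linked_induct) auto

lemma linked_sym:
  assumes "symp R" "linked R S x y"
  shows "linked R S y x"
  using assms(2)
  by (induction rule: linked_induct)
    (use assms(1) in \<open>auto intro: linked_trans[OF linked_step] dest: sympD\<close>)

lemma linked_mono: "linked R S x y \<Longrightarrow> S \<subseteq> T \<Longrightarrow> linked R T x y"
  by (induction rule: linked_induct) (auto intro: linked_trans linked_step)

lemma comp_of_self [simp]: "x \<in> comp_of R S x"
  by (simp add: comp_of_def)

lemma comp_of_subset: "x \<in> S \<Longrightarrow> comp_of R S x \<subseteq> S"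
  by (auto simp: comp_of_def dest: linked_mem)

lemma comp_of_eq: "symp R \<Longrightarrow> y \<in> comp_of R S x \<Longrightarrow> comp_of R S y = comp_of R S x"
  by (auto simp: comp_of_def intro: linked_trans linked_sym)

lemma comp_of_adj: "symp R \<Longrightarrow> x \<in> S \<Longrightarrow> y \<in> S \<Longrightarrow> R x y \<Longrightarrow> comp_of R S y = comp_of R S x"
  by (rule comp_of_eq) (auto simp: comp_of_def intro: linked_step)

lemma comps_touching:
  assumes "symp R"
  shows "{C \<in> comps R S. \<exists>y\<in>C. R x y} = comp_of R S ` {y \<in> S. R x y}"
proof safe
  fix C y assume "C \<in> comps R S" "y \<in> C" "R x y"
  then show "C \<in> comp_of R S ` {y \<in> S. R x y}"
    unfolding comps_def using comp_of_eq[OF assms] comp_of_subset by (smt (verit) image_iff mem_Collect_eq subsetD)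
qed (auto simp: comps_def intro: comp_of_self)

text \<open>Chains in \<open>insert x S\<close> can leave a component of \<open>S\<close> only
  through \<open>x\<close>. Hence components without a neighbour of \<open>x\<close> survive, and
  all the others are fused into one.\<close>

lemma comps_insert:
  assumes R: "symp R" and x: "x \<notin> S"
  shows "comps R (insert x S) =
    insert (comp_of R (insert x S) x) {C \<in> comps R S. \<not> (\<exists>y\<in>C. R x y)}"
    and "comp_of R (insert x S) x = insert x (\<Union>{C \<in> comps R S. \<exists>y\<in>C. R x y})"
proof -
  let ?T = "insert x S"
  have far: "comp_of R ?T y = comp_of R S y" if y: "y \<in> S" and nt: "\<not> (\<exists>z\<in>comp_of R S y. R x z)" for y
  proof (intro equalityI subsetI)
    fix z assume "z \<in> comp_of R ?T y"
    then have "linked R ?T y z" by (simp add: comp_of_def)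
    then show "z \<in> comp_of R S y"
    proof (induction rule: linked_induct)
      case (step z w)
      then have "z \<in> S" using comp_of_subset[OF y] by blast
      have "w \<noteq> x" using step nt sympD[OF R] by blast
      then show ?case using step \<open>z \<in> S\<close> unfolding comp_of_def
        by (auto intro: linked_trans linked_step)
    qed simp
  qed (auto simp: comp_of_def intro: linked_mono)
  have near: "comp_of R ?T y = comp_of R ?T x" if y: "y \<in> S" and t: "z \<in> comp_of R S y" "R x z" for y z
  proof -
    have "z \<in> S" using t(1) comp_of_subset[OF y] by blast
    then have "linked R ?T x z" using t(2) by (auto intro: linked_step)
    moreover have "linked R ?T z y"
      using t(1) linked_sym[OF R] by (auto simp: comp_of_def intro: linked_mono)
    ultimately show ?thesis
      by (intro comp_of_eq[OF R]) (auto simp: comp_of_def intro: linked_trans)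
  qed
  show "comps R ?T = insert (comp_of R ?T x) {C \<in> comps R S. \<not> (\<exists>y\<in>C. R x y)}"
  proof (intro equalityI subsetI)
    fix C assume "C \<in> comps R ?T"
    then obtain y where "y \<in> ?T" "C = comp_of R ?T y" by (auto simp: comps_def)
    then consider "y = x" | "y \<in> S" "\<not> (\<exists>z\<in>comp_of R S y. R x z)" | "y \<in> S" "\<exists>z\<in>comp_of R S y. R x z"
      by blast
    then show "C \<in> insert (comp_of R ?T x) {C \<in> comps R S. \<not> (\<exists>y\<in>C. R x y)}"
    proof cases
      case 2
      then show ?thesis using far[OF 2] \<open>C = _\<close> by (auto simp: comps_def)
    next
      case 3
      then show ?thesis using near \<open>C = _\<close> by auto
    qed (use \<open>C = _\<close> in simp)
  next
    fix C assume "C \<in> insert (comp_of R ?T x) {C \<in> comps R S. \<not> (\<exists>y\<in>C. R x y)}"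
    then consider "C = comp_of R ?T x" | y where "y \<in> S" "C = comp_of R S y" "\<not> (\<exists>z\<in>C. R x z)"
      by (auto simp: comps_def)
    then show "C \<in> comps R ?T"
    proof cases
      case 2
      then have "C = comp_of R ?T y" using far by simp
      then show ?thesis using 2 by (simp add: comps_def)
    qed (simp add: comps_def)
  qed
  show "comp_of R ?T x = insert x (\<Union>{C \<in> comps R S. \<exists>y\<in>C. R x y})"
  proof (intro equalityI subsetI)
    fix z assume "z \<in> comp_of R ?T x"
    then have "linked R ?T x z" by (simp add: comp_of_def)
    then show "z \<in> insert x (\<Union>{C \<in> comps R S. \<exists>y\<in>C. R x y})"
    proof (induction rule: linked_induct)
      case (step z w)
      show ?case
      proof (cases "w = x")
        case False
        then have w: "w \<in> S" using step by simp
        show ?thesis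
        proof (cases "z = x")
          case True
          then have "comp_of R S w \<in> {C \<in> comps R S. \<exists>y\<in>C. R x y}"
            using w step by (auto simp: comps_def intro: bexI[of _ w])
          then show ?thesis using comp_of_self[of w R S] by blast
        next
          case False
          then obtain C where C: "C \<in> comps R S" "\<exists>y\<in>C. R x y" "z \<in> C" using step by blast
          then obtain v where v: "v \<in> S" "C = comp_of R S v" by (auto simp: comps_def)
          have "z \<in> S" using C(3) comp_of_subset[OF v(1), of R] unfolding v(2) by (rule subsetD[rotated])
          have "linked R S v z" using C(3) unfolding v(2) by (simp add: comp_of_def)
          moreover have "linked R S z w" using \<open>z \<in> S\<close> w step(4) by (rule linked_step)
          ultimately have "linked R S v w" by (rule linked_trans)
          then have "w \<in> C" using v(2) by (simp add: comp_of_def)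
          then show ?thesis using C by blast
        qed
      qed simp
    qed simp
  next
    fix z assume "z \<in> insert x (\<Union>{C \<in> comps R S. \<exists>y\<in>C. R x y})"
    then show "z \<in> comp_of R ?T x"
    proof
      assume "z \<in> \<Union>{C \<in> comps R S. \<exists>y\<in>C. R x y}"
      then obtain y w where y: "y \<in> S" "z \<in> comp_of R S y" "w \<in> comp_of R S y" "R x w"
        by (auto simp: comps_def)
      then have "z \<in> comp_of R ?T y" by (auto simp: comp_of_def intro: linked_mono)
      then show ?thesis using near[of y w] y by simp
    qed simp
  qed
qed

text \<open>The touching components are counted through the neighbours of \<open>x\<close> because a
  new last cell has at most two of these.\<close>

lemma card_comps_insert:
  assumes R: "symp R" and x: "x \<notin> S" and fin: "finite S"
  shows "int (card (comps R (insert x S))) =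
    int (card (comps R S)) - int (card (comp_of R S ` {y \<in> S. R x y})) + 1"
proof -
  let ?N = "{C \<in> comps R S. \<not> (\<exists>y\<in>C. R x y)}" and ?T = "{C \<in> comps R S. \<exists>y\<in>C. R x y}"
  have f: "finite (comps R S)" using fin by (simp add: comps_def)
  have "comp_of R (insert x S) x \<notin> comps R S"
    using x comp_of_self[of x R "insert x S"] comp_of_subset[of _ S R] unfolding comps_def by blast
  then have "card (comps R (insert x S)) = card ?N + 1"
    using comps_insert(1)[OF R x] f by simp
  moreover have "card (comps R S) = card ?N + card ?T"
    by (subst card_Un_disjoint[symmetric]) (use f in \<open>auto intro!: arg_cong[where f=card]\<close>)
  ultimately show ?thesis using comps_touching[OF R, of S x] by simp
qed

lemma comps_cong:
  assumes "\<And>x y. x \<in> S \<Longrightarrow> y \<in> S \<Longrightarrow> R x y \<Longrightarrow> linked R' S x y"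
    and "\<And>x y. x \<in> S \<Longrightarrow> y \<in> S \<Longrightarrow> R' x y \<Longrightarrow> linked R S x y"
  shows "comps R S = comps R' S"
proof -
  have 1: "linked R' S x y" if "linked R S x y" for x y
    using that by (induction rule: linked_induct) (use assms(1) in \<open>auto intro: linked_trans\<close>)
  have 2: "linked R S x y" if "linked R' S x y" for x y
    using that by (induction rule: linked_induct) (use assms(2) in \<open>auto intro: linked_trans\<close>)
  have "comp_of R S = comp_of R' S" using 1 2 by (auto simp: comp_of_def fun_eq_iff)
  then show ?thesis by (simp add: comps_def)
qed

lemma linked_image:
  assumes "inj f" and R: "\<And>x y. R' (f x) (f y) \<longleftrightarrow> R x y"
  shows "linked R' (f ` S) (f x) y \<longleftrightarrow> (\<exists>z. y = f z \<and> linked R S x z)"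
proof
  assume "linked R' (f ` S) (f x) y"
  then show "\<exists>z. y = f z \<and> linked R S x z"
  proof (induction rule: linked_induct)
    case (step y w)
    then obtain z z' where "y = f z" "linked R S x z" "w = f z'" "z' \<in> S" by auto
    moreover from this have "z \<in> S" using step(2) \<open>inj f\<close> by (auto simp: inj_eq)
    moreover have "R z z'" using step(4) R \<open>y = f z\<close> \<open>w = f z'\<close> by simp
    ultimately show ?case using linked_trans[of R S x z z'] linked_step[of z S z' R] by blast
  qed auto
next
  assume "\<exists>z. y = f z \<and> linked R S x z"
  then obtain z where z: "y = f z" "linked R S x z" by blast
  from z(2) have "linked R' (f ` S) (f x) (f z)"
  proof (induction rule: linked_induct)
    case (step y z)
    have "linked R' (f ` S) (f y) (f z)" using step R by (intro linked_step) auto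
    with step(5) show ?case by (rule linked_trans)
  qed simp
  then show "linked R' (f ` S) (f x) y" using z by simp
qed

lemma comps_image:
  assumes "inj f" and R: "\<And>x y. R' (f x) (f y) \<longleftrightarrow> R x y"
  shows "comps R' (f ` S) = image f ` comps R S"
proof -
  have "comp_of R' (f ` S) (f x) = f ` comp_of R S x" for x
    unfolding comp_of_def using linked_image[of f R' R, OF assms] by auto
  then show ?thesis by (auto simp: comps_def image_image)
qed

section \<open>Side and diagonal adjacency of cells; flows along side steps\<close>

definition adj4 :: "int \<times> int \<Rightarrow> int \<times> int \<Rightarrow> bool" where
  "adj4 p q \<longleftrightarrow> \<bar>fst p - fst q\<bar> + \<bar>snd p - snd q\<bar> \<le> 1"

definition adj8 :: "int \<times> int \<Rightarrow> int \<times> int \<Rightarrow> bool" where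
  "adj8 p q \<longleftrightarrow> \<bar>fst p - fst q\<bar> \<le> 1 \<and> \<bar>snd p - snd q\<bar> \<le> 1"

lemma symp_adj4: "symp adj4" and symp_adj8: "symp adj8"
  by (auto simp: symp_def adj4_def adj8_def)

text \<open>\<open>H i j\<close> and \<open>V i j\<close> are the flows from \<open>(i, j)\<close>
  to its right and to its upper neighbour; by the equation one unit enters at \<open>u\<close> and
  leaves at \<open>v\<close>. A flow replaces the chain because flows can be added and closed up
  without regard to repeated cells.\<close>

lemma linked_adj4_flow:
  assumes "linked adj4 N u v"
  shows "\<exists>H V :: int \<Rightarrow> int \<Rightarrow> int.
    (\<forall>i j. H i j \<noteq> 0 \<longrightarrow> (i, j) \<in> N \<and> (i + 1, j) \<in> N) \<and>
    (\<forall>i j. V i j \<noteq> 0 \<longrightarrow> (i, j) \<in> N \<and> (i, j + 1) \<in> N) \<and>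
    (\<forall>i j. H i j - H (i - 1) j + V i j - V i (j - 1) = of_bool ((i, j) = u) - of_bool ((i, j) = v))"
  using assms
proof (induction rule: linked_induct)
  case base
  show ?case by (intro exI[of _ "\<lambda>i j. 0"]) auto
next
  case (step y z)
  then obtain H V :: "int \<Rightarrow> int \<Rightarrow> int" where
    H: "\<And>i j. H i j \<noteq> 0 \<Longrightarrow> (i, j) \<in> N \<and> (i + 1, j) \<in> N" and
    V: "\<And>i j. V i j \<noteq> 0 \<Longrightarrow> (i, j) \<in> N \<and> (i, j + 1) \<in> N" and
    D: "\<And>i j. H i j - H (i - 1) j + V i j - V i (j - 1) = of_bool ((i, j) = u) - of_bool ((i, j) = y)"
    by blast
  obtain p q where y: "y = (p, q)" by force
  obtain p' q' where z: "z = (p', q')" by force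
  have "p' = p \<and> q' = q \<or> p' = p + 1 \<and> q' = q \<or> p' = p - 1 \<and> q' = q \<or>
      p' = p \<and> q' = q + 1 \<or> p' = p \<and> q' = q - 1"
    using step(4) unfolding y z adj4_def by simp presburger
  then consider "z = y" | "z = (p + 1, q)" | "z = (p - 1, q)" | "z = (p, q + 1)" | "z = (p, q - 1)"
    using y z by auto
  \<comment> \<open>The step from \<open>y\<close> to \<open>z\<close> is a unit flow on a single
    edge, negative when the edge is passed leftwards or downwards.\<close>
  then have "\<exists>h v :: int \<Rightarrow> int \<Rightarrow> int.
    (\<forall>i j. h i j \<noteq> 0 \<longrightarrow> (i, j) \<in> N \<and> (i + 1, j) \<in> N) \<and>
    (\<forall>i j. v i j \<noteq> 0 \<longrightarrow> (i, j) \<in> N \<and> (i, j + 1) \<in> N) \<and>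
    (\<forall>i j. h i j - h (i - 1) j + v i j - v i (j - 1) = of_bool ((i, j) = y) - of_bool ((i, j) = z))"
  proof cases
    case 1
    then show ?thesis by (intro exI[of _ "\<lambda>i j. 0"]) auto
  next
    case 2
    show ?thesis
      by (rule exI[of _ "\<lambda>i j. if i = p \<and> j = q then 1 else 0"], rule exI[of _ "\<lambda>i j. 0"])
        (use step(2,3) 2 y in auto)
  next
    case 3
    show ?thesis
      by (rule exI[of _ "\<lambda>i j. if i = p - 1 \<and> j = q then - 1 else 0"], rule exI[of _ "\<lambda>i j. 0"])
        (use step(2,3) 3 y in auto)
  next
    case 4
    show ?thesis
      by (rule exI[of _ "\<lambda>i j. 0"], rule exI[of _ "\<lambda>i j. if i = p \<and> j = q then 1 else 0"])
        (use step(2,3) 4 y in auto)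
  next
    case 5
    show ?thesis
      by (rule exI[of _ "\<lambda>i j. 0"], rule exI[of _ "\<lambda>i j. if i = p \<and> j = q - 1 then - 1 else 0"])
        (use step(2,3) 5 y in auto)
  qed
  then obtain h v :: "int \<Rightarrow> int \<Rightarrow> int" where
    h: "\<And>i j. h i j \<noteq> 0 \<Longrightarrow> (i, j) \<in> N \<and> (i + 1, j) \<in> N" and
    v: "\<And>i j. v i j \<noteq> 0 \<Longrightarrow> (i, j) \<in> N \<and> (i, j + 1) \<in> N" and
    d: "\<And>i j. h i j - h (i - 1) j + v i j - v i (j - 1) = of_bool ((i, j) = y) - of_bool ((i, j) = z)"
    by blast
  show ?case
  proof (rule exI[of _ "\<lambda>i j. H i j + h i j"], rule exI[of _ "\<lambda>i j. V i j + v i j"], intro conjI allI)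
    fix i j
    show "H i j + h i j \<noteq> 0 \<longrightarrow> (i, j) \<in> N \<and> (i + 1, j) \<in> N"
      using H[of i j] h[of i j] by (cases "H i j = 0") auto
    show "V i j + v i j \<noteq> 0 \<longrightarrow> (i, j) \<in> N \<and> (i, j + 1) \<in> N"
      using V[of i j] v[of i j] by (cases "V i j = 0") auto
    show "H i j + h i j - (H (i - 1) j + h (i - 1) j) + (V i j + v i j) - (V i (j - 1) + v i (j - 1)) =
        of_bool ((i, j) = u) - of_bool ((i, j) = z)"
      using D[of i j] d[of i j] by linarith
  qed
qed

lemma sum_telescope_int:
  fixes f :: "int \<Rightarrow> int"
  assumes "j \<le> J"
  shows "(\<Sum>k\<in>{j<..J}. f k - f (k - 1)) = f J - f j"
  using assms
proof (induction J rule: int_ge_induct)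
  case (step J)
  have "{j<..J + 1} = insert (J + 1) {j<..J}" using step by auto
  then show ?case using step by simp
qed simp

section \<open>Components and holes of finite sets of cells\<close>

text \<open>Diagonal steps are allowed here because two cells of \<open>M\<close> that meet only in
  a corner are not connected in \<open>M\<close>, and so must not separate the complement
  either.\<close>

definition holes :: "(int \<times> int) set \<Rightarrow> (int \<times> int) set set" where
  "holes M = {C \<in> comps adj8 (- M). finite C}"

text \<open>Walking once round four cells ends with the initial truth value, so changes come in
  pairs. This is the parity argument for a single block.\<close>

lemma even_cyclic_changes:
  fixes p q r s :: bool
  shows "even (of_bool (p \<noteq> q) + of_bool (q \<noteq> r) + of_bool (r \<noteq> s) + of_bool (s \<noteq> p) :: nat)"
  by auto

lemma infinite_ray:
  assumes ray: "\<And>k. (i + int k, j) \<in> S"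
  shows "infinite (comp_of adj8 S (i, j))"
proof -
  have "linked adj8 S (i, j) (i + int k, j)" for k
  proof (induction k)
    case (Suc k)
    have "linked adj8 S (i + int k, j) (i + int (Suc k), j)"
      using ray[of k] ray[of "Suc k"] by (rule linked_step) (simp add: adj8_def)
    with Suc show ?case by (rule linked_trans)
  qed simp
  then have "range (\<lambda>k. (i + int k, j)) \<subseteq> comp_of adj8 S (i, j)" by (auto simp: comp_of_def)
  moreover have "infinite (range (\<lambda>k. (i + int k, j)))"
    by (intro range_inj_infinite injI) simp
  ultimately show ?thesis using finite_subset by blast
qed

text \<open>Cells are added in lexicographic order, so that \<open>(a, b)\<close> has only its left and lower neighbours in \<open>N\<close>.\<close>

locale last_cell =
  fixes N :: "(int \<times> int) set" and a b :: int
  assumes fin: "finite N" and last: "\<And>i j. (i, j) \<in> N \<Longrightarrow> i < a \<or> i = a \<and> j < b"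
begin

abbreviation "M \<equiv> insert (a, b) N"

lemma notin: "(a, b) \<notin> N" using last by force

lemma infinite_right:
  assumes "a < i"
  shows "infinite (comp_of adj8 (- M) (i, j))"
  using last assms by (intro infinite_ray) force

lemma infinite_adj:
  assumes "infinite (comp_of adj8 (- M) y)" "y \<notin> M" "z \<notin> M" "adj8 y z"
  shows "infinite (comp_of adj8 (- M) z)"
  using assms comp_of_adj[OF symp_adj8, of y "- M" z] by simp

lemma infinite_top: "infinite (comp_of adj8 (- M) (a, b + 1))"
  using last by (intro infinite_adj[OF infinite_right[of "a + 1" "b + 1"]]) (force simp: adj8_def)+

text \<open>The cells right of column \<open>a\<close> and the one above \<open>(a, b)\<close> lie
  in unbounded components of \<open>- M\<close>, and diagonal steps carry this to the other empty
  neighbours. Only \<open>(a - 1, b - 1)\<close> can be cut off, and only if both cells flanking it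
  are occupied.\<close>

lemma finite_touching:
  assumes y: "y \<notin> M" "adj8 (a, b) y" "finite (comp_of adj8 (- M) y)"
  shows "y = (a - 1, b - 1)" "(a - 1, b) \<in> N" "(a, b - 1) \<in> N"
proof -
  obtain i j where ij: "y = (i, j)" by force
  have top: "(a, b + 1) \<notin> M" and right: "\<And>i j. a < i \<Longrightarrow> (i, j) \<notin> M" using last by force+
  have i: "i \<le> a" using y(3) infinite_right[of i j] ij by force
  have na: "\<not> adj8 (a, b + 1) y"
    using infinite_adj[OF infinite_top top y(1)] y(3) by blast
  have nr: "\<not> adj8 (a + 1, k) y" for k
    using infinite_adj[OF infinite_right right y(1)] y(3) by fastforce
  have "i \<noteq> a" using nr[of j] ij by (auto simp: adj8_def)
  then have "i = a - 1" using i y(2) ij by (simp add: adj8_def)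
  moreover from this have "j = b - 1" using na y(2) ij by (simp add: adj8_def)
  ultimately show yd: "y = (a - 1, b - 1)" using ij by simp
  show "(a - 1, b) \<in> N"
  proof (rule ccontr)
    assume "(a - 1, b) \<notin> N"
    then have n: "(a - 1, b) \<notin> M" by simp
    have "infinite (comp_of adj8 (- M) (a - 1, b))"
      by (rule infinite_adj[OF infinite_top top n]) (simp add: adj8_def)
    from infinite_adj[OF this n y(1)] show False using y(3) yd by (simp add: adj8_def)
  qed
  show "(a, b - 1) \<in> N"
  proof (rule ccontr)
    assume "(a, b - 1) \<notin> N"
    then have n: "(a, b - 1) \<notin> M" by simp
    have "infinite (comp_of adj8 (- M) (a, b - 1))"
      by (rule infinite_adj[OF infinite_right[of "a + 1" b] right n]) (simp_all add: adj8_def)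
    from infinite_adj[OF this n y(1)] show False using y(3) yd by (simp add: adj8_def)
  qed
qed

text \<open>
  Closing a path from \<open>(a - 1, b)\<close> to \<open>(a, b - 1)\<close> through the last cell \<open>(a, b)\<close> gives a circulation
  on the edges of \<open>M\<close>. Its flux \<open>P\<close> through the vertical ray above a cell is a winding number:
  constant on the components of \<open>- M\<close>, zero far away, and \<open>- 1\<close> at \<open>(a - 1, b - 1)\<close>.
\<close>

lemma linked_encloses:
  assumes lk: "linked adj4 N (a - 1, b) (a, b - 1)" and d: "(a - 1, b - 1) \<notin> N"
  shows "finite (comp_of adj8 (- M) (a - 1, b - 1))"
proof -
  obtain H0 V0 :: "int \<Rightarrow> int \<Rightarrow> int" where
    H0: "\<And>i j. H0 i j \<noteq> 0 \<Longrightarrow> (i, j) \<in> N \<and> (i + 1, j) \<in> N" and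
    V0: "\<And>i j. V0 i j \<noteq> 0 \<Longrightarrow> (i, j) \<in> N \<and> (i, j + 1) \<in> N" and
    D0: "\<And>i j. H0 i j - H0 (i - 1) j + V0 i j - V0 i (j - 1) =
      of_bool ((i, j) = (a - 1, b)) - of_bool ((i, j) = (a, b - 1))"
    using linked_adj4_flow[OF lk] by blast
  \<comment> \<open>\<open>linked\<close> is reflexive and by itself does not place its ends in
    \<open>N\<close>. The unit source at \<open>(a - 1, b)\<close> does, since some edge at that
    cell must carry flow.\<close>
  have lN: "(a - 1, b) \<in> N \<and> (a, b - 1) \<in> N"
  proof -
    have "H0 (a - 1) b = 0" "V0 (a - 1) b = 0 \<or> (a - 1, b) \<in> N" "H0 (a - 2) b = 0 \<or> (a - 1, b) \<in> N"
      "V0 (a - 1) (b - 1) = 0 \<or> (a - 1, b) \<in> N"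
      using H0[of "a - 1" b] notin V0[of "a - 1" b] H0[of "a - 2" b] V0[of "a - 1" "b - 1"] by auto
    then have l: "(a - 1, b) \<in> N" using D0[of "a - 1" b] by auto
    then show ?thesis using linked_mem[OF lk] by simp
  qed
  \<comment> \<open>The two extra edges lead from \<open>(a, b - 1)\<close> up to
    \<open>(a, b)\<close> and then left to \<open>(a - 1, b)\<close>, so that the divergence
    vanishes everywhere.\<close>
  define H where "H i j = H0 i j - (if i = a - 1 \<and> j = b then 1 else 0)" for i j
  define V where "V i j = V0 i j + (if i = a \<and> j = b - 1 then 1 else 0)" for i j
  have H: "(i, j) \<in> M \<and> (i + 1, j) \<in> M" if "H i j \<noteq> 0" for i j
    using that H0[of i j] lN by (auto simp: H_def split: if_splits)
  have V: "(i, j) \<in> M \<and> (i, j + 1) \<in> M" if "V i j \<noteq> 0" for i j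
    using that V0[of i j] lN by (auto simp: V_def split: if_splits)
  have D: "H i j - H (i - 1) j + (V i j - V i (j - 1)) = 0" for i j
    using D0[of i j] unfolding H_def V_def
    by (cases "i = a"; cases "i = a - 1"; cases "j = b"; cases "j = b - 1"; simp)
  have finM: "finite M" using fin by simp
  define J where "J = Max (snd ` M)"
  define j0 where "j0 = Min (snd ` M)"
  define i0 where "i0 = Min (fst ` M)"
  have J: "j \<le> J" and j0: "j0 \<le> j" and i0: "i0 \<le> i" if "(i, j) \<in> M" for i j
    using that finM unfolding J_def j0_def i0_def by (force intro: Max_ge Min_le)+
  have ia: "i \<le> a" if "(i, j) \<in> M" for i j using that last by force
  \<comment> \<open>The ray starts between the rows \<open>j\<close> and \<open>j + 1\<close> and
    runs between the columns \<open>i\<close> and \<open>i + 1\<close>, so it crosses horizontal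
    edges only and meets no cell; this is why row \<open>j\<close> is left out.\<close>
  define P where "P i j = (\<Sum>k\<in>{j<..J}. H i k)" for i j
  have Pv: "P i j = P i (j + 1)" if "(i, j + 1) \<notin> M \<or> (i + 1, j + 1) \<notin> M" for i j
  proof (cases "j < J")
    case True
    then have "{j<..J} = insert (j + 1) {j + 1<..J}" by auto
    moreover have "H i (j + 1) = 0" using H that by blast
    ultimately show ?thesis by (simp add: P_def)
  qed (simp add: P_def)
  \<comment> \<open>The divergence is summed over column \<open>i + 1\<close> above row
    \<open>j\<close>. The vertical flow telescopes to its values at both ends, which vanish: row
    \<open>J + 1\<close> is empty, and so is the cell \<open>(i + 1, j)\<close>.\<close>
  have Ph: "P i j = P (i + 1) j" if "(i + 1, j) \<notin> M" for i j
  proof (cases "j \<le> J")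
    case True
    have "0 = (\<Sum>k\<in>{j<..J}. H (i + 1) k - H i k + (V (i + 1) k - V (i + 1) (k - 1)))"
      using D[of "i + 1"] by simp
    also have "\<dots> = P (i + 1) j - P i j + (V (i + 1) J - V (i + 1) j)"
      using sum_telescope_int[OF True, of "V (i + 1)"] by (simp add: P_def sum.distrib sum_subtractf)
    also have "V (i + 1) J = 0" using V[of "i + 1" J] J[of "i + 1" "J + 1"] by auto
    also have "V (i + 1) j = 0" using V[of "i + 1" j] that by auto
    finally show ?thesis by simp
  qed (simp add: P_def)
  \<comment> \<open>A diagonal step to the right is made vertically first and then sideways; the two
    empty cells rule out flow on the edges that are crossed.\<close>
  have inv_le: "P i j = P i' j'" if "(i, j) \<notin> M" "(i', j') \<notin> M" "adj8 (i, j) (i', j')" "i \<le> i'" for i j i' j'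
  proof -
    have "i' = i \<or> i' = i + 1" "j' = j - 1 \<or> j' = j \<or> j' = j + 1"
      using that by (auto simp: adj8_def)
    then show ?thesis
      using Pv[of i j] Pv[of i j'] Ph[of i j'] that by (elim disjE) auto
  qed
  have inv: "P i j = P i' j'" if "(i, j) \<notin> M" "(i', j') \<notin> M" "adj8 (i, j) (i', j')" for i j i' j'
    using inv_le[OF that] inv_le[OF that(2,1)] sympD[OF symp_adj8 that(3)] by linarith
  have far: "P i j = 0" if "i \<ge> a" for i j
    using that H ia unfolding P_def by (intro sum.neutral) (force)
  \<comment> \<open>Below all of \<open>M\<close> one can walk to the right through empty cells
    until \<open>far\<close> applies.\<close>
  have low: "P i j = 0" if "j < j0" for i j
  proof -
    have "P i j = P (i + int k) j" for k
    proof (induction k)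
      case (Suc k)
      have "(i + int k + 1, j) \<notin> M" using j0 that by force
      then show ?case using Ph[of "i + int k" j] Suc by (simp add: algebra_simps)
    qed simp
    from this[of "nat (a - i)"] show ?thesis by (cases "i \<le> a") (use far in auto)
  qed
  have box: "i0 \<le> i \<and> i \<le> a \<and> j0 \<le> j \<and> j \<le> J" if nz: "P i j \<noteq> 0" for i j
  proof -
    have "i \<le> a" using far[of i j] that by linarith
    moreover have "j0 \<le> j" using low[of j i] that by linarith
    moreover obtain k where "k \<in> {j<..J}" "H i k \<noteq> 0"
      using nz[unfolded P_def] by (rule sum.not_neutral_contains_not_neutral)
    ultimately show ?thesis using i0 H by fastforce
  qed
  \<comment> \<open>Above \<open>(a, b)\<close> column \<open>a\<close> is empty, so the ray meets
    just one edge that carries flow, the closing one from \<open>(a, b)\<close> to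
    \<open>(a - 1, b)\<close>.\<close>
  have "P (a - 1) (b - 1) = - 1"
  proof -
    have "b \<le> J" using J by blast
    then have "{b - 1<..J} = insert b {b<..J}" by auto
    moreover have "H (a - 1) b = - 1" using H0[of "a - 1" b] notin by (auto simp: H_def)
    moreover have "(\<Sum>k\<in>{b<..J}. H (a - 1) k) = 0"
    proof (intro sum.neutral ballI)
      fix k assume "k \<in> {b<..J}"
      then have "(a, k) \<notin> M" using last by force
      then show "H (a - 1) k = 0" using H[of "a - 1" k] by auto
    qed
    ultimately show ?thesis by (simp add: P_def)
  qed
  moreover have "P (fst y) (snd y) = P (a - 1) (b - 1)" if "linked adj8 (- M) (a - 1, b - 1) y" for y
    using that
  proof (induction rule: linked_induct)
    case (step y z)
    then show ?case using inv[of "fst y" "snd y" "fst z" "snd z"] by auto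
  qed simp
  ultimately have "P (fst y) (snd y) \<noteq> 0" if "y \<in> comp_of adj8 (- M) (a - 1, b - 1)" for y
    using that by (simp add: comp_of_def)
  then have "fst y \<in> {i0..a} \<and> snd y \<in> {j0..J}" if "y \<in> comp_of adj8 (- M) (a - 1, b - 1)" for y
    using box[of "fst y" "snd y"] that by simp
  then have "comp_of adj8 (- M) (a - 1, b - 1) \<subseteq> {i0..a} \<times> {j0..J}"
    by (simp add: subset_iff mem_Times_iff)
  then show ?thesis using finite_subset by blast
qed

text \<open>
  Otherwise consider the edges between the component \<open>L\<close> of \<open>(a - 1, b)\<close> and the finite component \<open>H\<close>
  of \<open>(a - 1, b - 1)\<close> in \<open>- M\<close>. Every edge lies in two \<open>2 \<times> 2\<close> blocks, but \<open>{a - 1, a} \<times> {b - 1, b}\<close>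
  would be the only block with an odd number of them.
\<close>

lemma enclosed_linked:
  assumes d: "(a - 1, b - 1) \<notin> N" and l: "(a - 1, b) \<in> N" and bN: "(a, b - 1) \<in> N"
    and finH: "finite (comp_of adj8 (- M) (a - 1, b - 1))"
  shows "linked adj4 N (a - 1, b) (a, b - 1)"
proof (rule ccontr)
  assume nl: "\<not> linked adj4 N (a - 1, b) (a, b - 1)"
  define H where "H = comp_of adj8 (- M) (a - 1, b - 1)"
  define L where "L = comp_of adj4 N (a - 1, b)"
  have HM: "H \<subseteq> - M" using comp_of_subset[of "(a - 1, b - 1)" "- M" adj8] d by (simp add: H_def)
  have LN: "L \<subseteq> N" using comp_of_subset[OF l] by (simp add: L_def)
  have Hadj: "w \<in> H" if "z \<in> H" "adj8 z w" "w \<notin> M" for z w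
  proof -
    have "linked adj8 (- M) z w" using that HM by (intro linked_step) auto
    with that(1) show ?thesis unfolding H_def comp_of_def by (auto intro: linked_trans)
  qed
  have Ladj: "w \<in> L" if "z \<in> L" "adj4 z w" "w \<in> N" for z w
  proof -
    have "linked adj4 N z w" using that LN by (intro linked_step) auto
    with that(1) show ?thesis unfolding L_def comp_of_def by (auto intro: linked_trans)
  qed
  have infH: "z \<notin> H" if "infinite (comp_of adj8 (- M) z)" for z
    using that finH comp_of_eq[OF symp_adj8, of z "- M" "(a - 1, b - 1)"] by (auto simp: H_def)
  have bL: "(a, b - 1) \<notin> L" using nl by (simp add: L_def comp_of_def)
  have lL: "(a - 1, b) \<in> L" by (simp add: L_def)
  have dH: "(a - 1, b - 1) \<in> H" by (simp add: H_def)
  define E where "E z w \<longleftrightarrow> z \<in> L \<and> w \<in> H \<or> z \<in> H \<and> w \<in> L" for z w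
  have Esym: "E z w = E w z" for z w by (auto simp: E_def)
  define EH where "EH = {(i, j). E (i, j) (i + 1, j)}"
  define EV where "EV = {(i, j). E (i, j) (i, j + 1)}"
  have finE: "finite EH" "finite EV"
  proof -
    have fH: "finite H" using finH by (simp add: H_def)
    have "EH \<subseteq> H \<union> (\<lambda>(i, j). (i - 1, j)) ` H" "EV \<subseteq> H \<union> (\<lambda>(i, j). (i, j - 1)) ` H"
      by (force simp: EH_def EV_def E_def)+
    then show "finite EH" "finite EV" using fH finite_subset by blast+
  qed
  \<comment> \<open>The four summands are the sides of the block with lower left cell
    \<open>(i, j)\<close>.\<close>
  define deg :: "int \<times> int \<Rightarrow> nat" where
    "deg = (\<lambda>(i, j). of_bool ((i, j) \<in> EH) + of_bool ((i, j + 1) \<in> EH) + of_bool ((i, j) \<in> EV) + of_bool ((i + 1, j) \<in> EV))"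
  \<comment> \<open>The single edge joins \<open>(a - 1, b - 1)\<close> to
    \<open>(a - 1, b)\<close>: the cell \<open>(a, b)\<close> lies in neither \<open>L\<close> nor
    \<open>H\<close>, and \<open>(a, b - 1)\<close> is outside \<open>L\<close> by the assumption to
    be refuted.\<close>
  have deg_d: "deg (a - 1, b - 1) = 1"
    using dH lL bL LN HM notin l bN d
    by (auto simp: deg_def EH_def EV_def E_def)
  have deg_noH: "deg (i, j) = 0"
    if "(i, j) \<notin> H" "(i + 1, j) \<notin> H" "(i, j + 1) \<notin> H" "(i + 1, j + 1) \<notin> H" for i j
    using that by (auto simp: deg_def EH_def EV_def E_def)
  have even_deg: "even (deg (i, j))" if ne: "(i, j) \<noteq> (a - 1, b - 1)" for i j
  proof (cases "(i, j) \<in> H \<or> (i + 1, j) \<in> H \<or> (i, j + 1) \<in> H \<or> (i + 1, j + 1) \<in> H")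
    case False
    then show ?thesis using deg_noH by simp
  next
    case True
    then obtain z where z: "z \<in> H" "z \<in> {i, i + 1} \<times> {j, j + 1}" by auto
    \<comment> \<open>Any two cells of a block are \<open>adj8\<close>, so \<open>H\<close> contains
      every empty cell of a block that it meets.\<close>
    have allH: "w \<in> H" if "w \<in> {i, i + 1} \<times> {j, j + 1}" "w \<notin> M" for w
      using Hadj[OF z(1) _ that(2)] z(2) that(1) by (force simp: adj8_def)
    consider "(a, b) \<notin> {i, i + 1} \<times> {j, j + 1}" | "(i, j) = (a, b)" | "(i, j) = (a - 1, b)" | "(i, j) = (a, b - 1)"
      using ne by fastforce
    then show ?thesis
    proof cases
      case 1
      \<comment> \<open>Every cell of this block is in \<open>N\<close> or \<open>H\<close>, and
        adjacent cells of \<open>N\<close> agree on membership in \<open>L\<close>. So the counted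
        edges are exactly the changes of membership in \<open>L\<close> around the block.\<close>
      have E_iff: "E z w \<longleftrightarrow> (z \<in> L) \<noteq> (w \<in> L)"
        if zw: "z \<in> {i, i + 1} \<times> {j, j + 1}" "w \<in> {i, i + 1} \<times> {j, j + 1}" "adj4 z w" for z w
      proof -
        have "z \<in> L \<or> z \<in> H \<or> z \<in> N" "w \<in> L \<or> w \<in> H \<or> w \<in> N"
          using allH[OF zw(1)] allH[OF zw(2)] zw(1,2) 1 by blast+
        moreover have "z \<in> L \<longleftrightarrow> w \<in> L" if "z \<in> N" "w \<in> N"
          using Ladj[of z w] Ladj[of w z] zw(3) sympD[OF symp_adj4 zw(3)] that by blast
        ultimately show ?thesis using LN HM unfolding E_def by blast
      qed
      have "deg (i, j) = of_bool (((i, j) \<in> L) \<noteq> ((i + 1, j) \<in> L)) +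
          of_bool (((i + 1, j) \<in> L) \<noteq> ((i + 1, j + 1) \<in> L)) +
          of_bool (((i + 1, j + 1) \<in> L) \<noteq> ((i, j + 1) \<in> L)) +
          of_bool (((i, j + 1) \<in> L) \<noteq> ((i, j) \<in> L))"
        using E_iff[of "(i, j)" "(i + 1, j)"] E_iff[of "(i + 1, j)" "(i + 1, j + 1)"]
          E_iff[of "(i, j + 1)" "(i + 1, j + 1)"] E_iff[of "(i, j)" "(i, j + 1)"]
        by (simp add: deg_def EH_def EV_def adj4_def eq_commute)
      then show ?thesis using even_cyclic_changes by simp
    next
      case 2
      have "w \<notin> N" if "w \<in> {i, i + 1} \<times> {j, j + 1}" for w
        using 2 that last[of "fst w" "snd w"] by auto
      then have "w \<notin> L" if "w \<in> {i, i + 1} \<times> {j, j + 1}" for w using that LN by blast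
      then have "deg (i, j) = 0" by (simp add: deg_def EH_def EV_def E_def)
      then show ?thesis by simp
    next
      case 3
      have "(a, b + 1) \<notin> M" using last by force
      moreover have "(a, b + 1) \<notin> H" using infH infinite_top by blast
      ultimately show ?thesis using allH[of "(a, b + 1)"] 3 by simp
    next
      case 4
      have "(a + 1, b) \<notin> M" using last by force
      moreover have "(a + 1, b) \<notin> H" using infH infinite_right[of "a + 1" b] by simp
      ultimately show ?thesis using allH[of "(a + 1, b)"] 4 by simp
    qed
  qed
  \<comment> \<open>Both blocks containing an edge must be in \<open>Z\<close>, so that each edge is
    counted twice; the exceptional block is included in order to be split off.\<close>
  define Z where "Z = insert (a - 1, b - 1) (EH \<union> (\<lambda>(i, j). (i, j - 1)) ` EH \<union> EV \<union> (\<lambda>(i, j). (i - 1, j)) ` EV)"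
  have finZ: "finite Z" using finE by (simp add: Z_def)
  have sum_shift: "(\<Sum>z\<in>Z. of_bool (f z \<in> X) :: nat) = card X"
    if "inj f" "g ` X \<subseteq> Z" "\<And>z. f (g z) = z" for X and f g :: "int \<times> int \<Rightarrow> int \<times> int"
  proof -
    have "g (f z) = z" for z using that(1) that(3)[of "f z"] by (rule injD)
    then have "z \<in> g ` X" if "f z \<in> X" for z using that by (metis imageI)
    then have "Z \<inter> {z. f z \<in> X} = g ` X" using that(2,3) by auto
    moreover have "card (g ` X) = card X" using that(3) by (intro card_image inj_onI) metis
    ultimately show ?thesis using finZ by (simp add: Int_def of_bool_def sum.If_cases)
  qed
  have "(\<Sum>(i, j)\<in>Z. deg (i, j)) = (\<Sum>z\<in>Z. of_bool (z \<in> EH) + of_bool ((\<lambda>(i, j). (i, j + 1)) z \<in> EH)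
      + of_bool (z \<in> EV) + of_bool ((\<lambda>(i, j). (i + 1, j)) z \<in> EV))"
    by (intro sum.cong) (auto simp: deg_def)
  also have "\<dots> = card EH + card EH + card EV + card EV"
    unfolding sum.distrib
    by (intro arg_cong2[where f="(+)"] sum_shift[of "\<lambda>z. z" "\<lambda>z. z"]
        sum_shift[of "\<lambda>(i, j). (i, j + 1)" "\<lambda>(i, j). (i, j - 1)"]
        sum_shift[of "\<lambda>(i, j). (i + 1, j)" "\<lambda>(i, j). (i - 1, j)"])
      (auto simp: Z_def inj_def)
  finally have "even (\<Sum>z\<in>Z. deg z)" by (simp add: case_prod_beta)
  moreover have "(\<Sum>z\<in>Z. deg z) = deg (a - 1, b - 1) + (\<Sum>z\<in>Z - {(a - 1, b - 1)}. deg z)"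
    using finZ by (intro sum.remove) (simp_all add: Z_def)
  moreover have "even (\<Sum>z\<in>Z - {(a - 1, b - 1)}. deg z)"
    by (intro dvd_sum) (use even_deg in auto)
  ultimately show False using deg_d by simp
qed

end

section \<open>Edges and squares spanned by a set of cells\<close>

definition hedges :: "(int \<times> int) set \<Rightarrow> (int \<times> int) set" where
  "hedges M = {(i, j). (i, j) \<in> M \<and> (i + 1, j) \<in> M}"

definition vedges :: "(int \<times> int) set \<Rightarrow> (int \<times> int) set" where
  "vedges M = {(i, j). (i, j) \<in> M \<and> (i, j + 1) \<in> M}"

definition squares :: "(int \<times> int) set \<Rightarrow> (int \<times> int) set" where
  "squares M = {(i, j). (i, j) \<in> M \<and> (i + 1, j) \<in> M \<and> (i, j + 1) \<in> M \<and> (i + 1, j + 1) \<in> M}"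

definition cell_euler :: "(int \<times> int) set \<Rightarrow> int" where
  "cell_euler M = int (card M) - int (card (hedges M)) - int (card (vedges M)) + int (card (squares M))"

lemma finite_cells:
  assumes "finite M"
  shows "finite (hedges M)" "finite (vedges M)" "finite (squares M)"
  by (rule finite_subset[OF _ assms], force simp: hedges_def vedges_def squares_def)+

context last_cell
begin

text \<open>Being last, \<open>(a, b)\<close> brings in only the edges to its left and lower
  neighbours and the square between them. Edges are indexed by their left or lower end, squares by
  their lower left cell.\<close>

lemma cell_euler_insert:
  "cell_euler M = cell_euler N + 1 - of_bool ((a - 1, b) \<in> N) - of_bool ((a, b - 1) \<in> N)
     + of_bool ((a - 1, b) \<in> N \<and> (a, b - 1) \<in> N \<and> (a - 1, b - 1) \<in> N)"
proof -
  have out: "(a, j) \<notin> N" if "b \<le> j" for j using that last[of a j] by linarith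
  have out': "(i, j) \<notin> N" if "a < i" for i j using that last[of i j] by linarith
  have e: "hedges M = (if (a - 1, b) \<in> N then insert (a - 1, b) (hedges N) else hedges N)"
    using out out' unfolding hedges_def by (auto simp: algebra_simps)
  have "(a - 1, b) \<notin> hedges N" using out by (simp add: hedges_def)
  with e have h: "int (card (hedges M)) = int (card (hedges N)) + of_bool ((a - 1, b) \<in> N)"
    using finite_cells[OF fin] by simp
  have e: "vedges M = (if (a, b - 1) \<in> N then insert (a, b - 1) (vedges N) else vedges N)"
    using out out' unfolding vedges_def by (auto simp: algebra_simps)
  have "(a, b - 1) \<notin> vedges N" using out by (simp add: vedges_def)
  with e have v: "int (card (vedges M)) = int (card (vedges N)) + of_bool ((a, b - 1) \<in> N)"
    using finite_cells[OF fin] by simp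
  have e: "squares M = (if (a - 1, b) \<in> N \<and> (a, b - 1) \<in> N \<and> (a - 1, b - 1) \<in> N
      then insert (a - 1, b - 1) (squares N) else squares N)"
  proof -
    have "(i, j) \<in> squares M \<longleftrightarrow> (i, j) \<in> squares N \<or>
        (i = a - 1 \<and> j = b - 1 \<and> (a - 1, b) \<in> N \<and> (a, b - 1) \<in> N \<and> (a - 1, b - 1) \<in> N)" for i j
    proof -
      consider "a \<le> i" | "i < a - 1" | "i = a - 1" "j = b" | "i = a - 1" "j = b - 1"
        | "i = a - 1" "j \<noteq> b" "j + 1 \<noteq> b" by linarith
      then show ?thesis
        by cases (use out[of b] out[of "b + 1"] out'[of "i + 1" j] in \<open>auto simp: squares_def\<close>)
    qed
    then show ?thesis by auto
  qed
  have "(a - 1, b - 1) \<notin> squares N" using out by (simp add: squares_def)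
  with e have s: "int (card (squares M)) = int (card (squares N)) +
      of_bool ((a - 1, b) \<in> N \<and> (a, b - 1) \<in> N \<and> (a - 1, b - 1) \<in> N)"
    using finite_cells[OF fin] by simp
  have "int (card M) = int (card N) + 1" using fin notin by simp
  then show ?thesis unfolding cell_euler_def h v s by linarith
qed

lemma components_insert:
  "int (card (comps adj4 M)) = int (card (comps adj4 N)) + 1
     - of_bool ((a - 1, b) \<in> N) - of_bool ((a, b - 1) \<in> N)
     + of_bool ((a - 1, b) \<in> N \<and> (a, b - 1) \<in> N \<and> linked adj4 N (a - 1, b) (a, b - 1))"
proof -
  have nbrs: "{y \<in> N. adj4 (a, b) y} = {(a - 1, b), (a, b - 1)} \<inter> N"
  proof -
    have "y \<in> {(a - 1, b), (a, b - 1)}" if "y \<in> N" "adj4 (a, b) y" for y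
      using last[of "fst y" "snd y"] that unfolding adj4_def by (cases y) auto
    then show ?thesis by (auto simp: adj4_def)
  qed
  have "comp_of adj4 N (a - 1, b) = comp_of adj4 N (a, b - 1) \<longleftrightarrow> linked adj4 N (a - 1, b) (a, b - 1)"
  proof
    assume "comp_of adj4 N (a - 1, b) = comp_of adj4 N (a, b - 1)"
    then have "(a, b - 1) \<in> comp_of adj4 N (a - 1, b)" by simp
    then show "linked adj4 N (a - 1, b) (a, b - 1)" by (simp add: comp_of_def)
  next
    assume "linked adj4 N (a - 1, b) (a, b - 1)"
    then show "comp_of adj4 N (a - 1, b) = comp_of adj4 N (a, b - 1)"
      by (intro comp_of_eq[OF symp_adj4, symmetric]) (simp add: comp_of_def)
  qed
  then have "int (card (comp_of adj4 N ` {y \<in> N. adj4 (a, b) y})) =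
    of_bool ((a - 1, b) \<in> N) + of_bool ((a, b - 1) \<in> N)
     - of_bool ((a - 1, b) \<in> N \<and> (a, b - 1) \<in> N \<and> linked adj4 N (a - 1, b) (a, b - 1))"
    unfolding nbrs by (cases "(a - 1, b) \<in> N"; cases "(a, b - 1) \<in> N") (simp_all add: Int_insert_left card_insert_if)
  then show ?thesis using card_comps_insert[OF symp_adj4 notin fin] by simp
qed

text \<open>From \<open>- M\<close> to \<open>- N\<close> it is \<open>(a, b)\<close> that is added,
  so \<open>comps_insert\<close> is read backwards. The component of \<open>(a, b)\<close> in
  \<open>- N\<close> reaches the unbounded part above it and is no hole; a hole of \<open>M\<close>
  is absorbed only if it touches \<open>(a, b)\<close>, and \<open>finite_touching\<close> leaves
  one candidate.\<close>

lemma holes_insert: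
  assumes "finite (holes N)"
  shows "finite (holes M)"
    and "int (card (holes M)) = int (card (holes N)) + of_bool ((a - 1, b) \<in> N \<and> (a, b - 1) \<in> N
      \<and> (a - 1, b - 1) \<notin> N \<and> finite (comp_of adj8 (- M) (a - 1, b - 1)))"
proof -
  have ins: "- N = insert (a, b) (- M)" and nm: "(a, b) \<notin> - M" using notin by auto
  have inf: "infinite (comp_of adj8 (- N) (a, b))"
  proof -
    have "(a, b + 1) \<notin> M" using last by force
    then have "comp_of adj8 (- M) (a, b + 1) \<subseteq> comp_of adj8 (- N) (a, b)"
      unfolding ins comps_insert(2)[OF symp_adj8 nm] comps_def
      by (intro subset_insertI2 Union_upper) (auto simp: adj8_def intro!: bexI[of _ "(a, b + 1)"])
    then show ?thesis using infinite_top finite_subset by blast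
  qed
  define T where "T = {C \<in> holes M. \<exists>y\<in>C. adj8 (a, b) y}"
  let ?c = "(a - 1, b) \<in> N \<and> (a, b - 1) \<in> N \<and> (a - 1, b - 1) \<notin> N \<and> finite (comp_of adj8 (- M) (a - 1, b - 1))"
  have far: "holes N = {C \<in> holes M. \<not> (\<exists>y\<in>C. adj8 (a, b) y)}"
    using inf comps_insert(1)[OF symp_adj8 nm] unfolding holes_def ins by auto
  have "T = {C \<in> comp_of adj8 (- M) ` {y \<in> - M. adj8 (a, b) y}. finite C}"
    unfolding T_def holes_def comps_touching[OF symp_adj8, symmetric] by auto
  also have "\<dots> = (if ?c then {comp_of adj8 (- M) (a - 1, b - 1)} else {})"
  proof -
    have 1: "y = (a - 1, b - 1) \<and> ?c"
      if "y \<in> - M" "adj8 (a, b) y" "finite (comp_of adj8 (- M) y)" for y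
      using finite_touching[of y] that by blast
    have 2: "adj8 (a, b) (a - 1, b - 1)" by (simp add: adj8_def)
    show ?thesis
    proof (cases ?c)
      case True
      then have "(a - 1, b - 1) \<in> - M" by simp
      then show ?thesis using 1 2 True unfolding if_P[OF True] by blast
    next
      case False
      then show ?thesis using 1 unfolding if_not_P[OF False] by blast
    qed
  qed
  finally have T: "T = (if ?c then {comp_of adj8 (- M) (a - 1, b - 1)} else {})" .
  have U: "holes M = holes N \<union> T" "holes N \<inter> T = {}" unfolding far T_def by auto
  show "finite (holes M)" using U(1) T assms by simp
  have "card (holes M) = card (holes N) + card T"
    unfolding U(1) by (rule card_Un_disjoint[OF assms _ U(2)]) (simp add: T)
  then show "int (card (holes M)) = int (card (holes N)) + of_bool ?c" using T by simp
qed

end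

text \<open>When the last cell is put next to two occupied neighbours that are already linked, a
  loop closes. If the diagonal cell is occupied, a square fills the corner; otherwise a hole is
  enclosed. Either way both sides change by the same amount.\<close>

theorem components_minus_holes:
  assumes "finite M"
  shows "finite (holes M) \<and> int (card (comps adj4 M)) - int (card (holes M)) = cell_euler M"
  using assms
proof (induction rule: finite_psubset_induct)
  case (psubset M)
  show ?case
  proof (cases "M = {}")
    case True
    have "infinite (comp_of adj8 UNIV z)" for z
      using infinite_ray[of "fst z" "snd z" UNIV] by simp
    then have "holes {} = {}" by (auto simp: holes_def comps_def)
    then show ?thesis
      using True by (simp add: cell_euler_def comps_def hedges_def vedges_def squares_def)
  next
    case False
    define a where "a = Max (fst ` M)"
    define b where "b = Max {j. (a, j) \<in> M}"
    have a: "i \<le> a" if "(i, j) \<in> M" for i j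
      using that psubset(1) unfolding a_def by (force intro: Max_ge)
    have "{j. (a, j) \<in> M} = snd ` (M \<inter> {a} \<times> UNIV)" by force
    then have fb: "finite {j. (a, j) \<in> M}" using psubset(1) by simp
    have "a \<in> fst ` M" using psubset(1) False unfolding a_def by (intro Max_in) auto
    then have "{j. (a, j) \<in> M} \<noteq> {}" by force
    then have ab: "(a, b) \<in> M" using Max_in[OF fb] unfolding b_def by blast
    have b: "j \<le> b" if "(a, j) \<in> M" for j using that fb unfolding b_def by (auto intro: Max_ge)
    define N where "N = M - {(a, b)}"
    interpret last_cell N a b
    proof
      show "finite N" using psubset(1) by (simp add: N_def)
      show "i < a \<or> i = a \<and> j < b" if "(i, j) \<in> N" for i j
        using that a[of i j] b[of j] unfolding N_def by (cases "i = a") auto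
    qed
    have M: "M = insert (a, b) N" using ab by (auto simp: N_def)
    have IH: "finite (holes N)" "int (card (comps adj4 N)) - int (card (holes N)) = cell_euler N"
      using psubset(2)[of N] ab by (auto simp: N_def)
    have F1: "linked adj4 N (a - 1, b) (a, b - 1)"
      if "(a - 1, b) \<in> N" "(a, b - 1) \<in> N" "(a - 1, b - 1) \<in> N"
      by (rule linked_trans[OF linked_step[OF that(1,3)] linked_step[OF that(3,2)]]) (simp_all add: adj4_def)
    have F2: "linked adj4 N (a - 1, b) (a, b - 1) \<longleftrightarrow> finite (comp_of adj8 (- insert (a, b) N) (a - 1, b - 1))"
      if "(a - 1, b) \<in> N" "(a, b - 1) \<in> N" "(a - 1, b - 1) \<notin> N"
      using linked_encloses[OF _ that(3)] enclosed_linked[OF that(3,1,2)] by blast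
    have "(of_bool ((a - 1, b) \<in> N \<and> (a, b - 1) \<in> N \<and> linked adj4 N (a - 1, b) (a, b - 1)) :: int)
      = of_bool ((a - 1, b) \<in> N \<and> (a, b - 1) \<in> N \<and> (a - 1, b - 1) \<in> N)
        + of_bool ((a - 1, b) \<in> N \<and> (a, b - 1) \<in> N \<and> (a - 1, b - 1) \<notin> N
          \<and> finite (comp_of adj8 (- insert (a, b) N) (a - 1, b - 1)))"
    proof (cases "(a - 1, b) \<in> N \<and> (a, b - 1) \<in> N")
      case True
      then show ?thesis
      proof (cases "(a - 1, b - 1) \<in> N")
        case True
        with \<open>_ \<and> _\<close> F1 show ?thesis by simp
      next
        case False
        with \<open>_ \<and> _\<close> F2 show ?thesis by simp
      qed
    qed auto
    then have "int (card (comps adj4 (insert (a, b) N))) - int (card (holes (insert (a, b) N))) = cell_euler (insert (a, b) N)"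
      unfolding cell_euler_insert components_insert holes_insert(2)[OF IH(1)] using IH(2) by linarith
    then show ?thesis using M holes_insert(1)[OF IH(1)] by simp
  qed
qed

definition no_cross :: "(int \<times> int) set \<Rightarrow> bool" where
  "no_cross M \<longleftrightarrow> (\<forall>i j i' j'. \<bar>i - i'\<bar> = 1 \<and> \<bar>j - j'\<bar> = 1 \<and> (i, j) \<in> M \<and> (i', j') \<in> M
     \<longrightarrow> (i, j') \<in> M \<or> (i', j) \<in> M)"

text \<open>The other two cells of a block crossed by a diagonal step in \<open>- M\<close> cannot
  both be in \<open>M\<close>, so one of them provides a detour by side steps.\<close>

lemma comps_adj8_eq_adj4:
  assumes "no_cross M"
  shows "comps adj8 (- M) = comps adj4 (- M)"
proof (rule comps_cong)
  fix x y assume xy: "x \<in> - M" "y \<in> - M" "adj8 x y"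
  obtain i j i' j' where ij: "x = (i, j)" "y = (i', j')" by force
  show "linked adj4 (- M) x y"
  proof (cases "adj4 x y")
    case True
    with xy(1,2) show ?thesis by (rule linked_step)
  next
    case False
    then have d: "\<bar>i - i'\<bar> = 1" "\<bar>j - j'\<bar> = 1" using xy(3) ij by (auto simp: adj4_def adj8_def)
    then have "(i, j') \<notin> M \<or> (i', j) \<notin> M"
      using assms[unfolded no_cross_def, rule_format, of i i' j' j] xy ij by (auto simp: abs_minus_commute)
    then obtain z where "z \<in> - M" "adj4 x z" "adj4 z y"
      using d ij unfolding adj4_def by fastforce
    then show ?thesis using linked_trans[OF linked_step linked_step] xy by metis
  qed
next
  fix x y assume "x \<in> - M" "y \<in> - M" "adj4 x y"
  then show "linked adj8 (- M) x y" by (intro linked_step) (auto simp: adj4_def adj8_def)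
qed

text \<open>The positive terms count the cells that start no edge; the negative ones, shifted by
  \<open>(1, 1)\<close>, count the cells that start two edges but no full square. Inclusion and
  exclusion for \<open>?h\<close> and \<open>?v\<close> does the rest.\<close>

lemma sum_corners_eq_cell_euler:
  assumes M: "finite M" "no_cross M" and Z: "finite Z" "M \<subseteq> Z"
    "\<And>i j. (i - 1, j) \<in> M \<Longrightarrow> (i, j - 1) \<in> M \<Longrightarrow> (i, j) \<in> Z"
  shows "(\<Sum>(i, j)\<in>Z. of_bool ((i, j) \<in> M \<and> (i + 1, j) \<notin> M \<and> (i, j + 1) \<notin> M)
     - of_bool ((i, j) \<notin> M \<and> (i - 1, j) \<in> M \<and> (i, j - 1) \<in> M)) = cell_euler M"
proof -
  let ?h = "hedges M" and ?v = "vedges M" and ?s = "squares M"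
  have sub: "?h \<union> ?v \<subseteq> M" "?s \<subseteq> ?h \<inter> ?v" by (auto simp: hedges_def vedges_def squares_def)
  note fin = finite_cells[OF M(1)] M(1)
  have "(\<Sum>(i, j)\<in>Z. of_bool ((i, j) \<in> M \<and> (i + 1, j) \<notin> M \<and> (i, j + 1) \<notin> M) :: int)
      = int (card (M - (?h \<union> ?v)))"
  proof -
    have "M - (?h \<union> ?v) = Z \<inter> {(i, j). (i, j) \<in> M \<and> (i + 1, j) \<notin> M \<and> (i, j + 1) \<notin> M}"
      using Z(2) by (auto simp: hedges_def vedges_def)
    then show ?thesis using Z(1) by (simp add: case_prod_beta')
  qed
  moreover have "(\<Sum>(i, j)\<in>Z. of_bool ((i, j) \<notin> M \<and> (i - 1, j) \<in> M \<and> (i, j - 1) \<in> M) :: int)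
      = int (card (?h \<inter> ?v - ?s))"
  proof -
    have "(\<lambda>(i, j). (i + 1, j + 1)) ` (?h \<inter> ?v - ?s) =
        Z \<inter> {(i, j). (i, j) \<notin> M \<and> (i - 1, j) \<in> M \<and> (i, j - 1) \<in> M}"
    proof (intro equalityI subsetI)
      fix z assume "z \<in> Z \<inter> {(i, j). (i, j) \<notin> M \<and> (i - 1, j) \<in> M \<and> (i, j - 1) \<in> M}"
      then obtain i j where z: "z = (i, j)" "(i, j) \<notin> M" "(i - 1, j) \<in> M" "(i, j - 1) \<in> M" by auto
      \<comment> \<open>As \<open>(i, j)\<close> is missing, \<open>no_cross\<close> forces the
        opposite cell of the block to be present.\<close>
      then have "(i - 1, j - 1) \<in> M"
        using M(2)[unfolded no_cross_def, rule_format, of "i - 1" i j "j - 1"] by auto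
      then have "(i - 1, j - 1) \<in> ?h \<inter> ?v - ?s"
        using z by (auto simp: hedges_def vedges_def squares_def)
      then show "z \<in> (\<lambda>(i, j). (i + 1, j + 1)) ` (?h \<inter> ?v - ?s)"
        using z by (intro image_eqI[of _ _ "(i - 1, j - 1)"]) auto
    next
      fix z assume "z \<in> (\<lambda>(i, j). (i + 1, j + 1)) ` (?h \<inter> ?v - ?s)"
      then obtain i j where z: "z = (i + 1, j + 1)" "(i, j) \<in> ?h \<inter> ?v - ?s" by auto
      then have "(i + 1, j + 1) \<notin> M" "(i + 1 - 1, j + 1) \<in> M" "(i + 1, j + 1 - 1) \<in> M"
        by (simp_all add: hedges_def vedges_def squares_def)
      then show "z \<in> Z \<inter> {(i, j). (i, j) \<notin> M \<and> (i - 1, j) \<in> M \<and> (i, j - 1) \<in> M}"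
        using Z(3)[of "i + 1" "j + 1"] z(1) by simp
    qed
    moreover have "card ((\<lambda>(i, j). (i + 1, j + 1)) ` (?h \<inter> ?v - ?s)) = card (?h \<inter> ?v - ?s)"
      by (intro card_image inj_onI) auto
    ultimately show ?thesis using Z(1) by (simp add: case_prod_beta')
  qed
  moreover have "card (M - (?h \<union> ?v)) = card M - card (?h \<union> ?v)" "card (?h \<union> ?v) \<le> card M"
    using sub(1) fin by (auto intro!: card_Diff_subset card_mono)
  moreover have "card (?h \<union> ?v) + card (?h \<inter> ?v) = card ?h + card ?v"
    using card_Un_Int[OF fin(1,2)] by simp
  moreover have "card (?h \<inter> ?v - ?s) = card (?h \<inter> ?v) - card ?s" "card ?s \<le> card (?h \<inter> ?v)"
    using sub(2) fin by (auto intro!: card_Diff_subset card_mono)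
  ultimately show ?thesis unfolding cell_euler_def
    by (simp add: case_prod_beta' sum_subtractf)
qed

section \<open>Tame sets\<close>

lemma dist_le_sum: "dist u v \<le> \<bar>fst u - fst v\<bar> + \<bar>snd u - snd v\<bar>" for u v :: plane
  unfolding dist_prod_def dist_real_def by (rule order_trans[OF sqrt_sum_squares_le_sum_abs]) simp

section \<open>Grid points in integer coordinates\<close>

definition near :: "real \<Rightarrow> plane \<Rightarrow> plane \<Rightarrow> bool" where
  "near \<epsilon> x y \<longleftrightarrow> x = y \<or> dist x y = \<epsilon>"

lemma symp_near: "symp (near \<epsilon>)"
  by (auto simp: symp_def near_def dist_commute)

lemma grid_components_eq_comps: "grid_components \<epsilon> M = comps (near \<epsilon>) M"
proof -
  have "grid_step \<epsilon> M = (\<lambda>x y. x \<in> M \<and> y \<in> M \<and> near \<epsilon> x y)"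
    by (simp add: grid_step_def near_def fun_eq_iff)
  then show ?thesis by (auto simp: grid_components_def comps_def comp_of_def linked_def)
qed

definition node :: "real \<Rightarrow> int \<times> int \<Rightarrow> plane" where
  "node \<epsilon> z = (\<epsilon> * of_int (fst z), \<epsilon> * of_int (snd z))"

lemma grid_eq_range_node: "grid \<epsilon> = range (node \<epsilon>)"
proof (intro equalityI subsetI)
  fix x assume "x \<in> grid \<epsilon>"
  then obtain i j :: int where "x = (\<epsilon> * of_int i, \<epsilon> * of_int j)" by (auto simp: grid_def)
  then have "x = node \<epsilon> (i, j)" by (simp add: node_def)
  then show "x \<in> range (node \<epsilon>)" by blast
qed (auto simp: grid_def node_def)

lemma inj_node: "\<epsilon> > 0 \<Longrightarrow> inj (node \<epsilon>)"
  by (auto simp: inj_def node_def)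

lemma near_node:
  assumes "\<epsilon> > 0"
  shows "near \<epsilon> (node \<epsilon> z) (node \<epsilon> w) \<longleftrightarrow> adj4 z w"
proof -
  define m n where "m = fst z - fst w" and "n = snd z - snd w"
  have "dist (node \<epsilon> z) (node \<epsilon> w) = sqrt ((\<epsilon> * of_int m)\<^sup>2 + (\<epsilon> * of_int n)\<^sup>2)"
    by (simp add: node_def m_def n_def dist_prod_def dist_real_def right_diff_distrib)
  also have "\<dots> = sqrt (\<epsilon>\<^sup>2 * of_int (m\<^sup>2 + n\<^sup>2))"
    by (simp add: power_mult_distrib distrib_left)
  also have "\<dots> = \<epsilon> * sqrt (of_int (m\<^sup>2 + n\<^sup>2))"
    using assms by (simp add: real_sqrt_mult)
  finally have "dist (node \<epsilon> z) (node \<epsilon> w) = \<epsilon> \<longleftrightarrow> sqrt (of_int (m\<^sup>2 + n\<^sup>2)) = 1"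
    using assms by simp
  also have "\<dots> \<longleftrightarrow> real_of_int (m\<^sup>2 + n\<^sup>2) = 1" by (rule real_sqrt_eq_1_iff)
  also have "\<dots> \<longleftrightarrow> m\<^sup>2 + n\<^sup>2 = 1" by linarith
  also have "\<dots> \<longleftrightarrow> \<bar>m\<bar> + \<bar>n\<bar> = 1"
  proof
    assume eq: "m\<^sup>2 + n\<^sup>2 = 1"
    have "\<bar>m\<bar> \<le> m\<^sup>2" "\<bar>n\<bar> \<le> n\<^sup>2"
      using mult_le_cancel_left1[of "\<bar>m\<bar>" "\<bar>m\<bar>"] mult_le_cancel_left1[of "\<bar>n\<bar>" "\<bar>n\<bar>"]
      by (auto simp: power2_eq_square abs_mult_self_eq)
    moreover have "m \<noteq> 0 \<or> n \<noteq> 0" using eq by auto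
    ultimately show "\<bar>m\<bar> + \<bar>n\<bar> = 1" using eq by linarith
  next
    assume "\<bar>m\<bar> + \<bar>n\<bar> = 1"
    then have "m = 0 \<and> \<bar>n\<bar> = 1 \<or> n = 0 \<and> \<bar>m\<bar> = 1" by linarith
    then show "m\<^sup>2 + n\<^sup>2 = 1" by (auto simp: abs_square_eq_1)
  qed
  finally have d: "dist (node \<epsilon> z) (node \<epsilon> w) = \<epsilon> \<longleftrightarrow> \<bar>m\<bar> + \<bar>n\<bar> = 1" .
  have "node \<epsilon> z = node \<epsilon> w \<longleftrightarrow> m = 0 \<and> n = 0"
    unfolding inj_eq[OF inj_node[OF assms]] by (auto simp: m_def n_def prod_eq_iff)
  then show ?thesis unfolding near_def d adj4_def m_def n_def by auto
qed

lemma finite_bounded_Int_grid: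
  assumes "bounded X" "\<epsilon> > 0"
  shows "finite (X \<inter> grid \<epsilon>)"
proof -
  obtain R where R: "\<And>x. x \<in> X \<Longrightarrow> norm x \<le> R" using assms(1) by (auto simp: bounded_iff)
  define n where "n = \<lceil>R / \<epsilon>\<rceil>"
  have bd: "\<bar>i\<bar> \<le> n" if "\<epsilon> * \<bar>of_int i\<bar> \<le> R" for i
  proof -
    have "of_int \<bar>i\<bar> \<le> R / \<epsilon>" using that assms(2) by (simp add: field_simps)
    then show ?thesis unfolding n_def by linarith
  qed
  have "X \<inter> grid \<epsilon> \<subseteq> node \<epsilon> ` ({-n..n} \<times> {-n..n})"
  proof
    fix x assume x: "x \<in> X \<inter> grid \<epsilon>"
    then obtain z where z: "x = node \<epsilon> z" by (auto simp: grid_eq_range_node)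
    have "\<bar>fst x\<bar> \<le> R" "\<bar>snd x\<bar> \<le> R"
      using R[of x] x norm_fst_le[of "fst x" "snd x"] norm_snd_le[of "snd x" "fst x"] by force+
    then have "\<bar>fst z\<bar> \<le> n" "\<bar>snd z\<bar> \<le> n"
      using assms(2) by (auto intro!: bd simp: z node_def abs_mult)
    then show "x \<in> node \<epsilon> ` ({-n..n} \<times> {-n..n})"
      unfolding z by (intro imageI) (auto simp: mem_Times_iff abs_le_iff)
  qed
  then show ?thesis using finite_subset by blast
qed

section \<open>Tameness in small boxes\<close>

definition grid_connected :: "real \<Rightarrow> plane set \<Rightarrow> bool" where
  "grid_connected \<epsilon> X \<longleftrightarrow> (\<forall>u\<in>X. \<forall>v\<in>X. linked (near \<epsilon>) X u v)"

definition half_tame :: "plane set \<Rightarrow> plane set \<Rightarrow> real \<Rightarrow> bool" where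
  "half_tame S B e \<longleftrightarrow> path_connected (S \<inter> B) \<and>
     (\<forall>\<epsilon> p. 0 < \<epsilon> \<and> \<epsilon> < e \<longrightarrow> grid_connected \<epsilon> (S \<inter> B \<inter> translate p (grid \<epsilon>)) \<and>
        (S \<inter> B \<noteq> {} \<longrightarrow> S \<inter> B \<inter> translate p (grid \<epsilon>) \<noteq> {}))"

text \<open>The rectangle spanned by the two diagonal points need not be a grid square, which frees
  the condition from the mesh.\<close>

definition crossfree :: "plane set \<Rightarrow> plane set \<Rightarrow> bool" where
  "crossfree A B \<longleftrightarrow> (\<forall>x y x' y'. {x, x'} \<times> {y, y'} \<subseteq> B \<and> (x, y) \<in> A \<and> (x', y') \<in> A
     \<longrightarrow> (x, y') \<in> A \<or> (x', y) \<in> A)"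

definition tame_box :: "plane set \<Rightarrow> plane set \<Rightarrow> real \<Rightarrow> bool" where
  "tame_box A B e \<longleftrightarrow> half_tame A B e \<and> half_tame (- A) B e \<and> crossfree A B"

definition tame_within :: "plane set \<Rightarrow> plane \<Rightarrow> real \<Rightarrow> real \<Rightarrow> bool" where
  "tame_within A p r s \<longleftrightarrow> (\<exists>B. ball p r \<subseteq> B \<and> (\<forall>u\<in>B. \<forall>v\<in>B. dist u v < s) \<and> tame_box A B r)"

text \<open>A single \<open>r\<close>, uniform in \<open>p\<close>, is both the radius covered by
  the box and the bound on the mesh.\<close>

definition tame :: "plane set \<Rightarrow> bool" where
  "tame A \<longleftrightarrow> (\<forall>s>0. \<exists>r>0. \<forall>p. tame_within A p r s)"

lemma translate_translate: "translate x (translate y A) = translate (y + x) A"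
  by (auto simp: translate_def image_image add.assoc)

lemma translate_0 [simp]: "translate 0 A = A"
  by (simp add: translate_def)

lemma mem_translate: "y \<in> translate x A \<longleftrightarrow> y - x \<in> A"
  by (force simp: translate_def)

lemma translate_Compl: "translate x (- A) = - translate x A"
  by (auto simp: mem_translate)

section \<open>Symmetries that preserve tameness\<close>

definition plane_sym :: "(plane \<Rightarrow> plane) \<Rightarrow> bool" where
  "plane_sym T \<longleftrightarrow> bij T \<and> (\<forall>u v. dist (T u) (T v) = dist u v) \<and>
     (\<forall>\<epsilon> p. \<exists>q. translate p (grid \<epsilon>) = T ` translate q (grid \<epsilon>)) \<and>
     (\<forall>A B. crossfree A B \<longrightarrow> crossfree (T ` A) (T ` B))"

lemma half_tame_image:
  assumes T: "plane_sym T" and h: "half_tame S B e"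
  shows "half_tame (T ` S) (T ` B) e"
proof -
  have inj: "inj T" and iso: "\<And>u v. dist (T u) (T v) = dist u v"
    using T bij_is_inj by (auto simp: plane_sym_def)
  have Int: "T ` S \<inter> T ` B = T ` (S \<inter> B)" using inj by (simp add: image_Int)
  have "continuous_on X T" for X
    by (intro continuous_onI) (use iso in auto)
  then have "path_connected (T ` S \<inter> T ` B)"
    unfolding Int using h by (intro path_connected_continuous_image) (auto simp: half_tame_def)
  moreover have "grid_connected \<epsilon> (T ` S \<inter> T ` B \<inter> translate p (grid \<epsilon>)) \<and>
      (T ` S \<inter> T ` B \<noteq> {} \<longrightarrow> T ` S \<inter> T ` B \<inter> translate p (grid \<epsilon>) \<noteq> {})"
    if \<epsilon>: "0 < \<epsilon> \<and> \<epsilon> < e" for \<epsilon> p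
  proof -
    obtain q where q: "translate p (grid \<epsilon>) = T ` translate q (grid \<epsilon>)"
      using T unfolding plane_sym_def by blast
    define X where "X = S \<inter> B \<inter> translate q (grid \<epsilon>)"
    have X: "grid_connected \<epsilon> X" "S \<inter> B \<noteq> {} \<longrightarrow> X \<noteq> {}"
      using h \<epsilon> unfolding half_tame_def X_def by blast+
    have I: "T ` S \<inter> T ` B \<inter> translate p (grid \<epsilon>) = T ` X"
      unfolding q Int X_def using inj by (simp add: image_Int)
    have nr: "near \<epsilon> (T x) (T y) \<longleftrightarrow> near \<epsilon> x y" for x y
      using iso inj by (simp add: near_def inj_eq)
    have "grid_connected \<epsilon> (T ` X)"
      unfolding grid_connected_def
    proof (intro ballI)
      fix u v assume "u \<in> T ` X" "v \<in> T ` X"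
      then obtain u' v' where uv: "u = T u'" "v = T v'" "u' \<in> X" "v' \<in> X" by blast
      then have "linked (near \<epsilon>) X u' v'" using X(1) unfolding grid_connected_def by blast
      then show "linked (near \<epsilon>) (T ` X) u v"
        unfolding uv linked_image[of T "near \<epsilon>" "near \<epsilon>", OF inj nr] by blast
    qed
    then show ?thesis unfolding I unfolding Int using X(2) by blast
  qed
  ultimately show ?thesis unfolding half_tame_def by blast
qed

lemma tame_box_image:
  assumes T: "plane_sym T" and h: "tame_box A B e"
  shows "tame_box (T ` A) (T ` B) e"
proof -
  have "- T ` A = T ` (- A)" using T by (simp add: plane_sym_def bij_image_Compl_eq)
  then show ?thesis using h half_tame_image[OF T] T by (auto simp: tame_box_def plane_sym_def)
qed

lemma plane_sym_translate: "plane_sym (\<lambda>z. z + x)"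
proof -
  have "translate p (grid \<epsilon>) = (\<lambda>z. z + x) ` translate (p - x) (grid \<epsilon>)" for \<epsilon> p
    using translate_translate[of x "p - x" "grid \<epsilon>"] by (simp add: translate_def)
  moreover have "crossfree ((\<lambda>z. z + x) ` A) ((\<lambda>z. z + x) ` B)" if "crossfree A B" for A B
  proof -
    have mem: "(a, b) \<in> (\<lambda>z. z + x) ` X \<longleftrightarrow> (a - fst x, b - snd x) \<in> X" for a b X
      using mem_translate[of "(a, b)" x X] by (cases x) (simp add: translate_def)
    show ?thesis
      unfolding crossfree_def
    proof (intro allI impI)
      fix a b a' b'
      assume "{a, a'} \<times> {b, b'} \<subseteq> (\<lambda>z. z + x) ` B \<and> (a, b) \<in> (\<lambda>z. z + x) ` A \<and> (a', b') \<in> (\<lambda>z. z + x) ` A"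
      then show "(a, b') \<in> (\<lambda>z. z + x) ` A \<or> (a', b) \<in> (\<lambda>z. z + x) ` A"
        using that[unfolded crossfree_def, rule_format, of "a - fst x" "a' - fst x" "b - snd x" "b' - snd x"]
        by (simp add: mem)
    qed
  qed
  moreover have "bij (\<lambda>z. z + x)" by (rule o_bij[of "\<lambda>z. z - x"]) (auto simp: fun_eq_iff)
  moreover have "dist (u + x) (v + x) = dist u v" for u v by (simp add: dist_norm)
  ultimately show ?thesis unfolding plane_sym_def by blast
qed

definition flip :: "plane \<Rightarrow> plane" where "flip z = (fst z, - snd z)"

lemma flip_flip [simp]: "flip (flip z) = z" and swap_swap_plane: "prod.swap (prod.swap z) = (z :: plane)"
  by (simp_all add: flip_def)

lemma mem_image_involution: "(\<And>z. f (f z) = z) \<Longrightarrow> z \<in> f ` A \<longleftrightarrow> f z \<in> A"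
  by (metis image_iff)

lemma plane_sym_flip: "plane_sym flip"
proof -
  note mem = mem_image_involution[of flip, OF flip_flip]
  have g1: "flip z \<in> grid \<epsilon>" if z: "z \<in> grid \<epsilon>" for z \<epsilon>
  proof -
    obtain w where "z = node \<epsilon> w" using z unfolding grid_eq_range_node by blast
    then have "flip z = node \<epsilon> (fst w, - snd w)" by (simp add: flip_def node_def)
    then show ?thesis by (simp add: grid_eq_range_node)
  qed
  have g: "flip z \<in> grid \<epsilon> \<longleftrightarrow> z \<in> grid \<epsilon>" for z \<epsilon>
    using g1[of z \<epsilon>] g1[of "flip z" \<epsilon>] by auto
  have "translate p (grid \<epsilon>) = flip ` translate (flip p) (grid \<epsilon>)" for \<epsilon> p
  proof (intro set_eqI)
    fix z
    have "flip z - flip p = flip (z - p)" by (simp add: flip_def)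
    then show "z \<in> translate p (grid \<epsilon>) \<longleftrightarrow> z \<in> flip ` translate (flip p) (grid \<epsilon>)"
      by (simp add: mem mem_translate g)
  qed
  moreover have "crossfree (flip ` A) (flip ` B)" if "crossfree A B" for A B
    unfolding crossfree_def
  proof (intro allI impI)
    fix a b a' b'
    assume "{a, a'} \<times> {b, b'} \<subseteq> flip ` B \<and> (a, b) \<in> flip ` A \<and> (a', b') \<in> flip ` A"
    then show "(a, b') \<in> flip ` A \<or> (a', b) \<in> flip ` A"
      using that[unfolded crossfree_def, rule_format, of a a' "- b" "- b'"]
      by (simp add: mem) (simp add: flip_def)
  qed
  moreover have "bij flip" by (rule o_bij[of flip]) (auto simp: fun_eq_iff)
  moreover have "dist (flip u) (flip v) = dist u v" for u v
    by (simp add: dist_prod_def flip_def dist_minus)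
  ultimately show ?thesis unfolding plane_sym_def by blast
qed

lemma plane_sym_swap: "plane_sym prod.swap"
proof -
  note mem = mem_image_involution[of "prod.swap :: plane \<Rightarrow> plane", OF swap_swap_plane]
  have g: "prod.swap z \<in> grid \<epsilon> \<longleftrightarrow> z \<in> grid \<epsilon>" for z \<epsilon>
    by (cases z) (auto simp: grid_def)
  have "translate p (grid \<epsilon>) = prod.swap ` translate (prod.swap p) (grid \<epsilon>)" for \<epsilon> p
  proof (intro set_eqI)
    fix z
    have "prod.swap z - prod.swap p = prod.swap (z - p)" by (simp add: prod_eq_iff)
    then show "z \<in> translate p (grid \<epsilon>) \<longleftrightarrow> z \<in> prod.swap ` translate (prod.swap p) (grid \<epsilon>)"
      by (simp only: mem mem_translate g)
  qed
  moreover have "crossfree (prod.swap ` A) (prod.swap ` B)" if "crossfree A B" for A B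
    unfolding crossfree_def
  proof (intro allI impI)
    fix a b a' b'
    assume "{a, a'} \<times> {b, b'} \<subseteq> prod.swap ` B \<and> (a, b) \<in> prod.swap ` A \<and> (a', b') \<in> prod.swap ` A"
    then have "{b, b'} \<times> {a, a'} \<subseteq> B" "(b, a) \<in> A" "(b', a') \<in> A"
      by (simp_all add: mem)
    then show "(a, b') \<in> prod.swap ` A \<or> (a', b) \<in> prod.swap ` A"
      using that[unfolded crossfree_def, rule_format, of b b' a a'] unfolding mem by auto
  qed
  moreover have "bij (prod.swap :: plane \<Rightarrow> plane)" by simp
  moreover have "dist (prod.swap u) (prod.swap v) = dist u v" for u v :: plane
    by (simp add: dist_prod_def add.commute)
  ultimately show ?thesis unfolding plane_sym_def by blast
qed

lemma tame_within_image:
  assumes T: "plane_sym T" and A: "tame_within A p r s"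
  shows "tame_within (T ` A) (T p) r s"
proof -
  obtain B where B: "ball p r \<subseteq> B" "\<forall>u\<in>B. \<forall>v\<in>B. dist u v < s" "tame_box A B r"
    using A unfolding tame_within_def by blast
  have iso: "\<And>u v. dist (T u) (T v) = dist u v" and "surj T"
    using T bij_is_surj unfolding plane_sym_def by blast+
  have "ball (T p) r \<subseteq> T ` B"
  proof
    fix z assume z: "z \<in> ball (T p) r"
    obtain w where "z = T w" using \<open>surj T\<close> by (rule surjE)
    then show "z \<in> T ` B" using z B(1) iso by auto
  qed
  moreover have "\<forall>u\<in>T ` B. \<forall>v\<in>T ` B. dist u v < s" using B(2) iso by auto
  ultimately show ?thesis
    unfolding tame_within_def using tame_box_image[OF T B(3)] by blast
qed

lemma tame_within_translate:
  "tame_within A (p - x) r s \<Longrightarrow> tame_within (translate x A) p r s"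
  using tame_within_image[OF plane_sym_translate[of x], of A "p - x" r s] by (simp add: translate_def)

section \<open>Path components and grid components\<close>

text \<open>
  \<open>\<delta>\<close> is the scale at which \<open>S\<close> is connected both by paths and along the grid; the grid points
  of \<open>S\<close> are \<open>\<delta>/2\<close>-dense in \<open>S\<close>.
\<close>

locale grid_resolved =
  fixes S :: "plane set" and \<epsilon> \<delta> :: real
  assumes eps: "0 < \<epsilon>" "\<epsilon> < \<delta>"
    and box: "\<And>p. \<exists>B. ball p \<delta> \<subseteq> B \<and> path_connected (S \<inter> B) \<and> grid_connected \<epsilon> (S \<inter> B \<inter> grid \<epsilon>)"
    and dense: "\<And>z. z \<in> S \<Longrightarrow> \<exists>z'. z' \<in> S \<inter> grid \<epsilon> \<and> dist z z' < \<delta> / 2"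
begin

lemma path_component_close:
  assumes "u \<in> S" "v \<in> S" "dist u v < \<delta>"
  shows "path_component S u v"
proof -
  obtain B where B: "ball u \<delta> \<subseteq> B" "path_connected (S \<inter> B)" using box by blast
  have "u \<in> ball u \<delta>" "v \<in> ball u \<delta>" using assms eps by auto
  then have "path_component (S \<inter> B) u v"
    using B assms unfolding path_connected_component by blast
  then show ?thesis by (rule path_component_of_subset[OF Int_lower1])
qed

lemma linked_close:
  assumes "u \<in> S \<inter> grid \<epsilon>" "v \<in> S \<inter> grid \<epsilon>" "dist x u < \<delta>" "dist x v < \<delta>"
  shows "linked (near \<epsilon>) (S \<inter> grid \<epsilon>) u v"
proof -
  obtain B where B: "ball x \<delta> \<subseteq> B" "grid_connected \<epsilon> (S \<inter> B \<inter> grid \<epsilon>)" using box by blast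
  have "u \<in> B" "v \<in> B" using B(1) assms by auto
  then have "linked (near \<epsilon>) (S \<inter> B \<inter> grid \<epsilon>) u v"
    using B(2) assms unfolding grid_connected_def by blast
  then show ?thesis by (rule linked_mono) blast
qed

text \<open>Grid steps are shorter than \<open>\<delta>\<close>, hence stay in a path component. For
  the converse no path is discretized: having a grid point of the right grid component within
  \<open>\<delta> / 2\<close> is a property that spreads locally, so it holds throughout a connected
  set.\<close>

lemma component_Int_grid:
  assumes z: "z \<in> S \<inter> grid \<epsilon>"
  shows "path_component_set S z \<inter> grid \<epsilon> = comp_of (near \<epsilon>) (S \<inter> grid \<epsilon>) z"
proof (intro equalityI subsetI)
  fix y assume "y \<in> comp_of (near \<epsilon>) (S \<inter> grid \<epsilon>) z"
  then have "linked (near \<epsilon>) (S \<inter> grid \<epsilon>) z y" by (simp add: comp_of_def)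
  then have "path_component S z y \<and> y \<in> grid \<epsilon>"
  proof (induction rule: linked_induct)
    case base
    then show ?case using z by (simp add: path_component_refl)
  next
    case (step u v)
    then have "dist u v < \<delta>" using eps by (auto simp: near_def)
    then have "path_component S u v" using step by (intro path_component_close) auto
    then show ?case using step path_component_trans[of S z u v] by blast
  qed
  then show "y \<in> path_component_set S z \<inter> grid \<epsilon>" by simp
next
  fix y assume y: "y \<in> path_component_set S z \<inter> grid \<epsilon>"
  let ?Y = "path_component_set S z"
  define P where "P x \<longleftrightarrow> (\<exists>x'. x' \<in> S \<inter> grid \<epsilon> \<and> dist x x' < \<delta> / 2 \<and> linked (near \<epsilon>) (S \<inter> grid \<epsilon>) z x')" for x
  have YS: "?Y \<subseteq> S" by (rule path_component_subset)
  have "P y"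
  proof (rule connected_induction_simple[where S="?Y" and P=P and a=z and b=y])
    show "connected ?Y" by (simp add: path_connected_imp_connected)
    show "P z" using z eps unfolding P_def by (intro exI[of _ z]) auto
    show "z \<in> ?Y" using z by (simp add: path_component_refl)
    show "y \<in> ?Y" using y by simp
    fix a assume "a \<in> ?Y"
    have "P w" if v: "v \<in> ?Y \<inter> ball a (\<delta> / 4)" and w: "w \<in> ?Y \<inter> ball a (\<delta> / 4)" and "P v" for v w
    proof -
      obtain v' where v': "v' \<in> S \<inter> grid \<epsilon>" "dist v v' < \<delta> / 2" "linked (near \<epsilon>) (S \<inter> grid \<epsilon>) z v'"
        using \<open>P v\<close> unfolding P_def by blast
      obtain w' where w': "w' \<in> S \<inter> grid \<epsilon>" "dist w w' < \<delta> / 2" using dense[of w] w YS by blast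
      \<comment> \<open>Balls of radius \<open>\<delta> / 4\<close> are used so that the grid points
        attached to \<open>v\<close> and to \<open>w\<close> are both within \<open>\<delta>\<close>
        of \<open>v\<close>.\<close>
      have "dist v w < \<delta> / 2" using v w dist_triangle_half_r[of a v "\<delta> / 2" w] by auto
      then have "dist v w' < \<delta>" using w'(2) dist_triangle[of v w' w] by linarith
      then have "linked (near \<epsilon>) (S \<inter> grid \<epsilon>) v' w'"
        using v' w' eps by (intro linked_close[of _ _ v]) auto
      then show ?thesis using v'(3) w' linked_trans[of "near \<epsilon>" "S \<inter> grid \<epsilon>" z v' w'] unfolding P_def by blast
    qed
    moreover have "a \<in> ball a (\<delta> / 4)" using eps by simp
    ultimately show "\<exists>T. openin (top_of_set ?Y) T \<and> a \<in> T \<and> (\<forall>v\<in>T. \<forall>w\<in>T. P v \<longrightarrow> P w)"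
      using \<open>a \<in> ?Y\<close> by (intro exI[of _ "?Y \<inter> ball a (\<delta> / 4)"]) (blast intro: openin_open_Int open_ball)
  qed
  then obtain y' where y': "y' \<in> S \<inter> grid \<epsilon>" "dist y y' < \<delta> / 2" "linked (near \<epsilon>) (S \<inter> grid \<epsilon>) z y'"
    unfolding P_def by blast
  have "linked (near \<epsilon>) (S \<inter> grid \<epsilon>) y' y"
    using y y' YS eps by (intro linked_close[of _ _ y]) auto
  then show "y \<in> comp_of (near \<epsilon>) (S \<inter> grid \<epsilon>) z"
    using y'(3) linked_trans[of "near \<epsilon>" "S \<inter> grid \<epsilon>" z y' y] by (simp add: comp_of_def)
qed

text \<open>Every component contains a grid point, so its trace determines it. A bounded component
  has finitely many grid points; conversely a component lies within \<open>\<delta> / 2\<close> of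
  its grid points and is bounded if these are finitely many.\<close>

lemma bij_betw_components:
  "bij_betw (\<lambda>C. C \<inter> grid \<epsilon>) (bounded_components S) (finite_grid_components \<epsilon> (S \<inter> grid \<epsilon>))"
proof -
  have rep: "\<exists>z. z \<in> S \<inter> grid \<epsilon> \<and> C = path_component_set S z" if C: "C = path_component_set S x" "x \<in> S" for C x
  proof -
    obtain z where z: "z \<in> S \<inter> grid \<epsilon>" "dist x z < \<delta> / 2" using dense[OF C(2)] by blast
    then have "path_component S x z" using C eps by (intro path_component_close) auto
    then show ?thesis using z(1) C path_component_eq[of z S x] by (intro exI[of _ z]) simp
  qed
  have self: "z \<in> path_component_set S z" if "z \<in> S" for z
    using that by (simp add: path_component_refl)
  show ?thesis
    unfolding bij_betw_def
  proof
    show "inj_on (\<lambda>C. C \<inter> grid \<epsilon>) (bounded_components S)"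
    proof (rule inj_onI)
      fix C D assume C: "C \<in> bounded_components S" and D: "D \<in> bounded_components S"
        and eq: "C \<inter> grid \<epsilon> = D \<inter> grid \<epsilon>"
      obtain x where "C = path_component_set S x" "x \<in> S" using C by (auto simp: bounded_components_def)
      then obtain z where z: "z \<in> S \<inter> grid \<epsilon>" "C = path_component_set S z" using rep by blast
      obtain w where w: "w \<in> S" "D = path_component_set S w" using D by (auto simp: bounded_components_def)
      have "z \<in> D" using z eq self[of z] by blast
      then show "C = D" using z w path_component_eq[of z S w] by simp
    qed
    show "(\<lambda>C. C \<inter> grid \<epsilon>) ` bounded_components S = finite_grid_components \<epsilon> (S \<inter> grid \<epsilon>)"
    proof (intro equalityI subsetI)
      fix D assume "D \<in> (\<lambda>C. C \<inter> grid \<epsilon>) ` bounded_components S"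
      then obtain C where C: "D = C \<inter> grid \<epsilon>" "C \<in> bounded_components S" by blast
      then obtain x where "C = path_component_set S x" "x \<in> S" by (auto simp: bounded_components_def)
      then obtain z where z: "z \<in> S \<inter> grid \<epsilon>" "C = path_component_set S z" using rep by blast
      have "bounded C" using C by (simp add: bounded_components_def)
      then have "finite D" using C finite_bounded_Int_grid eps by simp
      then show "D \<in> finite_grid_components \<epsilon> (S \<inter> grid \<epsilon>)"
        using C z component_Int_grid[of z]
        by (auto simp: finite_grid_components_def grid_components_eq_comps comps_def)
    next
      fix D assume "D \<in> finite_grid_components \<epsilon> (S \<inter> grid \<epsilon>)"
      then obtain z where z: "z \<in> S \<inter> grid \<epsilon>" "D = comp_of (near \<epsilon>) (S \<inter> grid \<epsilon>) z" "finite D"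
        by (auto simp: finite_grid_components_def grid_components_eq_comps comps_def)
      let ?C = "path_component_set S z"
      have D: "D = ?C \<inter> grid \<epsilon>" using z component_Int_grid by simp
      have "?C \<subseteq> (\<Union>d\<in>D. ball d (\<delta> / 2))"
      proof
        fix x assume x: "x \<in> ?C"
        then have "x \<in> S" using path_component_subset by blast
        then obtain x' where x': "x' \<in> S \<inter> grid \<epsilon>" "dist x x' < \<delta> / 2" using dense by blast
        then have "path_component S x x'" using \<open>x \<in> S\<close> eps by (intro path_component_close) auto
        then have "x' \<in> D" using x x' path_component_trans[of S z x x'] unfolding D by auto
        then show "x \<in> (\<Union>d\<in>D. ball d (\<delta> / 2))" using x'(2) by (auto simp: dist_commute)
      qed
      moreover have "bounded (\<Union>d\<in>D. ball d (\<delta> / 2))" using z(3) by (intro bounded_UN) auto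
      ultimately have "bounded ?C" using bounded_subset by blast
      then have "?C \<in> bounded_components S" using z by (auto simp: bounded_components_def)
      then show "D \<in> (\<lambda>C. C \<inter> grid \<epsilon>) ` bounded_components S" using D by blast
    qed
  qed
qed

end

lemma tame_grid_resolved:
  assumes "tame A"
  obtains \<delta> e where "e > 0" "4 * e \<le> \<delta>"
    "\<And>\<epsilon> x. 0 < \<epsilon> \<Longrightarrow> \<epsilon> < e \<Longrightarrow> grid_resolved (translate x A) \<epsilon> \<delta>"
    "\<And>\<epsilon> x. 0 < \<epsilon> \<Longrightarrow> \<epsilon> < e \<Longrightarrow> grid_resolved (- translate x A) \<epsilon> \<delta>"
    "\<And>p x. \<exists>B. ball p \<delta> \<subseteq> B \<and> crossfree (translate x A) B"
proof -
  \<comment> \<open>The size \<open>1\<close> is arbitrary. The resulting \<open>\<delta>\<close>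
    then prescribes the size \<open>\<delta> / 2\<close> of the boxes that yield density.\<close>
  obtain \<delta> where d: "\<delta> > 0" "\<And>p. tame_within A p \<delta> 1"
    using assms zero_less_one unfolding tame_def by blast
  then have "\<delta> / 2 > 0" by simp
  then obtain r where r: "r > 0" "\<And>p. tame_within A p r (\<delta> / 2)"
    using assms unfolding tame_def by blast
  note d' = tame_within_translate[OF d(2), unfolded tame_within_def]
  note r' = tame_within_translate[OF r(2), unfolded tame_within_def]
  \<comment> \<open>The factor 4 keeps a grid square inside a ball of radius \<open>\<delta>\<close>
    around any of its corners, so that \<open>crossfree\<close> applies to it.\<close>
  define e where "e = min (\<delta> / 4) r"
  have res: "grid_resolved S \<epsilon> \<delta>"
    if \<epsilon>: "0 < \<epsilon>" "\<epsilon> < e" and S: "S = translate x A \<or> S = - translate x A" for S \<epsilon> x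
  proof
    show "0 < \<epsilon>" "\<epsilon> < \<delta>" using \<epsilon> d by (auto simp: e_def)
    fix p
    obtain B where B: "ball p \<delta> \<subseteq> B" "tame_box (translate x A) B \<delta>" using d'[of p x] by blast
    then have "half_tame S B \<delta>" using S by (auto simp: tame_box_def)
    then have "path_connected (S \<inter> B)" "grid_connected \<epsilon> (S \<inter> B \<inter> translate 0 (grid \<epsilon>))"
      using \<open>0 < \<epsilon>\<close> \<open>\<epsilon> < \<delta>\<close> unfolding half_tame_def by blast+
    then show "\<exists>B. ball p \<delta> \<subseteq> B \<and> path_connected (S \<inter> B) \<and> grid_connected \<epsilon> (S \<inter> B \<inter> grid \<epsilon>)"
      using B(1) by (intro exI[of _ B]) simp
  next
    fix z assume z: "z \<in> S"
    obtain B where B: "ball z r \<subseteq> B" "\<forall>u\<in>B. \<forall>v\<in>B. dist u v < \<delta> / 2" "tame_box (translate x A) B r"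
      using r'[of z x] by blast
    then have h: "half_tame S B r" using S by (auto simp: tame_box_def)
    have "z \<in> B" using B(1) r(1) by auto
    then have ne: "S \<inter> B \<noteq> {}" using z by blast
    have "\<epsilon> < r" using \<epsilon> by (simp add: e_def)
    then have "S \<inter> B \<inter> translate 0 (grid \<epsilon>) \<noteq> {}"
      using h \<epsilon>(1) ne unfolding half_tame_def by blast
    then obtain z' where z': "z' \<in> S \<inter> B \<inter> grid \<epsilon>" by auto
    then have "dist z z' < \<delta> / 2" using B(2) \<open>z \<in> B\<close> by blast
    then show "\<exists>z'. z' \<in> S \<inter> grid \<epsilon> \<and> dist z z' < \<delta> / 2" using z' by blast
  qed
  show thesis
  proof (rule that[of e \<delta>])
    show "e > 0" "4 * e \<le> \<delta>" using d r by (auto simp: e_def)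
    show "\<exists>B. ball p \<delta> \<subseteq> B \<and> crossfree (translate x A) B" for p x
      using d'[of p x] unfolding tame_box_def by blast
  qed (use res in blast)+
qed

section \<open>Comparison with the lattice and with the corner terms\<close>

lemma card_image_image:
  assumes "inj f"
  shows "card (image f ` X) = card X"
  by (intro card_image inj_onI) (use assms in \<open>simp add: inj_image_eq_iff\<close>)

lemma finite_grid_components_node:
  assumes "\<epsilon> > 0"
  shows "finite_grid_components \<epsilon> (node \<epsilon> ` M) = image (node \<epsilon>) ` {C \<in> comps adj4 M. finite C}"
proof -
  have "comps (near \<epsilon>) (node \<epsilon> ` M) = image (node \<epsilon>) ` comps adj4 M"
    using comps_image[of "node \<epsilon>" "near \<epsilon>" adj4 M] inj_node[OF assms] near_node[OF assms] by blast
  moreover have "finite (node \<epsilon> ` C) \<longleftrightarrow> finite C" for C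
    using inj_node[OF assms] by (meson finite_image_iff inj_on_subset subset_UNIV)
  ultimately show ?thesis
    unfolding finite_grid_components_def grid_components_eq_comps by auto
qed

theorem tame_grid_euler:
  assumes "tame A" "bounded A"
  shows "\<exists>e>0. \<forall>\<epsilon> x. 0 < \<epsilon> \<and> \<epsilon> < e \<longrightarrow>
    translate x A \<in> euler_class \<and> grid_trace \<epsilon> (translate x A) \<in> grid_euler_class \<epsilon> \<and>
    euler_char (translate x A) = grid_euler_char \<epsilon> (grid_trace \<epsilon> (translate x A)) \<and>
    ((\<lambda>y. local_euler \<epsilon> y (translate x A)) has_sum of_int (euler_char (translate x A))) (grid \<epsilon>)"
proof -
  obtain \<delta> e where e: "e > 0" "4 * e \<le> \<delta>"
    and resA: "\<And>\<epsilon> x. 0 < \<epsilon> \<Longrightarrow> \<epsilon> < e \<Longrightarrow> grid_resolved (translate x A) \<epsilon> \<delta>"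
    and resC: "\<And>\<epsilon> x. 0 < \<epsilon> \<Longrightarrow> \<epsilon> < e \<Longrightarrow> grid_resolved (- translate x A) \<epsilon> \<delta>"
    and cross: "\<And>p x. \<exists>B. ball p \<delta> \<subseteq> B \<and> crossfree (translate x A) B"
    using tame_grid_resolved[OF assms(1)] by metis
  have main: "translate x A \<in> euler_class \<and> grid_trace \<epsilon> (translate x A) \<in> grid_euler_class \<epsilon> \<and>
      euler_char (translate x A) = grid_euler_char \<epsilon> (grid_trace \<epsilon> (translate x A)) \<and>
      ((\<lambda>y. local_euler \<epsilon> y (translate x A)) has_sum of_int (euler_char (translate x A))) (grid \<epsilon>)"
    if \<epsilon>: "0 < \<epsilon>" "\<epsilon> < e" for \<epsilon> x
  proof -
    define A' where "A' = translate x A"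
    have bdA: "bounded A'"
      using bounded_translation[OF assms(2), of x] by (simp add: A'_def translate_def add.commute)
    define M where "M = {z. node \<epsilon> z \<in> A'}"
    have AG: "A' \<inter> grid \<epsilon> = node \<epsilon> ` M" "- A' \<inter> grid \<epsilon> = node \<epsilon> ` (- M)" "grid \<epsilon> - node \<epsilon> ` M = node \<epsilon> ` (- M)"
      by (auto simp: M_def grid_eq_range_node)
    note inj = inj_node[OF \<epsilon>(1)]
    have "finite (A' \<inter> grid \<epsilon>)" using finite_bounded_Int_grid[OF bdA \<epsilon>(1)] .
    then have finM: "finite M"
      unfolding AG using inj by (meson finite_imageD inj_on_subset subset_UNIV)
    have nc: "no_cross M"
      unfolding no_cross_def
    proof (intro allI impI)
      fix i j i' j' assume H: "\<bar>i - i'\<bar> = 1 \<and> \<bar>j - j'\<bar> = 1 \<and> (i, j) \<in> M \<and> (i', j') \<in> M"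
      obtain B where B: "ball (node \<epsilon> (i, j)) \<delta> \<subseteq> B" "crossfree A' B" using cross unfolding A'_def by blast
      have close: "node \<epsilon> (k, l) \<in> B" if kl: "k \<in> {i, i'}" "l \<in> {j, j'}" for k l
      proof -
        have "dist (node \<epsilon> (i, j)) (node \<epsilon> (k, l)) \<le> \<bar>\<epsilon> * of_int i - \<epsilon> * of_int k\<bar> + \<bar>\<epsilon> * of_int j - \<epsilon> * of_int l\<bar>"
          using dist_le_sum[of "node \<epsilon> (i, j)" "node \<epsilon> (k, l)"] by (simp add: node_def)
        also have "\<dots> = \<epsilon> * (\<bar>of_int (i - k)\<bar> + \<bar>of_int (j - l)\<bar>)"
          using \<epsilon>(1) by (simp add: right_diff_distrib[symmetric] abs_mult distrib_left)
        also have "\<dots> \<le> \<epsilon> * (1 + 1)"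
        proof (intro mult_left_mono add_mono)
          have "\<bar>i - k\<bar> \<le> 1" "\<bar>j - l\<bar> \<le> 1" using H kl by auto
          then show "\<bar>real_of_int (i - k)\<bar> \<le> 1" "\<bar>real_of_int (j - l)\<bar> \<le> 1" by linarith+
        qed (use \<epsilon> in simp)
        also have "\<dots> < \<delta>" using \<epsilon> e by simp
        finally show ?thesis using B(1) by auto
      qed
      have "{\<epsilon> * real_of_int i, \<epsilon> * real_of_int i'} \<times> {\<epsilon> * real_of_int j, \<epsilon> * real_of_int j'} \<subseteq> B"
        using close by (auto simp: node_def)
      then show "(i, j') \<in> M \<or> (i', j) \<in> M"
        using B(2)[unfolded crossfree_def, rule_format, of "\<epsilon> * of_int i" "\<epsilon> * of_int i'" "\<epsilon> * of_int j" "\<epsilon> * of_int j'"] H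
        by (simp add: M_def node_def)
    qed
    have fgA: "finite_grid_components \<epsilon> (A' \<inter> grid \<epsilon>) = image (node \<epsilon>) ` comps adj4 M"
    proof -
      have "{C \<in> comps adj4 M. finite C} = comps adj4 M"
        using finM comp_of_subset[of _ M adj4] finite_subset by (fastforce simp: comps_def)
      then show ?thesis unfolding AG finite_grid_components_node[OF \<epsilon>(1)] by simp
    qed
    have fgC: "finite_grid_components \<epsilon> (- A' \<inter> grid \<epsilon>) = image (node \<epsilon>) ` holes M"
      unfolding AG finite_grid_components_node[OF \<epsilon>(1)] holes_def comps_adj8_eq_adj4[OF nc] ..
    note euler = components_minus_holes[OF finM]
    have bA: "bij_betw (\<lambda>C. C \<inter> grid \<epsilon>) (bounded_components A') (finite_grid_components \<epsilon> (A' \<inter> grid \<epsilon>))"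
      using grid_resolved.bij_betw_components[OF resA[OF \<epsilon>]] by (simp add: A'_def)
    have bC: "bij_betw (\<lambda>C. C \<inter> grid \<epsilon>) (bounded_components (- A')) (finite_grid_components \<epsilon> (- A' \<inter> grid \<epsilon>))"
      using grid_resolved.bij_betw_components[OF resC[OF \<epsilon>]] by (simp add: A'_def)
    have fin: "finite (finite_grid_components \<epsilon> (A' \<inter> grid \<epsilon>))" "finite (finite_grid_components \<epsilon> (- A' \<inter> grid \<epsilon>))"
      unfolding fgA fgC using euler finM by (auto simp: comps_def)
    have cls: "A' \<in> euler_class"
      using fin bij_betw_finite[OF bA] bij_betw_finite[OF bC] by (simp add: euler_class_def)
    have gr: "grid \<epsilon> - grid_trace \<epsilon> A' = - A' \<inter> grid \<epsilon>" by (auto simp: grid_trace_def)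
    have gcls: "grid_trace \<epsilon> A' \<in> grid_euler_class \<epsilon>"
      using fin bdA unfolding grid_euler_class_def gr mem_Collect_eq
      by (auto simp: grid_trace_def intro: bounded_subset)
    have "euler_char A' = grid_euler_char \<epsilon> (grid_trace \<epsilon> A')"
      unfolding euler_char_def grid_euler_char_def gr
      using bij_betw_same_card[OF bA] bij_betw_same_card[OF bC] by (simp add: grid_trace_def)
    moreover have ec: "euler_char A' = cell_euler M"
      using euler unfolding euler_char_def bij_betw_same_card[OF bA] bij_betw_same_card[OF bC] fgA fgC
        card_image_image[OF inj] by simp
    moreover have "((\<lambda>y. local_euler \<epsilon> y A') has_sum of_int (euler_char A')) (grid \<epsilon>)"
    proof -
      \<comment> \<open>Nonzero terms occur only at cells of \<open>M\<close> and at cells whose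
        left neighbour is in \<open>M\<close>.\<close>
      define Z where "Z = M \<union> (\<lambda>(i, j). (i + 1, j)) ` M"
      have finZ: "finite Z" using finM by (simp add: Z_def)
      let ?f = "\<lambda>(i, j). of_bool ((i, j) \<in> M \<and> (i + 1, j) \<notin> M \<and> (i, j + 1) \<notin> M)
        - of_bool ((i, j) \<notin> M \<and> (i - 1, j) \<in> M \<and> (i, j - 1) \<in> M) :: int"
      have f: "local_euler \<epsilon> (node \<epsilon> z) A' = of_int (?f z)" for z
      proof -
        obtain i j where z: "z = (i, j)" by force
        have "node \<epsilon> (i, j) + \<epsilon> *\<^sub>R u1 = node \<epsilon> (i + 1, j)" "node \<epsilon> (i, j) + \<epsilon> *\<^sub>R u2 = node \<epsilon> (i, j + 1)"
          "node \<epsilon> (i, j) - \<epsilon> *\<^sub>R u1 = node \<epsilon> (i - 1, j)" "node \<epsilon> (i, j) - \<epsilon> *\<^sub>R u2 = node \<epsilon> (i, j - 1)"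
          by (auto simp: node_def u1_def u2_def algebra_simps)
        then show ?thesis by (simp add: local_euler_def z M_def)
      qed
      have sub: "M \<subseteq> Z" by (simp add: Z_def)
      have mem: "(i, j) \<in> Z" if "(i - 1, j) \<in> M" for i j
        using that unfolding Z_def by (intro UnI2 image_eqI[of _ _ "(i - 1, j)"]) auto
      have "(\<Sum>z\<in>Z. ?f z) = cell_euler M"
        by (rule sum_corners_eq_cell_euler[OF finM nc finZ sub mem])
      then have "of_int (cell_euler M) = (\<Sum>z\<in>Z. real_of_int (?f z))"
        by (simp only: of_int_sum[symmetric])
      moreover have "local_euler \<epsilon> (node \<epsilon> z) A' = 0" if "z \<notin> Z" for z
      proof -
        obtain i j where z: "z = (i, j)" by force
        have "(i, j) \<notin> M" "(i - 1, j) \<notin> M" using that sub mem z by auto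
        then show ?thesis unfolding f z by simp
      qed
      ultimately have "((\<lambda>z. local_euler \<epsilon> (node \<epsilon> z) A') has_sum of_int (cell_euler M)) UNIV"
        unfolding f by (intro has_sum_finite_neutralI[OF finZ]) simp_all
      then show ?thesis
        unfolding grid_eq_range_node ec using has_sum_reindex[OF inj, of "\<lambda>y. local_euler \<epsilon> y A'"] by (simp add: o_def)
    qed
    ultimately show ?thesis using cls gcls unfolding A'_def by blast
  qed
  then show ?thesis using e(1) by blast
qed

section \<open>Local models of tame sets\<close>

lemma mem_translate_grid:
  "z \<in> translate p (grid \<epsilon>) \<longleftrightarrow> (\<exists>i j :: int. z = (fst p + \<epsilon> * of_int i, snd p + \<epsilon> * of_int j))"
proof -
  have "z \<in> translate p (grid \<epsilon>) \<longleftrightarrow> (\<exists>i j. z - p = node \<epsilon> (i, j))"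
    unfolding mem_translate grid_eq_range_node by (simp add: image_iff)
  also have "\<dots> \<longleftrightarrow> (\<exists>i j :: int. z = (fst p + \<epsilon> * of_int i, snd p + \<epsilon> * of_int j))"
    by (intro ex_cong1) (auto simp: node_def prod_eq_iff)
  finally show ?thesis .
qed

lemma near_vertical: "\<epsilon> > 0 \<Longrightarrow> near \<epsilon> (x, y + \<epsilon>) (x, y)"
  and near_horizontal: "\<epsilon> > 0 \<Longrightarrow> near \<epsilon> (x, y) (x + \<epsilon>, y)"
  by (simp_all add: near_def dist_Pair_Pair dist_real_def)

lemma lattice_point_above:
  assumes "(\<epsilon>::real) > 0"
  obtains i :: int where "a \<le> t + \<epsilon> * of_int i" "t + \<epsilon> * of_int i < a + \<epsilon>"
    "\<And>j. a \<le> t + \<epsilon> * of_int j \<Longrightarrow> i \<le> j"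
proof
  let ?i = "\<lceil>(a - t) / \<epsilon>\<rceil>"
  have "(a - t) / \<epsilon> \<le> of_int ?i" by linarith
  then have "a - t \<le> of_int ?i * \<epsilon>" using pos_divide_le_eq[OF assms] by blast
  then show "a \<le> t + \<epsilon> * of_int ?i" by (simp add: mult.commute)
  have "of_int ?i < (a - t) / \<epsilon> + 1" by linarith
  then show "t + \<epsilon> * of_int ?i < a + \<epsilon>" using assms by (simp add: field_simps)
  show "?i \<le> j" if "a \<le> t + \<epsilon> * of_int j" for j
    using that assms by (simp add: ceiling_le_iff field_simps)
qed

text \<open>Points slide down their columns to the bottom strip, where \<open>S\<close> is a product
  with the interval \<open>I\<close>. A strip of height \<open>m\<close> contains a grid row when
  \<open>\<epsilon> < m\<close>, and room of length \<open>m\<close> in \<open>I\<close> guarantees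
  a grid column.\<close>

lemma half_tame_columns:
  fixes a b c d m :: real
  assumes m: "0 < m" "c + m \<le> d"
    and down: "\<And>x y y'. x \<in> {a..b} \<Longrightarrow> y \<in> {c..d} \<Longrightarrow> y' \<in> {c..y} \<Longrightarrow> (x, y) \<in> S \<Longrightarrow> (x, y') \<in> S"
    and bottom: "\<And>x y. x \<in> {a..b} \<Longrightarrow> y \<in> {c..c + m} \<Longrightarrow> (x, y) \<in> S \<longleftrightarrow> x \<in> I"
    and I: "is_interval I" "I \<subseteq> {a..b}" "I = {} \<or> (\<exists>u. {u..u + m} \<subseteq> I)"
  shows "half_tame S ({a..b} \<times> {c..d}) m"
proof -
  let ?B = "{a..b} \<times> {c..d}"
  have base: "x \<in> I" if "(x, y) \<in> S \<inter> ?B" for x y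
    using that down[of x y c] bottom[of x c] m by auto
  have conv: "convex I" using I(1) is_interval_convex by blast
  have "path_component (S \<inter> ?B) u v" if u: "u \<in> S \<inter> ?B" and v: "v \<in> S \<inter> ?B" for u v
  proof -
    have seg: "path_component (S \<inter> ?B) w (fst w, c)" if w: "w \<in> S \<inter> ?B" for w
    proof (rule path_component_linepath)
      have "closed_segment w (fst w, c) \<subseteq> {fst w} \<times> {c..snd w}"
        using w by (intro closed_segment_subset convex_Times) (auto simp: mem_Times_iff)
      moreover have "{fst w} \<times> {c..snd w} \<subseteq> S \<inter> ?B"
        using w down[of "fst w" "snd w"] by (auto simp: mem_Times_iff)
      ultimately show "closed_segment w (fst w, c) \<subseteq> S \<inter> ?B" by blast
    qed
    have "closed_segment (fst u, c) (fst v, c) \<subseteq> I \<times> {c}"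
      using u v base[of "fst u" "snd u"] base[of "fst v" "snd v"]
      by (intro closed_segment_subset convex_Times conv) auto
    moreover have "I \<times> {c} \<subseteq> S \<inter> ?B"
      using bottom I(2) m by fastforce
    ultimately have "path_component (S \<inter> ?B) (fst u, c) (fst v, c)"
      by (intro path_component_linepath) blast
    then show ?thesis using seg[OF u] seg[OF v] path_component_trans path_component_sym by meson
  qed
  then have pc: "path_connected (S \<inter> ?B)" by (simp add: path_connected_component)
  have main: "grid_connected \<epsilon> X \<and> (S \<inter> ?B \<noteq> {} \<longrightarrow> X \<noteq> {})"
    if \<epsilon>: "0 < \<epsilon>" "\<epsilon> < m" and X: "X = S \<inter> ?B \<inter> translate p (grid \<epsilon>)" for \<epsilon> p X
  proof -
    define g where "g i j = (fst p + \<epsilon> * of_int i, snd p + \<epsilon> * of_int j)" for i j :: int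
    have G: "z \<in> translate p (grid \<epsilon>) \<longleftrightarrow> (\<exists>i j. z = g i j)" for z
      by (simp add: mem_translate_grid g_def)
    have gG: "g i j \<in> translate p (grid \<epsilon>)" for i j using G by blast
    \<comment> \<open>Row \<open>k\<close> is the lowest grid row at or above \<open>c\<close>. It
      is less than \<open>\<epsilon> < m\<close> away from \<open>c\<close>, so
      \<open>bottom\<close> describes \<open>S\<close> on it.\<close>
    obtain k :: int where k: "c \<le> snd p + \<epsilon> * of_int k" "snd p + \<epsilon> * of_int k < c + \<epsilon>"
      "\<And>j. c \<le> snd p + \<epsilon> * of_int j \<Longrightarrow> k \<le> j"
      using lattice_point_above[OF \<epsilon>(1)] by blast
    have row: "g i k \<in> X \<longleftrightarrow> fst p + \<epsilon> * of_int i \<in> I" for i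
      using bottom[of "fst p + \<epsilon> * of_int i" "snd p + \<epsilon> * of_int k"] k(1,2) \<epsilon> m I(2)
      unfolding X Int_iff G by (auto simp: g_def)
    have vert: "linked (near \<epsilon>) X (g i (k + int n)) (g i k) \<and> g i k \<in> X" if "g i (k + int n) \<in> X" for i n
      using that
    proof (induction n)
      case (Suc n)
      let ?y = "snd p + \<epsilon> * of_int (k + int n)"
      have y: "snd p + \<epsilon> * of_int (k + int (Suc n)) = ?y + \<epsilon>" by (simp add: algebra_simps)
      have "0 \<le> \<epsilon> * real n" using \<epsilon>(1) by simp
      then have "c \<le> ?y" using k(1) by (simp add: distrib_left)
      then have m: "g i (k + int n) \<in> X"
        using Suc(2) \<epsilon>(1) down[of "fst p + \<epsilon> * of_int i" "?y + \<epsilon>" ?y] gG[of i "k + int n"]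
        unfolding X Int_iff g_def y by simp
      have "near \<epsilon> (g i (k + int (Suc n))) (g i (k + int n))"
        unfolding g_def y by (rule near_vertical[OF \<epsilon>(1)])
      with Suc(2) m have "linked (near \<epsilon>) X (g i (k + int (Suc n))) (g i (k + int n))"
        by (rule linked_step)
      moreover have "linked (near \<epsilon>) X (g i (k + int n)) (g i k)" "g i k \<in> X"
        using Suc(1)[OF m] by simp_all
      ultimately show ?case using linked_trans by metis
    qed simp
    have hor: "linked (near \<epsilon>) X (g i k) (g (i + int n) k)" if "g i k \<in> X" "g (i + int n) k \<in> X" for i n
      using that
    proof (induction n)
      case (Suc n)
      let ?x = "fst p + \<epsilon> * of_int (i + int n)"
      have x: "fst p + \<epsilon> * of_int (i + int (Suc n)) = ?x + \<epsilon>" by (simp add: algebra_simps)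
      have "fst p + \<epsilon> * of_int i \<le> ?x" using \<epsilon>(1) by (simp add: distrib_left)
      then have "?x \<in> I"
        using I(1)[unfolded is_interval_1, rule_format, of "fst p + \<epsilon> * of_int i" "?x + \<epsilon>" ?x] Suc(2,3) \<epsilon>(1)
        unfolding row x by auto
      then have m: "g (i + int n) k \<in> X" unfolding row .
      have "near \<epsilon> (g (i + int n) k) (g (i + int (Suc n)) k)"
        unfolding g_def x by (rule near_horizontal[OF \<epsilon>(1)])
      then have "linked (near \<epsilon>) X (g (i + int n) k) (g (i + int (Suc n)) k)"
        by (rule linked_step[OF m Suc(3)])
      with Suc(1)[OF Suc(2) m] show ?case by (rule linked_trans)
    qed simp
    have rowlink: "linked (near \<epsilon>) X (g i k) (g i' k)" if "g i k \<in> X" "g i' k \<in> X" for i i'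
      using hor[of i "nat (i' - i)"] hor[of i' "nat (i - i')"] that linked_sym[OF symp_near]
      by (cases "i \<le> i'") auto
    have "linked (near \<epsilon>) X u v" if "u \<in> X" "v \<in> X" for u v
    proof -
      have drop: "\<exists>i. linked (near \<epsilon>) X w (g i k) \<and> g i k \<in> X" if "w \<in> X" for w
      proof -
        obtain i j where w: "w = g i j" using \<open>w \<in> X\<close> unfolding X Int_iff G by blast
        then have "k \<le> j" using \<open>w \<in> X\<close> k(3) unfolding X by (auto simp: g_def)
        then show ?thesis using vert[of i "nat (j - k)"] \<open>w \<in> X\<close> w by auto
      qed
      obtain i i' where "linked (near \<epsilon>) X u (g i k)" "g i k \<in> X" "linked (near \<epsilon>) X v (g i' k)" "g i' k \<in> X"
        using drop \<open>u \<in> X\<close> \<open>v \<in> X\<close> by meson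
      then show ?thesis using rowlink linked_sym[OF symp_near] by (meson linked_trans)
    qed
    moreover have "X \<noteq> {}" if ne: "S \<inter> ?B \<noteq> {}"
    proof -
      obtain z where "z \<in> S \<inter> ?B" using ne by blast
      then have "fst z \<in> I" using base[of "fst z" "snd z"] by simp
      then obtain u where u: "{u..u + m} \<subseteq> I" using I(3) by auto
      obtain i :: int where i: "u \<le> fst p + \<epsilon> * of_int i" "fst p + \<epsilon> * of_int i < u + \<epsilon>"
        using lattice_point_above[OF \<epsilon>(1)] by blast
      then have "fst p + \<epsilon> * of_int i \<in> I" using u \<epsilon>(2) by auto
      then show ?thesis using row by blast
    qed
    ultimately show ?thesis unfolding grid_connected_def by blast
  qed
  show ?thesis unfolding half_tame_def using pc main by blast
qed

lemma flip_image_Times: "flip ` ({a..b} \<times> {c..d}) = {a..b} \<times> {- d..- c}"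
  by (auto simp: mem_image_involution flip_def)

text \<open>Turned upside down, the complement has downward closed columns too, and the top strip
  becomes the bottom one. Of two diagonal points of \<open>A\<close> the higher one can drop to the
  level of the other, which excludes crossings.\<close>

lemma tame_box_columns:
  fixes a b c d m :: real
  assumes m: "0 < m" "c + m \<le> d"
    and down: "\<And>x y y'. x \<in> {a..b} \<Longrightarrow> y \<in> {c..d} \<Longrightarrow> y' \<in> {c..y} \<Longrightarrow> (x, y) \<in> A \<Longrightarrow> (x, y') \<in> A"
    and bottom: "\<And>x y. x \<in> {a..b} \<Longrightarrow> y \<in> {c..c + m} \<Longrightarrow> (x, y) \<in> A \<longleftrightarrow> x \<in> I"
    and I: "is_interval I" "I \<subseteq> {a..b}" "I = {} \<or> (\<exists>u. {u..u + m} \<subseteq> I)"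
    and top: "\<And>x y. x \<in> {a..b} \<Longrightarrow> y \<in> {d - m..d} \<Longrightarrow> (x, y) \<notin> A \<longleftrightarrow> x \<in> J"
    and J: "is_interval J" "J \<subseteq> {a..b}" "J = {} \<or> (\<exists>u. {u..u + m} \<subseteq> J)"
  shows "tame_box A ({a..b} \<times> {c..d}) m"
  unfolding tame_box_def
proof (intro conjI)
  note mem = mem_image_involution[of flip, OF flip_flip]
  show "half_tame A ({a..b} \<times> {c..d}) m"
    by (rule half_tame_columns[OF m down bottom I])
  have "half_tame (flip ` (- A)) ({a..b} \<times> {- d..- c}) m"
  proof (rule half_tame_columns[OF m(1) _ _ _ J])
    show "(x, y') \<in> flip ` (- A)"
      if "x \<in> {a..b}" "y \<in> {- d..- c}" "y' \<in> {- d..y}" "(x, y) \<in> flip ` (- A)" for x y y'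
      using that down[of x "- y'" "- y"] unfolding mem by (auto simp: flip_def)
    show "(x, y) \<in> flip ` (- A) \<longleftrightarrow> x \<in> J" if "x \<in> {a..b}" "y \<in> {- d..- d + m}" for x y
      using that top[of x "- y"] unfolding mem by (auto simp: flip_def)
  qed (use m in auto)
  then have "half_tame (flip ` (flip ` (- A))) (flip ` (flip ` ({a..b} \<times> {c..d}))) m"
    unfolding flip_image_Times[of a b c d] by (rule half_tame_image[OF plane_sym_flip])
  then show "half_tame (- A) ({a..b} \<times> {c..d}) m" by (simp add: image_image)
  show "crossfree A ({a..b} \<times> {c..d})"
    unfolding crossfree_def
  proof (intro allI impI)
    fix x y x' y' assume H: "{x, x'} \<times> {y, y'} \<subseteq> {a..b} \<times> {c..d} \<and> (x, y) \<in> A \<and> (x', y') \<in> A"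
    then show "(x, y') \<in> A \<or> (x', y) \<in> A"
      using down[of x y y'] down[of x' y' y] by (cases "y \<le> y'") auto
  qed
qed

section \<open>From tameness at each point to uniform tameness\<close>

definition tame_at :: "plane set \<Rightarrow> plane \<Rightarrow> bool" where
  "tame_at A p \<longleftrightarrow> (\<forall>s>0. \<exists>r>0. tame_within A p r s)"

lemma half_tame_antimono: "half_tame S B e \<Longrightarrow> e' \<le> e \<Longrightarrow> half_tame S B e'"
  unfolding half_tame_def by (meson order_less_le_trans)

lemma tame_box_antimono: "tame_box A B e \<Longrightarrow> e' \<le> e \<Longrightarrow> tame_box A B e'"
  unfolding tame_box_def using half_tame_antimono by blast

lemma ball_subset_box: "ball p h \<subseteq> {fst p - h..fst p + h} \<times> {snd p - h..snd p + h}"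
proof
  fix z assume "z \<in> ball p h"
  then have "dist (fst p) (fst z) \<le> h" "dist (snd p) (snd z) \<le> h"
    using dist_fst_le[of p z] dist_snd_le[of p z] by auto
  then show "z \<in> {fst p - h..fst p + h} \<times> {snd p - h..snd p + h}"
    by (auto simp: mem_Times_iff dist_real_def abs_le_iff)
qed

lemma dist_box_less:
  fixes a b c d :: real
  assumes "u \<in> {a..b} \<times> {c..d}" "v \<in> {a..b} \<times> {c..d}" "(b - a) + (d - c) < s"
  shows "dist u v < s"
proof -
  have "\<bar>fst u - fst v\<bar> + \<bar>snd u - snd v\<bar> \<le> (b - a) + (d - c)"
    using assms(1,2) by (intro add_mono) (auto simp: abs_le_iff)
  then show ?thesis using dist_le_sum[of u v] assms(3) by linarith
qed

lemma tame_at_image: "plane_sym T \<Longrightarrow> tame_at A p \<Longrightarrow> tame_at (T ` A) (T p)"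
  unfolding tame_at_def using tame_within_image by blast

lemma tame_at_flip: "tame_at (flip ` A) (flip p) \<Longrightarrow> tame_at A p"
  using tame_at_image[OF plane_sym_flip, of "flip ` A" "flip p"] by (simp add: image_image)

lemma tame_at_swap: "tame_at (prod.swap ` A) (prod.swap p) \<Longrightarrow> tame_at A p"
  using tame_at_image[OF plane_sym_swap, of "prod.swap ` A" "prod.swap p"] by (simp add: image_image)

lemma tame_box_disjoint:
  fixes p :: plane
  assumes "h > 0" "A \<inter> {fst p - h..fst p + h} \<times> {snd p - h..snd p + h} = {}"
  shows "tame_box A ({fst p - h..fst p + h} \<times> {snd p - h..snd p + h}) h"
  by (rule tame_box_columns[where I = "{}" and J = "{fst p - h..fst p + h}"])
    (use assms in \<open>auto simp: is_interval_cc intro!: exI[of _ "fst p - h"]\<close>)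

text \<open>A Lebesgue number argument handles the ball of radius \<open>R + 1\<close>; farther out,
  boxes of diameter below 1 miss \<open>A\<close>.\<close>

lemma tame_of_tame_at:
  assumes "bounded A" "\<And>p. tame_at A p"
  shows "tame A"
  unfolding tame_def
proof (intro allI impI)
  fix s :: real assume s: "s > 0"
  have "\<exists>r. \<forall>p. r p > 0 \<and> tame_within A p (r p) s"
    using assms(2) s unfolding tame_at_def by (intro choice) blast
  then obtain r B where r: "\<And>p. r p > 0" "\<And>p. ball p (r p) \<subseteq> B p"
      "\<And>p. \<forall>u\<in>B p. \<forall>v\<in>B p. dist u v < s" "\<And>p. tame_box A (B p) (r p)"
    unfolding tame_within_def by metis
  obtain R where R: "\<And>x. x \<in> A \<Longrightarrow> norm x \<le> R" using assms(1) by (auto simp: bounded_iff)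
  let ?K = "cball 0 (R + 1) :: plane set"
  obtain C where C: "C \<subseteq> ?K" "finite C" "?K \<subseteq> (\<Union>p\<in>C. ball p (r p / 2))"
  proof (rule compactE_image[of ?K ?K "\<lambda>p. ball p (r p / 2)"])
    show "?K \<subseteq> (\<Union>p\<in>?K. ball p (r p / 2))" using r(1) by force
  qed auto
  \<comment> \<open>A square of side \<open>2 * h\<close> has width plus height
    \<open>4 * h\<close>, which must stay below both \<open>s\<close> and 1.\<close>
  define h where "h = min 1 s / 5"
  define \<rho> where "\<rho> = Min (insert h ((\<lambda>p. r p / 2) ` C))"
  have h: "0 < h" "4 * h < s" "4 * h < 1" using s by (auto simp: h_def)
  have \<rho>: "0 < \<rho>" "\<rho> \<le> h" "\<And>p. p \<in> C \<Longrightarrow> \<rho> \<le> r p / 2"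
  proof -
    have fin: "finite (insert h ((\<lambda>p. r p / 2) ` C))" using C(2) by simp
    show "0 < \<rho>" unfolding \<rho>_def using fin r(1) h(1) by (subst Min_gr_iff) auto
    show "\<rho> \<le> h" unfolding \<rho>_def using fin by (rule Min_le) simp
    show "\<rho> \<le> r p / 2" if "p \<in> C" for p unfolding \<rho>_def using fin by (rule Min_le) (use that in blast)
  qed
  have "tame_within A p \<rho> s" for p
  proof (cases "p \<in> ?K")
    case True
    then obtain q where q: "q \<in> C" "dist q p < r q / 2" using C(3) by auto
    have "ball p \<rho> \<subseteq> ball q (r q)"
    proof
      fix z assume "z \<in> ball p \<rho>"
      then have "dist p z < r q / 2" using \<rho>(3)[OF q(1)] by simp
      then show "z \<in> ball q (r q)" using q(2) dist_triangle[of q z p] by simp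
    qed
    then have "ball p \<rho> \<subseteq> B q" using r(2)[of q] by blast
    moreover have "tame_box A (B q) \<rho>"
      using r(4)[of q] \<rho>(3)[OF q(1)] r(1)[of q] by (rule_tac tame_box_antimono) auto
    ultimately show ?thesis using r(3)[of q] unfolding tame_within_def by blast
  next
    case False
    let ?B = "{fst p - h..fst p + h} \<times> {snd p - h..snd p + h}"
    have "z \<notin> A" if "z \<in> ?B" for z
    proof
      assume "z \<in> A"
      have "p \<in> ?B" using h(1) by (simp add: mem_Times_iff)
      then have "dist p z < 1" using h(3) that by (intro dist_box_less[of _ "fst p - h" "fst p + h" "snd p - h" "snd p + h"]) auto
      then have "norm p \<le> norm z + 1" using norm_triangle_sub[of p z] by (simp add: dist_norm)
      then show False using R[OF \<open>z \<in> A\<close>] False by simp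
    qed
    then have "tame_box A ?B h" using h(1) by (intro tame_box_disjoint) auto
    then have "tame_box A ?B \<rho>" using \<rho>(2) by (rule tame_box_antimono)
    moreover have "ball p \<rho> \<subseteq> ?B" using subset_ball[OF \<rho>(2)] ball_subset_box by (rule subset_trans)
    moreover have "\<forall>u\<in>?B. \<forall>v\<in>?B. dist u v < s"
      using h(2) by (intro ballI, elim dist_box_less) auto
    ultimately show ?thesis unfolding tame_within_def by blast
  qed
  then show "\<exists>r>0. \<forall>p. tame_within A p r s"
    using \<rho>(1) by blast
qed

lemma tame_atI:
  assumes "\<And>s. s > 0 \<Longrightarrow> \<exists>a b c d m h. 0 < m \<and> m \<le> h \<and>
    {fst p - h..fst p + h} \<times> {snd p - h..snd p + h} \<subseteq> {a..b} \<times> {c..d} \<and>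
    (b - a) + (d - c) < s \<and> tame_box A ({a..b} \<times> {c..d}) m"
  shows "tame_at A p"
  unfolding tame_at_def
proof (intro allI impI)
  fix s :: real assume "s > 0"
  from assms[OF this] obtain a b c d m h where *: "0 < m" "m \<le> h"
    "{fst p - h..fst p + h} \<times> {snd p - h..snd p + h} \<subseteq> {a..b} \<times> {c..d}"
    "(b - a) + (d - c) < s" "tame_box A ({a..b} \<times> {c..d}) m"
    by (elim exE conjE)
  have "ball p m \<subseteq> {a..b} \<times> {c..d}"
    using subset_ball[OF *(2), of p] ball_subset_box[of p h] *(3) by (meson subset_trans)
  moreover have "\<forall>u\<in>{a..b} \<times> {c..d}. \<forall>v\<in>{a..b} \<times> {c..d}. dist u v < s"
    using dist_box_less *(4) by blast
  ultimately show "\<exists>r>0. tame_within A p r s"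
    unfolding tame_within_def using *(1,5) by blast
qed

section \<open>Unions of quadrants\<close>

definition side :: "bool \<Rightarrow> real \<Rightarrow> real \<Rightarrow> bool" where
  "side t a x \<longleftrightarrow> (if t then a \<le> x else x \<le> a)"

text \<open>The quadrants are closed. A half-plane is coded by two of them, so that every local
  shape of a polyrectangle is described by one set \<open>K\<close>.\<close>

definition in_quadrants :: "(bool \<times> bool) set \<Rightarrow> plane \<Rightarrow> plane \<Rightarrow> bool" where
  "in_quadrants K p z \<longleftrightarrow> (\<exists>t u. (t, u) \<in> K \<and> side t (fst p) (fst z) \<and> side u (snd p) (snd z))"

lemma side_slice_cases:
  assumes "0 < h"
  shows "{x \<in> {a - h..a + h}. \<exists>t. P t \<and> side t a x} \<in> {{a - h..a + h}, {a..a + h}, {a - h..a}, {}}"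
proof -
  have "{x \<in> {a - h..a + h}. \<exists>t. P t \<and> side t a x} =
      (if P True \<and> P False then {a - h..a + h} else if P True then {a..a + h}
       else if P False then {a - h..a} else {})"
    using assms unfolding side_def ex_bool_eq by auto
  then show ?thesis by simp
qed

text \<open>An upper quadrant comes with the one below it, so columns are closed downwards. The
  lower quadrants give the bottom slice and the upper ones the top slice.\<close>

lemma tame_at_quadrants_down:
  assumes \<eta>: "\<eta> > 0"
    and A: "\<And>x y. \<bar>x - fst p\<bar> \<le> \<eta> \<Longrightarrow> \<bar>y - snd p\<bar> \<le> \<eta> \<Longrightarrow> (x, y) \<in> A \<longleftrightarrow> in_quadrants K p (x, y)"
    and K: "\<And>t. (t, True) \<in> K \<Longrightarrow> (t, False) \<in> K"
  shows "tame_at A p"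
proof (rule tame_atI)
  fix s :: real assume "s > 0"
  define h where "h = min \<eta> (s / 5)"
  have h: "0 < h" "h \<le> \<eta>" "4 * h < s" using \<eta> \<open>s > 0\<close> by (auto simp: h_def)
  obtain p1 p2 where p: "p = (p1, p2)" by force
  have A': "(x, y) \<in> A \<longleftrightarrow> in_quadrants K p (x, y)" if "x \<in> {p1 - h..p1 + h}" "y \<in> {p2 - h..p2 + h}" for x y
    using A[of x y] that h unfolding p by (auto simp: abs_le_iff)
  have low: "in_quadrants K p (x, y) \<longleftrightarrow> (\<exists>t. (t, False) \<in> K \<and> side t p1 x)" if "y < p2" for x y
    unfolding in_quadrants_def p ex_bool_eq using that by (auto simp: side_def)
  have high: "in_quadrants K p (x, y) \<longleftrightarrow> (\<exists>t. (t, True) \<in> K \<and> side t p1 x)" if "y > p2" for x y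
    unfolding in_quadrants_def p ex_bool_eq using that by (auto simp: side_def)
  have mid: "in_quadrants K p (x, p2) \<longleftrightarrow> (\<exists>t. (t, False) \<in> K \<and> side t p1 x)" for x
    unfolding in_quadrants_def p ex_bool_eq using K by (auto simp: side_def)
  define I where "I = {x \<in> {p1 - h..p1 + h}. \<exists>t. (t, False) \<in> K \<and> side t p1 x}"
  define J where "J = {x \<in> {p1 - h..p1 + h}. \<not> (\<exists>t. (t, True) \<in> K \<and> side t p1 x)}"
  \<comment> \<open>\<open>h / 2\<close> instead of \<open>h\<close>: at the top the complement may
    be a half-open interval ending at \<open>p1\<close>, which contains no closed interval of length
    \<open>h\<close>, and the strips have to avoid the level \<open>p2\<close>.\<close>
  have "tame_box A ({p1 - h..p1 + h} \<times> {p2 - h..p2 + h}) (h / 2)"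
  proof (rule tame_box_columns[where I = I and J = J])
    show "(x, y') \<in> A" if "x \<in> {p1 - h..p1 + h}" "y \<in> {p2 - h..p2 + h}" "y' \<in> {p2 - h..y}" "(x, y) \<in> A" for x y y'
    proof -
      have "y' \<in> {p2 - h..p2 + h}" using that by auto
      moreover have "in_quadrants K p (x, y)" using that A' by blast
      then have "in_quadrants K p (x, y')"
        using low[of y x] high[of y x] mid[of x] low[of y' x] high[of y' x] K that(3)
        by (cases y p2 rule: linorder_cases; cases y' p2 rule: linorder_cases) auto
      ultimately show ?thesis using that(1) A' by blast
    qed
    show "(x, y) \<in> A \<longleftrightarrow> x \<in> I" if "x \<in> {p1 - h..p1 + h}" "y \<in> {p2 - h..p2 - h + h / 2}" for x y
      using that h A'[of x y] low[of y x] by (auto simp: I_def)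
    show "(x, y) \<notin> A \<longleftrightarrow> x \<in> J" if "x \<in> {p1 - h..p1 + h}" "y \<in> {p2 + h - h / 2..p2 + h}" for x y
      using that h A'[of x y] high[of y x] by (auto simp: J_def)
    have "I \<in> {{p1 - h..p1 + h}, {p1..p1 + h}, {p1 - h..p1}, {}}"
      unfolding I_def by (rule side_slice_cases) (use h in simp)
    then show "is_interval I" "I = {} \<or> (\<exists>u. {u..u + h / 2} \<subseteq> I)" "I \<subseteq> {p1 - h..p1 + h}"
      using h by (auto simp: is_interval_cc intro: exI[of _ "p1 - h"] exI[of _ p1])
    have "{p1 - h..p1 + h} - J \<in> {{p1 - h..p1 + h}, {p1..p1 + h}, {p1 - h..p1}, {}}"
      unfolding J_def set_diff_eq using side_slice_cases[of h p1 "\<lambda>t. (t, True) \<in> K"] h by (simp cong: conj_cong)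
    moreover have "J = {p1 - h..p1 + h} - ({p1 - h..p1 + h} - J)" unfolding J_def by blast
    moreover have "{p1 - h..p1 + h} - {p1..p1 + h} = {p1 - h..<p1}" "{p1 - h..p1 + h} - {p1 - h..p1} = {p1<..p1 + h}"
      using h by auto
    ultimately have "J \<in> {{}, {p1 - h..<p1}, {p1<..p1 + h}, {p1 - h..p1 + h}}"
      by (metis Diff_cancel Diff_empty empty_iff insert_iff)
    then show "is_interval J" "J = {} \<or> (\<exists>u. {u..u + h / 2} \<subseteq> J)" "J \<subseteq> {p1 - h..p1 + h}"
      using h by (auto simp: is_interval_1 intro: exI[of _ "p1 - h"] exI[of _ "p1 + h / 2"])
  qed (use h in auto)
  then show "\<exists>a b c d m h. 0 < m \<and> m \<le> h \<and>
    {fst p - h..fst p + h} \<times> {snd p - h..snd p + h} \<subseteq> {a..b} \<times> {c..d} \<and>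
    (b - a) + (d - c) < s \<and> tame_box A ({a..b} \<times> {c..d}) m"
    using h unfolding p
    by - (rule exI[of _ "p1 - h"], rule exI[of _ "p1 + h"], rule exI[of _ "p2 - h"],
        rule exI[of _ "p2 + h"], rule exI[of _ "h / 2"], rule exI[of _ h], auto)
qed

text \<open>If some upper quadrant is present without the one below it, the condition on
  \<open>K\<close> forces every lower quadrant to have its upper companion; flipping then gives the
  downward case.\<close>

lemma tame_at_quadrants:
  assumes \<eta>: "\<eta> > 0"
    and A: "\<And>x y. \<bar>x - fst p\<bar> \<le> \<eta> \<Longrightarrow> \<bar>y - snd p\<bar> \<le> \<eta> \<Longrightarrow> (x, y) \<in> A \<longleftrightarrow> in_quadrants K p (x, y)"
    and K: "\<And>t u. (t, u) \<in> K \<Longrightarrow> (\<not> t, \<not> u) \<in> K \<Longrightarrow> (t, \<not> u) \<in> K \<or> (\<not> t, u) \<in> K"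
  shows "tame_at A p"
proof (cases "\<forall>t. (t, True) \<in> K \<longrightarrow> (t, False) \<in> K")
  case True
  then show ?thesis using tame_at_quadrants_down[OF \<eta> A] by blast
next
  case False
  then obtain s where s: "(s, True) \<in> K" "(s, False) \<notin> K" by blast
  have up: "(t, True) \<in> K" if "(t, False) \<in> K" for t
  proof (rule ccontr)
    assume n: "(t, True) \<notin> K"
    then have "t = (\<not> s)" using s that by (cases "t = s") auto
    then show False using K[of s True] s that n by simp
  qed
  define K' where "K' = {(t, u). (t, \<not> u) \<in> K}"
  have "tame_at (flip ` A) (flip p)"
  proof (rule tame_at_quadrants_down[OF \<eta>, where K = K'])
    fix x y assume "\<bar>x - fst (flip p)\<bar> \<le> \<eta>" "\<bar>y - snd (flip p)\<bar> \<le> \<eta>"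
    then have "(x, - y) \<in> A \<longleftrightarrow> in_quadrants K p (x, - y)"
      by (intro A) (auto simp: flip_def)
    moreover have "in_quadrants K p (x, - y) \<longleftrightarrow> in_quadrants K' (flip p) (x, y)"
      unfolding in_quadrants_def K'_def ex_bool_eq by (auto simp: flip_def side_def)
    ultimately show "(x, y) \<in> flip ` A \<longleftrightarrow> in_quadrants K' (flip p) (x, y)"
      unfolding mem_image_involution[of flip, OF flip_flip] by (simp add: flip_def)
  qed (use up in \<open>auto simp: K'_def\<close>)
  then show ?thesis by (rule tame_at_flip)
qed

section \<open>Sublevel sets of monotone functions\<close>

definition monotone_along :: "plane \<Rightarrow> plane set \<Rightarrow> (plane \<Rightarrow> real) \<Rightarrow> bool" where
  "monotone_along v D f \<longleftrightarrow>
    (\<forall>z a. 0 < a \<and> z \<in> D \<and> z + a *\<^sub>R v \<in> D \<longrightarrow> f z < f (z + a *\<^sub>R v)) \<or>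
    (\<forall>z a. 0 < a \<and> z \<in> D \<and> z + a *\<^sub>R v \<in> D \<longrightarrow> f (z + a *\<^sub>R v) < f z)"

text \<open>The height \<open>h\<close> is fixed first. By continuity \<open>\<phi>\<close> keeps
  its sign on two short horizontal segments of half-width \<open>\<xi>\<close>, below and above
  \<open>p\<close>, and monotonicity extends the signs to the bottom and top strips. The cut
  \<open>X\<close> only selects columns.\<close>

lemma tame_at_graph_increasing:
  fixes p :: plane and \<phi> :: "plane \<Rightarrow> real"
  assumes e: "e > 0"
    and ball_A: "\<And>z. z \<in> ball p e \<Longrightarrow> z \<in> A \<longleftrightarrow> \<phi> z \<le> 0 \<and> fst z \<in> X"
    and X: "X = UNIV \<or> X = {..fst p} \<or> X = {fst p..}"
    and ball_cont: "continuous_on (ball p e) \<phi>"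
    and zero: "\<phi> p = 0"
    and ball_mono: "\<And>z a. 0 < a \<Longrightarrow> z \<in> ball p e \<Longrightarrow> z + a *\<^sub>R (0, 1) \<in> ball p e \<Longrightarrow> \<phi> z < \<phi> (z + a *\<^sub>R (0, 1))"
  shows "tame_at A p"
proof (rule tame_atI)
  fix s :: real assume "s > 0"
  define \<eta> where "\<eta> = e / 3"
  have \<eta>: "\<eta> > 0" "2 * \<eta> < e" using e by (simp_all add: \<eta>_def)
  have sub: "(x, y) \<in> ball p e" if "\<bar>x - fst p\<bar> \<le> \<eta>" "\<bar>y - snd p\<bar> \<le> \<eta>" for x y
    using that \<eta> dist_le_sum[of "(x, y)" p] by (simp add: dist_commute)
  have A: "(x, y) \<in> A \<longleftrightarrow> \<phi> (x, y) \<le> 0 \<and> x \<in> X" if "\<bar>x - fst p\<bar> \<le> \<eta>" "\<bar>y - snd p\<bar> \<le> \<eta>" for x y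
    using ball_A[OF sub[OF that]] by simp
  have cont: "continuous_on ({fst p - \<eta>..fst p + \<eta>} \<times> {snd p - \<eta>..snd p + \<eta>}) \<phi>"
  proof (rule continuous_on_subset[OF ball_cont], rule subsetI)
    fix z assume "z \<in> {fst p - \<eta>..fst p + \<eta>} \<times> {snd p - \<eta>..snd p + \<eta>}"
    then have "\<bar>fst z - fst p\<bar> \<le> \<eta>" "\<bar>snd z - snd p\<bar> \<le> \<eta>"
      unfolding abs_le_iff mem_Times_iff atLeastAtMost_iff by linarith+
    then show "z \<in> ball p e" using sub[of "fst z" "snd z"] by simp
  qed
  have mono: "\<phi> (x, y) < \<phi> (x, y')"
    if "\<bar>x - fst p\<bar> \<le> \<eta>" "snd p - \<eta> \<le> y" "y < y'" "y' \<le> snd p + \<eta>" for x y y'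
  proof -
    have "\<bar>y - snd p\<bar> \<le> \<eta>" "\<bar>y' - snd p\<bar> \<le> \<eta>" using that by linarith+
    then show ?thesis using ball_mono[of "y' - y" "(x, y)"] sub that by simp
  qed
  obtain p1 p2 where p: "p = (p1, p2)" by force
  define h where "h = min \<eta> (s / 8)"
  have h: "0 < h" "h \<le> \<eta>" "4 * h < s" using \<eta> \<open>s > 0\<close> by (auto simp: h_def)
  have neg: "\<phi> (p1, p2 - h / 2) < 0" and pos: "\<phi> (p1, p2 + h / 2) > 0"
    using mono[of p1 "p2 - h / 2" p2] mono[of p1 p2 "p2 + h / 2"] zero h by (auto simp: p)
  have col: "continuous_on {p1 - \<eta>..p1 + \<eta>} (\<lambda>x. \<phi> (x, y))" if "y \<in> {p2 - \<eta>..p2 + \<eta>}" for y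
    by (rule continuous_on_compose2[OF cont]) (use that in \<open>auto simp: p intro!: continuous_intros\<close>)
  obtain d1 where d1: "d1 > 0" "\<And>x. x \<in> {p1 - \<eta>..p1 + \<eta>} \<Longrightarrow> dist x p1 < d1 \<Longrightarrow>
      dist (\<phi> (x, p2 - h / 2)) (\<phi> (p1, p2 - h / 2)) < - \<phi> (p1, p2 - h / 2)"
    using col[of "p2 - h / 2", unfolded continuous_on_iff, rule_format, of p1 "- \<phi> (p1, p2 - h / 2)"] neg h
    by auto
  obtain d2 where d2: "d2 > 0" "\<And>x. x \<in> {p1 - \<eta>..p1 + \<eta>} \<Longrightarrow> dist x p1 < d2 \<Longrightarrow>
      dist (\<phi> (x, p2 + h / 2)) (\<phi> (p1, p2 + h / 2)) < \<phi> (p1, p2 + h / 2)"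
    using col[of "p2 + h / 2", unfolded continuous_on_iff, rule_format, of p1 "\<phi> (p1, p2 + h / 2)"] pos h
    by auto
  define \<xi> where "\<xi> = min h (min d1 d2 / 2)"
  have \<xi>: "0 < \<xi>" "\<xi> \<le> h" "\<xi> < d1" "\<xi> < d2" using h d1(1) d2(1) by (auto simp: \<xi>_def)
  have neg': "\<phi> (x, p2 - h / 2) < 0" and pos': "\<phi> (x, p2 + h / 2) > 0" if "x \<in> {p1 - \<xi>..p1 + \<xi>}" for x
  proof -
    have "x \<in> {p1 - \<eta>..p1 + \<eta>}" "dist x p1 < d1" "dist x p1 < d2"
      using that \<xi> h by (auto simp: dist_real_def abs_less_iff)
    then show "\<phi> (x, p2 - h / 2) < 0" "\<phi> (x, p2 + h / 2) > 0"
      using d1(2)[of x] d2(2)[of x] by (auto simp: dist_real_def)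
  qed
  \<comment> \<open>A vertical cut through \<open>p\<close> leaves half of the width, an interval of
    length \<open>\<xi>\<close>.\<close>
  define m where "m = min (h / 2) \<xi>"
  have m: "0 < m" "m \<le> h / 2" "m \<le> \<xi>" using h \<xi> by (auto simp: m_def)
  have A': "(x, y) \<in> A \<longleftrightarrow> \<phi> (x, y) \<le> 0 \<and> x \<in> X" if "x \<in> {p1 - \<xi>..p1 + \<xi>}" "y \<in> {p2 - h..p2 + h}" for x y
    using A[of x y] that h \<xi> unfolding p by (auto simp: abs_le_iff)
  have mono': "\<phi> (x, y) \<le> \<phi> (x, y')" if "x \<in> {p1 - \<xi>..p1 + \<xi>}" "p2 - h \<le> y" "y \<le> y'" "y' \<le> p2 + h" for x y y'
    using mono[of x y y'] that h \<xi> by (cases "y = y'") (auto simp: p abs_le_iff)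
  have "tame_box A ({p1 - \<xi>..p1 + \<xi>} \<times> {p2 - h..p2 + h}) m"
  proof (rule tame_box_columns[where I = "{p1 - \<xi>..p1 + \<xi>} \<inter> X" and J = "{p1 - \<xi>..p1 + \<xi>}"])
    show "(x, y') \<in> A" if "x \<in> {p1 - \<xi>..p1 + \<xi>}" "y \<in> {p2 - h..p2 + h}" "y' \<in> {p2 - h..y}" "(x, y) \<in> A" for x y y'
      using that A'[of x y] A'[of x y'] mono'[of x y' y] by auto
    show "(x, y) \<in> A \<longleftrightarrow> x \<in> {p1 - \<xi>..p1 + \<xi>} \<inter> X" if "x \<in> {p1 - \<xi>..p1 + \<xi>}" "y \<in> {p2 - h..p2 - h + m}" for x y
      using that A'[of x y] neg'[of x] mono'[of x y "p2 - h / 2"] m h by auto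
    show "(x, y) \<notin> A \<longleftrightarrow> x \<in> {p1 - \<xi>..p1 + \<xi>}" if "x \<in> {p1 - \<xi>..p1 + \<xi>}" "y \<in> {p2 + h - m..p2 + h}" for x y
      using that A'[of x y] pos'[of x] mono'[of x "p2 + h / 2" y] m h by auto
    show "is_interval ({p1 - \<xi>..p1 + \<xi>} \<inter> X)"
      using X by (auto simp: p is_interval_1)
    show "{p1 - \<xi>..p1 + \<xi>} \<inter> X = {} \<or> (\<exists>u. {u..u + m} \<subseteq> {p1 - \<xi>..p1 + \<xi>} \<inter> X)"
      using X m \<xi> by (auto simp: p intro: exI[of _ "p1 - \<xi>"] exI[of _ p1])
    show "{p1 - \<xi>..p1 + \<xi>} = {} \<or> (\<exists>u. {u..u + m} \<subseteq> {p1 - \<xi>..p1 + \<xi>})"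
      using m by (intro disjI2 exI[of _ "p1 - \<xi>"]) auto
  qed (use m h in \<open>auto simp: is_interval_cc\<close>)
  then show "\<exists>a b c d m h. 0 < m \<and> m \<le> h \<and>
    {fst p - h..fst p + h} \<times> {snd p - h..snd p + h} \<subseteq> {a..b} \<times> {c..d} \<and>
    (b - a) + (d - c) < s \<and> tame_box A ({a..b} \<times> {c..d}) m"
    using h \<xi> m unfolding p
    by - (rule exI[of _ "p1 - \<xi>"], rule exI[of _ "p1 + \<xi>"], rule exI[of _ "p2 - h"],
        rule exI[of _ "p2 + h"], rule exI[of _ m], rule exI[of _ m], auto)
qed

lemma tame_at_graph:
  fixes p :: plane and \<phi> :: "plane \<Rightarrow> real"
  assumes e: "e > 0"
    and A: "\<And>z. z \<in> ball p e \<Longrightarrow> z \<in> A \<longleftrightarrow> \<phi> z \<le> 0 \<and> fst z \<in> X"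
    and X: "X = UNIV \<or> X = {..fst p} \<or> X = {fst p..}"
    and cont: "continuous_on (ball p e) \<phi>"
    and zero: "\<phi> p = 0"
    and mono: "monotone_along (0, 1) (ball p e) \<phi>"
  shows "tame_at A p"
  using mono[unfolded monotone_along_def]
proof
  assume "\<forall>z a. 0 < a \<and> z \<in> ball p e \<and> z + a *\<^sub>R (0, 1) \<in> ball p e \<longrightarrow> \<phi> z < \<phi> (z + a *\<^sub>R (0, 1))"
  then show ?thesis using tame_at_graph_increasing[OF e A X cont zero] by blast
next
  assume dec: "\<forall>z a. 0 < a \<and> z \<in> ball p e \<and> z + a *\<^sub>R (0, 1) \<in> ball p e \<longrightarrow> \<phi> (z + a *\<^sub>R (0, 1)) < \<phi> z"
  have fl: "flip z \<in> ball p e \<longleftrightarrow> z \<in> ball (flip p) e" for z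
    using plane_sym_flip unfolding plane_sym_def by (metis flip_flip mem_ball)
  have "tame_at (flip ` A) (flip p)"
  proof (rule tame_at_graph_increasing[OF e, where \<phi> = "\<lambda>z. \<phi> (flip z)" and X = X])
    show "z \<in> flip ` A \<longleftrightarrow> \<phi> (flip z) \<le> 0 \<and> fst z \<in> X" if "z \<in> ball (flip p) e" for z
      using A[of "flip z"] that fl
      unfolding mem_image_involution[of flip, OF flip_flip] by (simp add: flip_def)
    show "X = UNIV \<or> X = {..fst (flip p)} \<or> X = {fst (flip p)..}" using X by (simp add: flip_def)
    show "continuous_on (ball (flip p) e) (\<lambda>z. \<phi> (flip z))"
    proof (rule continuous_on_compose2[OF cont])
      show "continuous_on (ball (flip p) e) flip" unfolding flip_def by (intro continuous_intros)
    qed (use fl in auto)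
    show "\<phi> (flip (flip p)) = 0" using zero by simp
    fix z and a :: real assume z: "0 < a" "z \<in> ball (flip p) e" "z + a *\<^sub>R (0, 1) \<in> ball (flip p) e"
    have "flip (z + a *\<^sub>R (0, 1)) + a *\<^sub>R (0, 1) = flip z" by (simp add: flip_def prod_eq_iff)
    then show "\<phi> (flip z) < \<phi> (flip (z + a *\<^sub>R (0, 1)))"
      using dec[rule_format, of a "flip (z + a *\<^sub>R (0, 1))"] z fl by simp
  qed
  then show ?thesis by (rule tame_at_flip)
qed

section \<open>Local structure of polyrectangles\<close>

text \<open>The set \<open>k\<close> of half-lines is \<open>UNIV\<close> at interior points, empty
  outside, and a singleton at end points only; singletons are what detects corners later.\<close>

lemma interval_local:
  assumes I: "admissible_interval I"
  shows "\<exists>\<eta>>0. \<exists>k. (\<forall>x. \<bar>x - a\<bar> < \<eta> \<longrightarrow> (x \<in> I \<longleftrightarrow> (\<exists>t\<in>k. side t a x))) \<and>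
    (\<forall>t. k = {t} \<longrightarrow> a \<in> frontier I)"
proof -
  have cl: "closed I" and iv: "\<And>x y z. x \<in> I \<Longrightarrow> z \<in> I \<Longrightarrow> x \<le> y \<Longrightarrow> y \<le> z \<Longrightarrow> y \<in> I"
    using I unfolding admissible_interval_def is_interval_1 by blast+
  consider "a \<in> interior I" | "a \<notin> I" | "a \<in> I" "a \<notin> interior I" by blast
  then show ?thesis
  proof cases
    case 1
    then obtain e where e: "e > 0" "ball a e \<subseteq> I" by (auto simp: mem_interior)
    then have "x \<in> I" if "\<bar>x - a\<bar> < e" for x
      using that by (auto simp: dist_real_def subset_iff abs_minus_commute)
    moreover have "\<exists>t\<in>UNIV. side t a x" for x unfolding side_def by (cases "a \<le> x") auto
    moreover have "UNIV \<noteq> {t}" for t :: bool by auto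
    ultimately show ?thesis using e(1) by (intro exI[of _ e] conjI exI[of _ UNIV]) auto
  next
    case 2
    then obtain e where e: "e > 0" "ball a e \<subseteq> - I"
      using cl open_contains_ball[of "- I"] by auto
    then have "x \<notin> I" if "\<bar>x - a\<bar> < e" for x
      using that by (auto simp: dist_real_def subset_iff abs_minus_commute)
    then show ?thesis using e(1) by (intro exI[of _ e] conjI exI[of _ "{}"]) auto
  next
    case 3
    then have fr: "a \<in> frontier I" using cl by (simp add: frontier_def)
    obtain q where "q \<in> interior I" using I unfolding admissible_interval_def by blast
    then have q: "q \<in> I" "q \<noteq> a" using 3 interior_subset by auto
    have one: "(\<forall>x\<in>I. a \<le> x) \<or> (\<forall>x\<in>I. x \<le> a)"
    proof (rule ccontr)
      assume "\<not> ?thesis"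
      then obtain x y where xy: "x \<in> I" "x < a" "y \<in> I" "a < y" by (auto simp: not_le)
      have "{x<..<y} \<subseteq> I" using iv[of x y] xy by auto
      then have "a \<in> interior I" using xy by (intro interiorI[of "{x<..<y}"]) auto
      then show False using 3 by blast
    qed
    let ?t = "a < q"
    have "x \<in> I \<longleftrightarrow> (\<exists>t\<in>{?t}. side t a x)" if "\<bar>x - a\<bar> < \<bar>q - a\<bar>" for x
      using one q 3(1) that iv[of a q x] iv[of q a x] unfolding side_def by (auto split: if_splits)
    then show ?thesis using fr q(2) by (intro exI[of _ "\<bar>q - a\<bar>"] conjI exI[of _ "{?t}"]) auto
  qed
qed

lemma rectangle_local:
  assumes R: "admissible_rectangle R"
  shows "\<exists>\<eta> k l. \<eta> > 0 \<and> (\<forall>x y. \<bar>x - fst p\<bar> < \<eta> \<longrightarrow> \<bar>y - snd p\<bar> < \<eta> \<longrightarrow>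
      ((x, y) \<in> R \<longleftrightarrow> in_quadrants (k \<times> l) p (x, y))) \<and>
    (\<forall>t u. k = {t} \<longrightarrow> l = {u} \<longrightarrow> p \<in> rect_corners R)"
proof -
  obtain I J where IJ: "admissible_interval I" "admissible_interval J" "R = I \<times> J"
    using R unfolding admissible_rectangle_def by blast
  then have ne: "I \<noteq> {}" "J \<noteq> {}" unfolding admissible_interval_def by auto
  obtain \<eta>1 k where 1: "\<eta>1 > 0" "\<And>x. \<bar>x - fst p\<bar> < \<eta>1 \<Longrightarrow> x \<in> I \<longleftrightarrow> (\<exists>t\<in>k. side t (fst p) x)"
    "\<And>t. k = {t} \<Longrightarrow> fst p \<in> frontier I" using interval_local[OF IJ(1), of "fst p"] by metis
  obtain \<eta>2 l where 2: "\<eta>2 > 0" "\<And>x. \<bar>x - snd p\<bar> < \<eta>2 \<Longrightarrow> x \<in> J \<longleftrightarrow> (\<exists>t\<in>l. side t (snd p) x)"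
    "\<And>t. l = {t} \<Longrightarrow> snd p \<in> frontier J" using interval_local[OF IJ(2), of "snd p"] by metis
  have "(x, y) \<in> R \<longleftrightarrow> in_quadrants (k \<times> l) p (x, y)"
    if "\<bar>x - fst p\<bar> < min \<eta>1 \<eta>2" "\<bar>y - snd p\<bar> < min \<eta>1 \<eta>2" for x y
    using that 1(2)[of x] 2(2)[of y] unfolding IJ(3) in_quadrants_def by auto
  moreover have "p \<in> rect_corners R" if "k = {t}" "l = {u}" for t u
    using 1(3)[OF that(1)] 2(3)[OF that(2)] ne unfolding rect_corners_def IJ(3) by (simp add: mem_Times_iff)
  moreover have "min \<eta>1 \<eta>2 > 0" using 1(1) 2(1) by simp
  ultimately show ?thesis
    by - (rule exI[of _ "min \<eta>1 \<eta>2"], rule exI[of _ k], rule exI[of _ l], blast)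
qed

text \<open>Two opposite quadrants without a third would come from two different rectangles that
  both have a corner at \<open>p\<close>, and distinct rectangles share no corner. This is how the
  definition of polyrectangles excludes crossings.\<close>

lemma polyrectangle_local:
  assumes "polyrectangle \<R> W"
  obtains \<eta> K where "\<eta> > 0"
    "\<And>x y. \<bar>x - fst p\<bar> < \<eta> \<Longrightarrow> \<bar>y - snd p\<bar> < \<eta> \<Longrightarrow> (x, y) \<in> W \<longleftrightarrow> in_quadrants K p (x, y)"
    "\<And>t u. (t, u) \<in> K \<Longrightarrow> (\<not> t, \<not> u) \<in> K \<Longrightarrow> (t, \<not> u) \<in> K \<or> (\<not> t, u) \<in> K"
    "\<And>t u. K = {(t, u)} \<Longrightarrow> \<exists>R\<in>\<R>. p \<in> rect_corners R"
proof -
  have fin: "finite \<R>" and adm: "\<And>R. R \<in> \<R> \<Longrightarrow> admissible_rectangle R" and W: "W = \<Union>\<R>"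
    and disj: "\<And>R S. R \<in> \<R> \<Longrightarrow> S \<in> \<R> \<Longrightarrow> R \<noteq> S \<Longrightarrow> rect_corners R \<inter> rect_corners S = {}"
    using assms unfolding polyrectangle_def pairwise_def by blast+
  have "\<forall>R\<in>\<R>. \<exists>\<eta> k l. \<eta> > 0 \<and> (\<forall>x y. \<bar>x - fst p\<bar> < \<eta> \<longrightarrow> \<bar>y - snd p\<bar> < \<eta> \<longrightarrow>
      ((x, y) \<in> R \<longleftrightarrow> in_quadrants (k \<times> l) p (x, y))) \<and>
    (\<forall>t u. k = {t} \<longrightarrow> l = {u} \<longrightarrow> p \<in> rect_corners R)"
    by (intro ballI rectangle_local adm)
  then obtain \<eta> k l where *: "\<forall>R\<in>\<R>. \<eta> R > 0 \<and> (\<forall>x y. \<bar>x - fst p\<bar> < \<eta> R \<longrightarrow> \<bar>y - snd p\<bar> < \<eta> R \<longrightarrow>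
      ((x, y) \<in> R \<longleftrightarrow> in_quadrants (k R \<times> l R) p (x, y))) \<and>
    (\<forall>t u. k R = {t} \<longrightarrow> l R = {u} \<longrightarrow> p \<in> rect_corners R)"
    unfolding bchoice_iff by (elim exE)
  have
    \<eta>: "\<And>R. R \<in> \<R> \<Longrightarrow> \<eta> R > 0"
    and loc: "\<And>R x y. R \<in> \<R> \<Longrightarrow> \<bar>x - fst p\<bar> < \<eta> R \<Longrightarrow> \<bar>y - snd p\<bar> < \<eta> R \<Longrightarrow>
      (x, y) \<in> R \<longleftrightarrow> in_quadrants (k R \<times> l R) p (x, y)"
    and cor: "\<And>R t u. R \<in> \<R> \<Longrightarrow> k R = {t} \<Longrightarrow> l R = {u} \<Longrightarrow> p \<in> rect_corners R"
    using * by simp_all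
  define e where "e = Min (insert 1 (\<eta> ` \<R>))"
  define K where "K = (\<Union>R\<in>\<R>. k R \<times> l R)"
  have e: "e > 0" "\<And>R. R \<in> \<R> \<Longrightarrow> e \<le> \<eta> R"
    using fin \<eta> unfolding e_def by (auto intro: Min_le)
  \<comment> \<open>A quadrant whose two adjacent quadrants are missing is not part of a half-plane,
    so it stems from a rectangle with a corner at \<open>p\<close>.\<close>
  have single: "\<exists>R\<in>\<R>. k R = {t} \<and> l R = {u} \<and> p \<in> rect_corners R"
    if tu: "(t, u) \<in> K" "(t, \<not> u) \<notin> K" "(\<not> t, u) \<notin> K" for t u
  proof -
    obtain R where R: "R \<in> \<R>" "t \<in> k R" "u \<in> l R" using tu(1) unfolding K_def by blast
    have "(\<not> t) \<notin> k R" "(\<not> u) \<notin> l R" using R tu(2,3) unfolding K_def by blast+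
    have "k R = {t}"
    proof (intro equalityI subsetI)
      fix s assume "s \<in> k R"
      then show "s \<in> {t}" using \<open>(\<not> t) \<notin> k R\<close> by (cases s; cases t) auto
    qed (use R in simp)
    moreover have "l R = {u}"
    proof (intro equalityI subsetI)
      fix s assume "s \<in> l R"
      then show "s \<in> {u}" using \<open>(\<not> u) \<notin> l R\<close> by (cases s; cases u) auto
    qed (use R in simp)
    ultimately show ?thesis using cor R(1) by blast
  qed
  show thesis
  proof (rule that[OF e(1), of K])
    show "(x, y) \<in> W \<longleftrightarrow> in_quadrants K p (x, y)" if "\<bar>x - fst p\<bar> < e" "\<bar>y - snd p\<bar> < e" for x y
    proof -
      have "(x, y) \<in> R \<longleftrightarrow> in_quadrants (k R \<times> l R) p (x, y)" if "R \<in> \<R>" for R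
        using loc[OF that, of x y] e(2)[OF that] \<open>\<bar>x - fst p\<bar> < e\<close> \<open>\<bar>y - snd p\<bar> < e\<close> by simp
      then show ?thesis unfolding W K_def in_quadrants_def by blast
    qed
    show "(t, \<not> u) \<in> K \<or> (\<not> t, u) \<in> K" if tu: "(t, u) \<in> K" "(\<not> t, \<not> u) \<in> K" for t u
    proof (rule ccontr)
      assume n: "\<not> ?thesis"
      obtain R where R: "R \<in> \<R>" "k R = {t}" "p \<in> rect_corners R" using single[of t u] tu(1) n by blast
      obtain S where S: "S \<in> \<R>" "k S = {\<not> t}" "p \<in> rect_corners S"
        using single[of "\<not> t" "\<not> u"] tu(2) n by auto
      have "R \<noteq> S" using R(2) S(2) by auto
      then show False using disj[OF R(1) S(1)] R(3) S(3) by blast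
    qed
    show "\<exists>R\<in>\<R>. p \<in> rect_corners R" if "K = {(t, u)}" for t u
      using single[of t u] that by auto
  qed
qed

abbreviation sg :: "bool \<Rightarrow> real" where "sg t \<equiv> (if t then 1 else - 1)"

text \<open>
  Where \<open>W\<close> is locally the complement of an open quadrant, \<open>p\<close> ends the edge that starts at \<open>p\<close> and
  runs along the boundary of that quadrant; this edge is a connected component of a line section
  of the frontier.
\<close>

lemma reentrant_corner:
  assumes \<eta>: "\<eta> > 0"
    and W: "\<And>x y. \<bar>x - fst p\<bar> < \<eta> \<Longrightarrow> \<bar>y - snd p\<bar> < \<eta> \<Longrightarrow> (x, y) \<in> W \<longleftrightarrow> \<not> (0 < sg t * (x - fst p) \<and> 0 < sg u * (y - snd p))"
  shows "\<exists>s. edge W s \<and> p extreme_point_of s"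
proof -
  obtain p1 p2 where p: "p = (p1, p2)" by force
  \<comment> \<open>Of the two half-lines bounding the missing quadrant, the horizontal one is
    used.\<close>
  define L where "L = {z :: plane. snd z = p2}"
  define s where "s = connected_component_set (frontier W \<inter> L) p"
  have sgt: "sg t * sg t = 1" "sg u * sg u = 1" by auto
  have small: "(p1 + x, p2 + y) \<in> W \<longleftrightarrow> \<not> (0 < sg t * x \<and> 0 < sg u * y)" if "\<bar>x\<bar> < \<eta>" "\<bar>y\<bar> < \<eta>" for x y
    using W[of "p1 + x" "p2 + y"] that by (simp add: p)
  have ray: "(p1 + sg t * \<tau>, p2) \<in> frontier W" if \<tau>: "0 \<le> \<tau>" "\<tau> < \<eta>" for \<tau>
    unfolding frontier_straddle
  proof (intro allI impI conjI)
    fix e :: real assume e: "e > 0"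
    have "(p1 + sg t * \<tau>, p2) \<in> W" using small[of "sg t * \<tau>" 0] \<tau> \<eta> by auto
    then show "\<exists>x\<in>W. dist (p1 + sg t * \<tau>, p2) x < e" using e by (intro bexI) auto
    define \<delta> where "\<delta> = min e (\<eta> - \<tau>) / 4"
    have "0 < \<delta>" "4 * \<delta> \<le> e" "4 * \<delta> \<le> \<eta> - \<tau>" using e \<tau> by (auto simp: \<delta>_def)
    then have \<delta>: "0 < \<delta>" "4 * \<delta> \<le> e" "\<tau> + \<delta> < \<eta>" "\<delta> < \<eta>" using \<tau> by linarith+
    have "(p1 + sg t * (\<tau> + \<delta>), p2 + sg u * \<delta>) \<notin> W"
      using small[of "sg t * (\<tau> + \<delta>)" "sg u * \<delta>"] \<tau> \<delta> by auto
    moreover have "dist (p1 + sg t * \<tau>, p2) (p1 + sg t * (\<tau> + \<delta>), p2 + sg u * \<delta>) < e"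
    proof -
      have "\<bar>p1 + sg t * \<tau> - (p1 + sg t * (\<tau> + \<delta>))\<bar> + \<bar>p2 - (p2 + sg u * \<delta>)\<bar> = 2 * \<delta>"
        using \<delta>(1) by auto
      then show ?thesis using \<delta> dist_le_sum[of "(p1 + sg t * \<tau>, p2)" "(p1 + sg t * (\<tau> + \<delta>), p2 + sg u * \<delta>)"] by simp
    qed
    ultimately show "\<exists>x. x \<notin> W \<and> dist (p1 + sg t * \<tau>, p2) x < e" by blast
  qed
  \<comment> \<open>On the other side of \<open>p\<close> all points near the line belong to
    \<open>W\<close>, so the frontier stops at \<open>p\<close>.\<close>
  have off: "(p1 - sg t * \<tau>, p2) \<notin> frontier W" if \<tau>: "0 < \<tau>" "\<tau> < \<eta>" for \<tau>
  proof
    assume "(p1 - sg t * \<tau>, p2) \<in> frontier W"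
    moreover have "min \<tau> (\<eta> - \<tau>) > 0" using \<tau> by simp
    ultimately obtain z where z: "z \<notin> W" "dist (p1 - sg t * \<tau>, p2) z < min \<tau> (\<eta> - \<tau>)"
      unfolding frontier_straddle by blast
    define x y where "x = fst z - p1" and "y = snd z - p2"
    have zz: "z = (p1 + x, p2 + y)" by (simp add: x_def y_def)
    have "\<bar>sg t * \<tau> + x\<bar> < min \<tau> (\<eta> - \<tau>)" "\<bar>y\<bar> < min \<tau> (\<eta> - \<tau>)"
      using dist_fst_le[of "(p1 - sg t * \<tau>, p2)" z] dist_snd_le[of "(p1 - sg t * \<tau>, p2)" z] z(2)
      by (auto simp: dist_real_def zz split: if_splits)
    then have "\<bar>x\<bar> < \<eta>" "\<bar>y\<bar> < \<eta>" "\<not> 0 < sg t * x" using \<tau> by (auto split: if_splits)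
    then show False using small[of x y] z(1) zz by simp
  qed
  have sub: "s \<subseteq> frontier W \<inter> L" unfolding s_def by (rule connected_component_subset)
  have pf: "p \<in> frontier W \<inter> L" using ray[of 0] \<eta> by (simp add: p L_def)
  have ps: "p \<in> s" using pf by (simp add: s_def connected_component_refl)
  have colL: "collinear L"
    unfolding collinear_alt L_def by (rule exI[of _ "(0, p2)"], rule exI[of _ "(1, 0)"]) (auto simp: prod_eq_iff)
  have cols: "collinear s" using colL sub collinear_subset by blast
  have convs: "convex s"
    using convex_connected_collinear[OF cols] by (simp add: s_def)
  have "(p1 + sg t * (\<eta> / 2), p2) \<in> s"
  proof -
    have "closed_segment p (p1 + sg t * (\<eta> / 2), p2) \<subseteq> frontier W \<inter> L"
    proof
      fix z assume "z \<in> closed_segment p (p1 + sg t * (\<eta> / 2), p2)"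
      then obtain \<theta> where \<theta>: "0 \<le> \<theta>" "\<theta> \<le> 1" "z = (1 - \<theta>) *\<^sub>R p + \<theta> *\<^sub>R (p1 + sg t * (\<eta> / 2), p2)"
        unfolding in_segment by blast
      have "z = (p1 + sg t * (\<theta> * (\<eta> / 2)), p2)"
        unfolding \<theta>(3) p by (auto simp: algebra_simps)
      moreover have "\<theta> * (\<eta> / 2) < \<eta>" using \<theta> \<eta> mult_left_le_one_le[of "\<eta> / 2" \<theta>] by simp
      ultimately show "z \<in> frontier W \<inter> L" using ray[of "\<theta> * (\<eta> / 2)"] \<theta> \<eta> by (simp add: L_def)
    qed
    then have "closed_segment p (p1 + sg t * (\<eta> / 2), p2) \<subseteq> s"
      unfolding s_def by (intro connected_component_maximal) auto
    then show ?thesis by auto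
  qed
  then have two: "\<exists>a\<in>s. \<exists>b\<in>s. a \<noteq> b"
    using ps \<eta> by (intro bexI[of _ p] bexI[of _ "(p1 + sg t * (\<eta> / 2), p2)"]) (auto simp: p)
  have seg: "boundary_segment W s"
    using sub convs cols two unfolding boundary_segment_def by blast
  have "edge W s"
    unfolding edge_def
  proof (intro conjI seg allI impI)
    fix r assume r: "boundary_segment W r \<and> s \<subseteq> r"
    obtain a b where ab: "a \<in> s" "b \<in> s" "a \<noteq> b" using two by blast
    \<comment> \<open>Two distinct points of \<open>s\<close> determine the line, so a collinear
      extension stays in \<open>L\<close>; being convex, it then stays in the component
      \<open>s\<close>.\<close>
    have "r \<subseteq> L"
    proof
      fix z assume "z \<in> r"
      have "collinear {a, b, z}" using r ab \<open>z \<in> r\<close> unfolding boundary_segment_def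
        by (meson collinear_subset empty_subsetI insert_subset subset_iff)
      then obtain v w where vw: "\<forall>x\<in>{a, b, z}. \<exists>c. x = v + c *\<^sub>R w" unfolding collinear_alt by blast
      then obtain ca cb cz where c: "a = v + ca *\<^sub>R w" "b = v + cb *\<^sub>R w" "z = v + cz *\<^sub>R w" by auto
      have "snd a = p2" "snd b = p2" using ab sub by (auto simp: L_def)
      then have "snd v + ca * snd w = p2" "snd v + cb * snd w = p2" using c by simp_all
      then have "ca * snd w = cb * snd w" by linarith
      then have "(ca - cb) * snd w = 0" by (simp add: left_diff_distrib)
      moreover have "ca \<noteq> cb" using c ab(3) by auto
      ultimately have "snd w = 0" by simp
      then have "snd z = snd a" using c by simp
      then show "z \<in> L" using \<open>snd a = p2\<close> by (simp add: L_def)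
    qed
    then have "r \<subseteq> s"
      unfolding s_def using r ps
      by (intro connected_component_maximal) (auto simp: boundary_segment_def convex_connected)
    then show "r = s" using r by blast
  qed
  moreover have "p extreme_point_of s"
    unfolding extreme_point_of_def
  proof (intro conjI ps ballI notI)
    fix a b assume ab: "a \<in> s" "b \<in> s" and "p \<in> open_segment a b"
    then obtain \<theta> where \<theta>: "0 < \<theta>" "\<theta> < 1" "p = (1 - \<theta>) *\<^sub>R a + \<theta> *\<^sub>R b" "a \<noteq> b"
      unfolding in_segment by blast
    have ab2: "snd a = p2" "snd b = p2" using ab sub by (auto simp: L_def)
    then have "fst a \<noteq> fst b" using \<theta>(4) by (simp add: prod_eq_iff)
    have comb: "(1 - \<theta>) * (sg t * (fst a - p1)) + \<theta> * (sg t * (fst b - p1)) = 0"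
      using \<theta>(3) unfolding p by (auto simp: algebra_simps prod_eq_iff)
    \<comment> \<open>If \<open>p\<close> were strictly between two points of \<open>s\<close>, one
      of them would be on the side where the frontier stops; moving it towards \<open>p\<close>
      brings it into the range of \<open>off\<close>.\<close>
    have "\<exists>w\<in>s. sg t * (fst w - p1) < 0"
    proof (rule ccontr)
      assume "\<not> ?thesis"
      then have nn: "0 \<le> sg t * (fst a - p1)" "0 \<le> sg t * (fst b - p1)" using ab by (auto simp: not_less)
      then have "(1 - \<theta>) * (sg t * (fst a - p1)) = 0" "\<theta> * (sg t * (fst b - p1)) = 0"
        using comb \<theta>(1,2) add_nonneg_eq_0_iff[of "(1 - \<theta>) * (sg t * (fst a - p1))" "\<theta> * (sg t * (fst b - p1))"]
        by simp_all
      then show False using \<theta>(1,2) \<open>fst a \<noteq> fst b\<close> by (auto split: if_splits)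
    qed
    then obtain w where w: "w \<in> s" "sg t * (fst w - p1) < 0" by blast
    define d where "d = - (sg t * (fst w - p1))"
    have d: "d > 0" "fst w = p1 - sg t * d" using w(2) by (auto simp: d_def)
    define \<tau> where "\<tau> = min d (\<eta> / 2)"
    have \<tau>: "0 < \<tau>" "\<tau> \<le> d" "\<tau> < \<eta>" using d \<eta> by (auto simp: \<tau>_def)
    have "(1 - \<tau> / d) *\<^sub>R p + (\<tau> / d) *\<^sub>R w \<in> s"
      using convs ps w(1) \<tau> d(1) by (intro convexD) auto
    moreover have "snd w = p2" using w sub by (auto simp: L_def)
    then have "(1 - \<tau> / d) *\<^sub>R p + (\<tau> / d) *\<^sub>R w = (p1 - sg t * \<tau>, p2)"
      using d by (auto simp: p prod_eq_iff field_simps)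
    ultimately show False using off[OF \<tau>(1,3)] sub by auto
  qed
  ultimately show ?thesis by blast
qed

section \<open>Regular sets cut by polyrectangles\<close>

text \<open>Continuity of the gradient preserves the sign of the derivative along \<open>v\<close>
  on a small ball. Multiplication by \<open>\<sigma>\<close> reduces both signs to an increasing
  function.\<close>

lemma C1_regular_monotone:
  assumes reg: "C1_regular_on U f g" and p: "p \<in> U" "inner v (g p) \<noteq> 0"
  obtains \<eta> where "\<eta> > 0" "ball p \<eta> \<subseteq> U" "continuous_on (ball p \<eta>) f"
    "monotone_along v (ball p \<eta>) f"
proof -
  define \<sigma> where "\<sigma> = inner v (g p)"
  define V where "V = {z \<in> U. 0 < \<sigma> * inner v (g z)}"
  have U: "open U" "\<And>y. y \<in> U \<Longrightarrow> GDERIV f y :> g y" "continuous_on U g"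
    using reg unfolding C1_regular_on_def by blast+
  have "continuous_on U (\<lambda>z. \<sigma> * inner v (g z))" using U(3) by (intro continuous_intros)
  then have "open (U \<inter> (\<lambda>z. \<sigma> * inner v (g z)) -` {0<..})"
    using U(1) by (intro continuous_open_preimage) auto
  moreover have "V = U \<inter> (\<lambda>z. \<sigma> * inner v (g z)) -` {0<..}" by (auto simp: V_def)
  ultimately have "open V" by simp
  moreover have "\<sigma> \<noteq> 0" using p(2) by (simp add: \<sigma>_def)
  then have "0 < \<sigma> * \<sigma>" using not_real_square_gt_zero by blast
  then have "p \<in> V" using p(1) by (simp add: V_def \<sigma>_def)
  ultimately obtain \<eta> where \<eta>: "\<eta> > 0" "ball p \<eta> \<subseteq> V" unfolding open_contains_ball by blast
  have cont: "continuous_on (ball p \<eta>) f"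
  proof (intro continuous_at_imp_continuous_on ballI)
    fix x assume "x \<in> ball p \<eta>"
    then have "x \<in> U" using \<eta>(2) unfolding V_def by blast
    then have "GDERIV f x :> g x" by (rule U(2))
    then show "isCont f x" unfolding gderiv_def by (rule has_derivative_continuous)
  qed
  have line: "((\<lambda>t. f (z + t *\<^sub>R v)) has_real_derivative inner v (g (z + t *\<^sub>R v))) (at t) \<and>
      0 < \<sigma> * inner v (g (z + t *\<^sub>R v))"
    if z: "z \<in> ball p \<eta>" "z + a *\<^sub>R v \<in> ball p \<eta>" "0 < a" and t: "0 \<le> t" "t \<le> a" for z a t
  proof -
    have "(1 - t / a) *\<^sub>R z + (t / a) *\<^sub>R (z + a *\<^sub>R v) \<in> ball p \<eta>"
      using z t by (intro convexD[OF convex_ball]) auto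
    moreover have "(1 - t / a) *\<^sub>R z + (t / a) *\<^sub>R (z + a *\<^sub>R v) = z + t *\<^sub>R v"
      using z(3) by (simp add: algebra_simps)
    ultimately have V: "z + t *\<^sub>R v \<in> V" using \<eta>(2) by auto
    then have "(f has_derivative (\<lambda>h. inner h (g (z + t *\<^sub>R v)))) (at (z + t *\<^sub>R v))"
      using U(2) unfolding V_def gderiv_def by blast
    moreover have "((\<lambda>t. z + t *\<^sub>R v) has_derivative (\<lambda>t. t *\<^sub>R v)) (at t)"
      by (auto intro!: derivative_eq_intros)
    ultimately have "((\<lambda>t. f (z + t *\<^sub>R v)) has_derivative (\<lambda>s. inner (s *\<^sub>R v) (g (z + t *\<^sub>R v)))) (at t)"
      by (rule has_derivative_compose[rotated])
    then show ?thesis using V by (simp add: has_field_derivative_def mult_commute_abs V_def)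
  qed
  have inc: "\<sigma> * f z < \<sigma> * f (z + a *\<^sub>R v)" if z: "0 < a" "z \<in> ball p \<eta>" "z + a *\<^sub>R v \<in> ball p \<eta>" for z a
  proof -
    have "\<sigma> * f (z + 0 *\<^sub>R v) < \<sigma> * f (z + a *\<^sub>R v)"
    proof (rule DERIV_pos_imp_increasing[OF z(1), of "\<lambda>t. \<sigma> * f (z + t *\<^sub>R v)"])
      fix t assume "0 \<le> t" "t \<le> a"
      from line[OF z(2,3,1) this]
      show "\<exists>y. ((\<lambda>t. \<sigma> * f (z + t *\<^sub>R v)) has_real_derivative y) (at t) \<and> 0 < y"
        using DERIV_cmult by blast
    qed
    then show ?thesis by simp
  qed
  have "monotone_along v (ball p \<eta>) f"
  proof (cases "\<sigma> > 0")
    case True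
    then show ?thesis using inc unfolding monotone_along_def by (simp add: mult_less_cancel_left_pos)
  next
    case False
    then have "\<sigma> < 0" using p(2) by (simp add: \<sigma>_def)
    then show ?thesis using inc unfolding monotone_along_def by (simp add: mult_less_cancel_left_neg)
  qed
  moreover have "ball p \<eta> \<subseteq> U" using \<eta>(2) by (auto simp: V_def)
  ultimately show thesis using that[OF \<eta>(1) _ cont] by blast
qed

lemma tame_at_sublevel_vertical:
  assumes reg: "C1_regular_on U f g" "p \<in> U" "f p = 0" "snd (g p) \<noteq> 0"
    and e: "e > 0" and A: "\<And>z. z \<in> U \<Longrightarrow> z \<in> ball p e \<Longrightarrow> z \<in> A \<longleftrightarrow> f z \<le> 0 \<and> fst z \<in> X"
    and X: "X = UNIV \<or> X = {..fst p} \<or> X = {fst p..}"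
  shows "tame_at A p"
proof -
  have "inner (0, 1) (g p) \<noteq> 0" using reg(4) by (simp add: inner_prod_def)
  then obtain \<eta> where \<eta>: "\<eta> > 0" "ball p \<eta> \<subseteq> U" "continuous_on (ball p \<eta>) f"
    "monotone_along (0, 1) (ball p \<eta>) f"
    by (rule C1_regular_monotone[OF reg(1,2)])
  let ?r = "min e \<eta>"
  have sub: "ball p ?r \<subseteq> ball p \<eta>" "ball p ?r \<subseteq> ball p e" by auto
  show ?thesis
  proof (rule tame_at_graph[where e = ?r and X = X])
    show "continuous_on (ball p ?r) f" using \<eta>(3) sub(1) by (rule continuous_on_subset)
    show "monotone_along (0, 1) (ball p ?r) f"
      using \<eta>(4) sub(1) unfolding monotone_along_def by blast
    show "z \<in> A \<longleftrightarrow> f z \<le> 0 \<and> fst z \<in> X" if "z \<in> ball p ?r" for z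
      using that sub \<eta>(2) by (intro A) auto
  qed (use e \<eta>(1) X reg(3) in auto)
qed

lemma tame_at_sublevel_horizontal:
  assumes reg: "C1_regular_on U f g" "p \<in> U" "f p = 0" "fst (g p) \<noteq> 0"
    and e: "e > 0" and A: "\<And>z. z \<in> U \<Longrightarrow> z \<in> ball p e \<Longrightarrow> z \<in> A \<longleftrightarrow> f z \<le> 0 \<and> snd z \<in> X"
    and X: "X = UNIV \<or> X = {..snd p} \<or> X = {snd p..}"
  shows "tame_at A p"
proof -
  have "inner (1, 0) (g p) \<noteq> 0" using reg(4) by (simp add: inner_prod_def)
  then obtain \<eta> where \<eta>: "\<eta> > 0" "ball p \<eta> \<subseteq> U" "continuous_on (ball p \<eta>) f"
    "monotone_along (1, 0) (ball p \<eta>) f"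
    by (rule C1_regular_monotone[OF reg(1,2)])
  let ?r = "min e \<eta>"
  have sub: "ball p ?r \<subseteq> ball p \<eta>" "ball p ?r \<subseteq> ball p e" by auto
  have sw: "prod.swap z \<in> ball p d \<longleftrightarrow> z \<in> ball (prod.swap p) d" for z d
    by (simp add: dist_prod_def add.commute)
  have step: "prod.swap (z + a *\<^sub>R (0, 1)) = prod.swap z + a *\<^sub>R (1, 0)" for z :: plane and a
    by (simp add: prod_eq_iff)
  have "tame_at (prod.swap ` A) (prod.swap p)"
  proof (rule tame_at_graph[where e = ?r and X = X and \<phi> = "\<lambda>z. f (prod.swap z)"])
    show "continuous_on (ball (prod.swap p) ?r) (\<lambda>z. f (prod.swap z))"
    proof (rule continuous_on_compose2[OF \<eta>(3)])
      show "continuous_on (ball (prod.swap p) ?r) prod.swap" by (intro continuous_on_swap)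
      show "prod.swap ` ball (prod.swap p) ?r \<subseteq> ball p \<eta>" using sw by auto
    qed
    show "monotone_along (0, 1) (ball (prod.swap p) ?r) (\<lambda>z. f (prod.swap z))"
      unfolding monotone_along_def sw[symmetric] step
      using \<eta>(4)[unfolded monotone_along_def] sub(1) by blast
    show "z \<in> prod.swap ` A \<longleftrightarrow> f (prod.swap z) \<le> 0 \<and> fst z \<in> X" if "z \<in> ball (prod.swap p) ?r" for z
    proof -
      have "prod.swap z \<in> ball p ?r" using that sw by blast
      then have "prod.swap z \<in> A \<longleftrightarrow> f (prod.swap z) \<le> 0 \<and> snd (prod.swap z) \<in> X"
        using sub \<eta>(2) by (intro A) blast+
      then show ?thesis
        unfolding mem_image_involution[of "prod.swap :: plane \<Rightarrow> plane", OF swap_swap_plane] by simp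
    qed
  qed (use e \<eta>(1) X reg(3) in auto)
  then show ?thesis by (rule tame_at_swap)
qed

text \<open>Normals are defined through local sublevel sets, so the affine function of a half-plane
  itself certifies its normal.\<close>

lemma is_outward_normal_halfplane_local:
  assumes "\<eta> > 0" "norm n = 1" "\<And>z. z \<in> ball p \<eta> \<Longrightarrow> z \<in> W \<longleftrightarrow> inner (z - p) n \<le> 0"
  shows "is_outward_normal W p n"
  unfolding is_outward_normal_def
proof (intro exI conjI)
  show "p \<in> ball p \<eta>" using assms(1) by simp
  have "GDERIV (\<lambda>z. inner (z - p) n) y :> n" for y
    unfolding gderiv_def by (auto intro!: derivative_eq_intros)
  then show "C1_regular_on (ball p \<eta>) (\<lambda>z. inner (z - p) n) (\<lambda>_. n)"
    using assms(2) unfolding C1_regular_on_def by auto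
  show "n = sgn n" using assms(2) by (simp add: sgn_div_norm)
  show "W \<inter> ball p \<eta> = {y \<in> ball p \<eta>. inner (y - p) n \<le> 0}" using assms(3) by auto
qed simp

text \<open>Of the sixteen sets of quadrants only the two diagonal pairs are excluded. What remains
  are the two trivial sets, four half-planes, four convex corners and four reentrant
  corners.\<close>

lemma quadrant_sets_cases:
  assumes K: "\<forall>t u. (t, u) \<in> K \<longrightarrow> (\<not> t, \<not> u) \<in> K \<longrightarrow> (t, \<not> u) \<in> K \<or> (\<not> t, u) \<in> K"
  obtains "K = {}" | "K = UNIV" | t where "K = {t} \<times> UNIV" | u where "K = UNIV \<times> {u}"
    | t u where "K = {(t, u)}" | t u where "K = - {(t, u)}"
proof -
  have eq: "K = L \<longleftrightarrow> (\<forall>a b. (a, b) \<in> K \<longleftrightarrow> (a, b) \<in> L)" for L by auto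
  have "K = {} \<or> K = UNIV \<or> (\<exists>t. K = {t} \<times> UNIV) \<or> (\<exists>u. K = UNIV \<times> {u}) \<or>
      (\<exists>t u. K = {(t, u)}) \<or> (\<exists>t u. K = - {(t, u)})"
    using K[rule_format, of True True] K[rule_format, of True False] unfolding eq
    by (cases "(True, True) \<in> K"; cases "(True, False) \<in> K"; cases "(False, True) \<in> K"; cases "(False, False) \<in> K")
      (simp_all add: all_bool_eq ex_bool_eq)
  then show thesis using that by metis
qed

text \<open>Quadrants are closed, so \<open>p\<close> is in \<open>W\<close> as soon as one is
  present, while an absent quadrant supplies points outside \<open>W\<close> arbitrarily close to
  \<open>p\<close>.\<close>

lemma quadrants_frontier:
  assumes \<eta>: "\<eta> > 0"
    and W: "\<And>x y. \<bar>x - fst p\<bar> < \<eta> \<Longrightarrow> \<bar>y - snd p\<bar> < \<eta> \<Longrightarrow> (x, y) \<in> W \<longleftrightarrow> in_quadrants K p (x, y)"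
    and K: "K \<noteq> {}" "K \<noteq> UNIV"
  shows "p \<in> frontier W"
  unfolding frontier_straddle
proof (intro allI impI conjI)
  fix e :: real assume e: "e > 0"
  obtain t u where "(t, u) \<in> K" using K(1) by auto
  then have "in_quadrants K p (fst p, snd p)" by (auto simp: in_quadrants_def side_def)
  then have "p \<in> W" using W[of "fst p" "snd p"] \<eta> by simp
  then show "\<exists>x\<in>W. dist p x < e" using e by (intro bexI[of _ p]) auto
  obtain t u where tu: "(t, u) \<notin> K" using K(2) by auto
  define \<delta> where "\<delta> = min e \<eta> / 3"
  have \<delta>: "0 < \<delta>" "2 * \<delta> < e" "\<delta> < \<eta>" using e \<eta> by (auto simp: \<delta>_def)
  let ?z = "(fst p + sg t * \<delta>, snd p + sg u * \<delta>)"
  have "\<not> in_quadrants K p ?z"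
  proof
    assume "in_quadrants K p ?z"
    then obtain t' u' where "(t', u') \<in> K" "side t' 0 (sg t * \<delta>)" "side u' 0 (sg u * \<delta>)"
      by (auto simp: in_quadrants_def side_def split: if_splits)
    then show False using tu \<delta>(1) by (cases t; cases u; cases t'; cases u') (auto simp: side_def)
  qed
  then have "?z \<notin> W" using W[of "fst ?z" "snd ?z"] \<delta> by (auto split: if_splits)
  moreover have "dist p ?z < e"
  proof -
    have "\<bar>fst p - (fst p + sg t * \<delta>)\<bar> + \<bar>snd p - (snd p + sg u * \<delta>)\<bar> = 2 * \<delta>"
      using \<delta>(1) by auto
    then show ?thesis using \<delta>(2) dist_le_sum[of p ?z] by simp
  qed
  ultimately show "\<exists>x. x \<notin> W \<and> dist p x < e" by blast
qed

text \<open>Off the frontier of \<open>F\<close> only the quadrants of \<open>W\<close> matter. On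
  it, the corner hypothesis leaves for \<open>W\<close> nothing, everything or a half-plane; in the
  last case transversality makes the function defining \<open>F\<close> strictly monotone along the
  edge of that half-plane.\<close>

lemma tame_at_Int:
  assumes F: "closed F" "\<And>x. x \<in> frontier F \<Longrightarrow> \<exists>n. is_outward_normal F x n"
    and W: "polyrectangle \<R> W"
    and corner: "frontier F \<inter> corners \<R> W = {}"
    and transversal: "\<And>x. x \<in> frontier F \<inter> frontier W \<Longrightarrow> \<not> collinear {0, outward_normal F x, outward_normal W x}"
  shows "tame_at (F \<inter> W) p"
proof -
  obtain \<eta> K where \<eta>: "\<eta> > 0"
    and loc: "\<And>x y. \<bar>x - fst p\<bar> < \<eta> \<Longrightarrow> \<bar>y - snd p\<bar> < \<eta> \<Longrightarrow> (x, y) \<in> W \<longleftrightarrow> in_quadrants K p (x, y)"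
    and K: "\<And>t u. (t, u) \<in> K \<Longrightarrow> (\<not> t, \<not> u) \<in> K \<Longrightarrow> (t, \<not> u) \<in> K \<or> (\<not> t, u) \<in> K"
    and single: "\<And>t u. K = {(t, u)} \<Longrightarrow> \<exists>R\<in>\<R>. p \<in> rect_corners R"
    using polyrectangle_local[OF W] by metis
  have box: "z \<in> ball p d" if "\<bar>fst z - fst p\<bar> \<le> d / 3" "\<bar>snd z - snd p\<bar> \<le> d / 3" "d > 0" for z d
  proof -
    show ?thesis using that dist_le_sum[of z p] by (simp add: dist_commute)
  qed
  have ballW: "z \<in> W \<longleftrightarrow> in_quadrants K p z" if "z \<in> ball p \<eta>" for z
    using that loc[of "fst z" "snd z"] dist_fst_le[of p z] dist_snd_le[of p z]
    by (auto simp: dist_real_def abs_minus_commute)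
  consider "p \<notin> F" | "p \<in> interior F" | "p \<in> frontier F"
    using F(1) by (auto simp: frontier_def)
  then show ?thesis
  proof cases
    case 1
    then obtain d where d: "d > 0" "ball p d \<subseteq> - F" using F(1) open_contains_ball[of "- F"] by auto
    show ?thesis
    proof (rule tame_at_quadrants[of "d / 3" _ _ "{}"])
      fix x y assume "\<bar>x - fst p\<bar> \<le> d / 3" "\<bar>y - snd p\<bar> \<le> d / 3"
      then have "(x, y) \<in> ball p d" using box[of "(x, y)" d] d(1) by simp
      then show "(x, y) \<in> F \<inter> W \<longleftrightarrow> in_quadrants {} p (x, y)" using d(2) by (auto simp: in_quadrants_def)
    qed (use d(1) in auto)
  next
    case 2
    then obtain d where d: "d > 0" "ball p d \<subseteq> F" by (auto simp: mem_interior)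
    let ?d = "min d \<eta> / 3"
    show ?thesis
    proof (rule tame_at_quadrants[of ?d _ _ K])
      fix x y assume "\<bar>x - fst p\<bar> \<le> ?d" "\<bar>y - snd p\<bar> \<le> ?d"
      then have "(x, y) \<in> ball p (min d \<eta>)" using box[of "(x, y)" "min d \<eta>"] d(1) \<eta> by simp
      then show "(x, y) \<in> F \<inter> W \<longleftrightarrow> in_quadrants K p (x, y)" using ballW[of "(x, y)"] d(2) by auto
    qed (use d(1) \<eta> K in auto)
  next
    case 3
    then obtain n where n: "is_outward_normal F p n" using F(2) by blast
    obtain U f g where f: "C1_regular_on U f g" "p \<in> U" "f p = 0" "F \<inter> U = {y \<in> U. f y \<le> 0}"
      and "n = sgn (g p)"
      using n[unfolded is_outward_normal_def] by (elim exE conjE)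
    then have nF: "outward_normal F p = sgn (g p)" using outward_normal_eq[OF n] by simp
    have g0: "g p \<noteq> 0" using f(1,2) unfolding C1_regular_on_def by blast
    have FU: "z \<in> F \<longleftrightarrow> f z \<le> 0" if "z \<in> U" for z using f(4) that by blast
    have ncorner: "p \<notin> corners \<R> W" using corner 3 by blast
    have front: "p \<in> frontier W" if "K \<noteq> {}" "K \<noteq> UNIV" using quadrants_frontier[OF \<eta> loc that] .
    have "\<forall>t u. (t, u) \<in> K \<longrightarrow> (\<not> t, \<not> u) \<in> K \<longrightarrow> (t, \<not> u) \<in> K \<or> (\<not> t, u) \<in> K"
      using K by blast
    then show ?thesis
    proof (cases rule: quadrant_sets_cases)
      case 1
      show ?thesis
      proof (rule tame_at_quadrants[of "\<eta> / 3" _ _ "{}"])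
        fix x y assume "\<bar>x - fst p\<bar> \<le> \<eta> / 3" "\<bar>y - snd p\<bar> \<le> \<eta> / 3"
        then have "(x, y) \<in> ball p \<eta>" using box[of "(x, y)" \<eta>] \<eta> by simp
        then show "(x, y) \<in> F \<inter> W \<longleftrightarrow> in_quadrants {} p (x, y)"
          using ballW[of "(x, y)"] 1 by (auto simp: in_quadrants_def)
      qed (use \<eta> in auto)
    next
      case 2
      have inW: "z \<in> W" if "z \<in> ball p \<eta>" for z
        using ballW[OF that] unfolding in_quadrants_def 2 by (auto simp: side_def ex_bool_eq)
      consider "snd (g p) \<noteq> 0" | "fst (g p) \<noteq> 0" using g0 by (auto simp: prod_eq_iff)
      then show ?thesis
      proof cases
        case 1
        show ?thesis
          by (rule tame_at_sublevel_vertical[OF f(1-3) 1 \<eta>, of _ UNIV]) (use inW FU in auto)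
      next
        case 2
        show ?thesis
          by (rule tame_at_sublevel_horizontal[OF f(1-3) 2 \<eta>, of _ UNIV]) (use inW FU in auto)
      qed
    next
      case (3 t)
      have WX: "z \<in> W \<longleftrightarrow> side t (fst p) (fst z)" if "z \<in> ball p \<eta>" for z
        using ballW[OF that] unfolding in_quadrants_def 3 by (auto simp: side_def ex_bool_eq)
      have "outward_normal W p = (- sg t, 0)"
        using \<eta> WX by (intro outward_normal_eq is_outward_normal_halfplane_local[of \<eta>])
          (auto simp: side_def inner_prod_def norm_prod_def)
      moreover have "(t, True) \<in> K" "(\<not> t, True) \<notin> K" using 3(1) by simp_all
      then have "p \<in> frontier W" by (intro front) blast+
      ultimately have tr: "\<not> collinear {0, sgn (g p), (- sg t, 0)}"
        using transversal[of p] \<open>p \<in> frontier F\<close> nF by simp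
      \<comment> \<open>A horizontal gradient would be collinear with the normal of a vertical
        edge.\<close>
      have "snd (g p) \<noteq> 0"
      proof
        assume s: "snd (g p) = 0"
        have "(- sg t, 0) = (- sg t / fst (sgn (g p))) *\<^sub>R sgn (g p)"
          using s g0 by (auto simp: sgn_div_norm prod_eq_iff)
        then show False using tr unfolding collinear_lemma by blast
      qed
      then show ?thesis
        by (rule tame_at_sublevel_vertical[OF f(1-3) _ \<eta>, of _ "{x. side t (fst p) x}"])
          (use WX FU in \<open>auto simp: side_def\<close>)
    next
      case (4 u)
      have WX: "z \<in> W \<longleftrightarrow> side u (snd p) (snd z)" if "z \<in> ball p \<eta>" for z
        using ballW[OF that] unfolding in_quadrants_def 4 by (auto simp: side_def ex_bool_eq)
      have "outward_normal W p = (0, - sg u)"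
        using \<eta> WX by (intro outward_normal_eq is_outward_normal_halfplane_local[of \<eta>])
          (auto simp: side_def inner_prod_def norm_prod_def)
      moreover have "(True, u) \<in> K" "(True, \<not> u) \<notin> K" using 4(1) by simp_all
      then have "p \<in> frontier W" by (intro front) blast+
      ultimately have tr: "\<not> collinear {0, sgn (g p), (0, - sg u)}"
        using transversal[of p] \<open>p \<in> frontier F\<close> nF by simp
      have "fst (g p) \<noteq> 0"
      proof
        assume s: "fst (g p) = 0"
        have "(0, - sg u) = (- sg u / snd (sgn (g p))) *\<^sub>R sgn (g p)"
          using s g0 by (auto simp: sgn_div_norm prod_eq_iff)
        then show False using tr unfolding collinear_lemma by blast
      qed
      then show ?thesis
        by (rule tame_at_sublevel_horizontal[OF f(1-3) _ \<eta>, of _ "{x. side u (snd p) x}"])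
          (use WX FU in \<open>auto simp: side_def\<close>)
    next
      case (5 t u)
      have "(t, u) \<in> K" "(\<not> t, u) \<notin> K" using 5 by simp_all
      then have "p \<in> frontier W" by (intro front) blast+
      \<comment> \<open>A convex corner is a corner of one of the rectangles.\<close>
      then have "p \<in> corners \<R> W" using single[OF 5] by (auto simp: corners_def)
      then show ?thesis using ncorner by blast
    next
      case (6 t u)
      \<comment> \<open>A reentrant corner can arise where the sides of two rectangles cross, away
        from all their corners. It is excluded as an end point of an edge.\<close>
      have "\<exists>s. edge W s \<and> p extreme_point_of s"
      proof (rule reentrant_corner[OF \<eta>, of _ _ t u])
        fix x y assume "\<bar>x - fst p\<bar> < \<eta>" "\<bar>y - snd p\<bar> < \<eta>"
        then have "(x, y) \<in> W \<longleftrightarrow> in_quadrants K p (x, y)" by (rule loc)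
        also have "\<dots> \<longleftrightarrow> \<not> (0 < sg t * (x - fst p) \<and> 0 < sg u * (y - snd p))"
          unfolding in_quadrants_def 6 side_def ex_bool_eq
          by (cases t; cases u; cases "x \<le> fst p"; cases "y \<le> snd p"; cases "fst p \<le> x"; cases "snd p \<le> y") simp_all
        finally show "(x, y) \<in> W \<longleftrightarrow> \<not> (0 < sg t * (x - fst p) \<and> 0 < sg u * (y - snd p))" .
      qed
      then have "p \<in> corners \<R> W" by (auto simp: corners_def)
      then show ?thesis using ncorner by blast
    qed
  qed
qed

section \<open>Volumes\<close>

lemma path_component_translate:
  assumes "path_component A u v"
  shows "path_component (translate x A) (u + x) (v + x)"
proof -
  obtain g where g: "path g" "path_image g \<subseteq> A" "pathstart g = u" "pathfinish g = v"
    using assms unfolding path_component_def by blast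
  have "path_image ((+) x \<circ> g) \<subseteq> translate x A"
    using g(2) unfolding path_image_translation translate_def by (auto simp: add.commute)
  moreover have "path ((+) x \<circ> g)" using g(1) path_translation_eq[of x g] by simp
  moreover have "pathstart ((+) x \<circ> g) = u + x" "pathfinish ((+) x \<circ> g) = v + x"
    using g(3,4) by (simp_all add: pathstart_def pathfinish_def add.commute)
  ultimately show ?thesis unfolding path_component_def by blast
qed

lemma path_component_set_translate:
  "path_component_set (translate x A) (z + x) = translate x (path_component_set A z)"
proof (intro set_eqI)
  fix w
  have "path_component (translate x A) (z + x) w \<longleftrightarrow> path_component A z (w - x)"
    using path_component_translate[of A z "w - x" x] path_component_translate[of "translate x A" "z + x" w "- x"]
    by (auto simp: translate_translate)
  then show "w \<in> path_component_set (translate x A) (z + x) \<longleftrightarrow> w \<in> translate x (path_component_set A z)"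
    by (simp add: mem_translate)
qed

lemma inj_translate: "inj (translate x)"
  by (rule inj_on_inverseI[where g = "translate (- x)"]) (simp add: translate_translate)

lemma translate_eq: "translate x A = (+) x ` A"
  by (simp add: translate_def add.commute)

lemma closed_translate: "closed A \<Longrightarrow> closed (translate x A)"
  and bounded_translate: "bounded A \<Longrightarrow> bounded (translate x A)"
  unfolding translate_eq by (auto intro: closed_translation bounded_translation)

lemma bounded_components_translate:
  "bounded_components (translate x A) = translate x ` bounded_components A"
proof -
  have bd: "bounded (translate x C) \<longleftrightarrow> bounded C" for C
    using bounded_translate[of C x] bounded_translate[of "translate x C" "- x"] by (auto simp: translate_translate)
  have "bounded_components (translate x A) = {C. bounded C \<and> (\<exists>z\<in>A. C = translate x (path_component_set A z))}"
    unfolding bounded_components_def path_component_set_translate[symmetric]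
    by (auto simp: translate_def)
  then show ?thesis unfolding bounded_components_def using bd by auto
qed

lemma euler_char_translate: "euler_char (translate x A) = euler_char A"
  unfolding euler_char_def translate_Compl[symmetric] bounded_components_translate
  by (simp add: card_image[OF inj_on_subset[OF inj_translate subset_UNIV]])

section \<open>Integrals over a period of the grid\<close>

lemma integral_lborel_shift:
  fixes f :: "plane \<Rightarrow> real"
  assumes "f \<in> borel_measurable borel"
  shows "integral\<^sup>L lborel f = (\<integral>y. f (z + y) \<partial>lborel)"
  using integral_distr[of "(+) z" lborel borel f] assms by (simp add: lborel_distr_plus)

lemma integrable_lborel_shift:
  fixes f :: "plane \<Rightarrow> real"
  assumes "f \<in> borel_measurable borel"
  shows "integrable lborel f \<longleftrightarrow> integrable lborel (\<lambda>y. f (z + y))"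
  using integrable_distr_eq[of "(+) z" lborel borel f] assms by (simp add: lborel_distr_plus)

lemma grid_cell_cover:
  assumes "\<epsilon> > 0"
  shows "\<exists>!z. z \<in> grid \<epsilon> \<and> x - z \<in> {0..<\<epsilon>} \<times> {0..<\<epsilon>}"
proof -
  have cell: "t - \<epsilon> * of_int i \<in> {0..<\<epsilon>} \<longleftrightarrow> i = \<lfloor>t / \<epsilon>\<rfloor>" for t i
  proof -
    have "t - \<epsilon> * of_int i \<in> {0..<\<epsilon>} \<longleftrightarrow> of_int i \<le> t / \<epsilon> \<and> t / \<epsilon> < of_int i + 1"
      using assms by (auto simp: field_simps)
    then show ?thesis by (simp add: floor_eq_iff eq_commute[of i])
  qed
  have "node \<epsilon> w \<in> grid \<epsilon> \<and> x - node \<epsilon> w \<in> {0..<\<epsilon>} \<times> {0..<\<epsilon>} \<longleftrightarrow> w = (\<lfloor>fst x / \<epsilon>\<rfloor>, \<lfloor>snd x / \<epsilon>\<rfloor>)" for w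
    unfolding mem_Times_iff using cell[of "fst x" "fst w"] cell[of "snd x" "snd w"]
    by (auto simp: grid_eq_range_node node_def prod_eq_iff)
  note iff = this
  show ?thesis
  proof (rule ex1I[of _ "node \<epsilon> (\<lfloor>fst x / \<epsilon>\<rfloor>, \<lfloor>snd x / \<epsilon>\<rfloor>)"])
    fix z assume z: "z \<in> grid \<epsilon> \<and> x - z \<in> {0..<\<epsilon>} \<times> {0..<\<epsilon>}"
    then obtain w where "z = node \<epsilon> w" unfolding grid_eq_range_node by blast
    then show "z = node \<epsilon> (\<lfloor>fst x / \<epsilon>\<rfloor>, \<lfloor>snd x / \<epsilon>\<rfloor>)" using z iff[of w] by simp
  qed (use iff in blast)
qed

text \<open>The integral is unfolded: \<open>f\<close> is cut along the cells \<open>z + C\<close>,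
  every piece is moved to \<open>C\<close>, and there the pieces add up to the constant
  \<open>c\<close>. Bounded support keeps the sum finite, so that it can be exchanged with the
  integral.\<close>

lemma integral_eq_grid_sum:
  fixes f :: "plane \<Rightarrow> real"
  assumes \<epsilon>: "\<epsilon> > 0" and f: "integrable lborel f" "f \<in> borel_measurable borel"
    and supp: "\<And>x. f x \<noteq> 0 \<Longrightarrow> norm x \<le> R"
    and sum: "\<And>x. ((\<lambda>z. f (z + x)) has_sum c) (grid \<epsilon>)"
  shows "integral\<^sup>L lborel f = c * \<epsilon>\<^sup>2"
proof -
  define C where "C = {0..<\<epsilon>} \<times> {0..<\<epsilon>}"
  \<comment> \<open>Points of \<open>C\<close> have norm at most \<open>2 * \<epsilon>\<close>, so a
    cell \<open>z + C\<close> that meets the support has \<open>z\<close> within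
    \<open>R + 2 * \<epsilon>\<close> of the origin.\<close>
  define Z where "Z = cball 0 (R + 2 * \<epsilon>) \<inter> grid \<epsilon>"
  have finZ: "finite Z" unfolding Z_def by (intro finite_bounded_Int_grid \<epsilon> bounded_cball)
  have Cs: "C \<in> sets borel" unfolding C_def by (intro borel_Times) auto
  have normC: "norm x \<le> 2 * \<epsilon>" if "x \<in> C" for x
  proof -
    have "norm x \<le> norm (fst x) + norm (snd x)"
      unfolding norm_prod_def by (rule sqrt_sum_squares_le_sum) simp_all
    then show ?thesis using that unfolding C_def mem_Times_iff by auto
  qed
  have inZ: "z \<in> Z" if z: "z \<in> grid \<epsilon>" "x \<in> C" "f (z + x) \<noteq> 0" for z x
  proof -
    have "norm z \<le> norm (z + x) + norm x" using norm_triangle_ineq4[of "z + x" x] by simp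
    then show ?thesis using supp[OF z(3)] normC[OF z(2)] z(1) by (simp add: Z_def)
  qed
  have split: "f x = (\<Sum>z\<in>Z. indicator C (x - z) * f x)" for x
  proof (cases "f x = 0")
    case False
    obtain z where z: "z \<in> grid \<epsilon> \<and> x - z \<in> C" and uniq: "\<forall>w. w \<in> grid \<epsilon> \<and> x - w \<in> C \<longrightarrow> w = z"
      using grid_cell_cover[OF \<epsilon>, of x] unfolding C_def by (rule ex1E)
    have "z \<in> Z" using inZ[of z "x - z"] z False by simp
    then have "(\<Sum>w\<in>Z. indicator C (x - w) * f x) = indicator C (x - z) * f x"
    proof (subst sum.remove[OF finZ], assumption)
      have "(\<Sum>w\<in>Z - {z}. indicator C (x - w) * f x) = 0"
        using uniq by (intro sum.neutral) (auto simp: Z_def indicator_def)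
      then show "indicator C (x - z) * f x + (\<Sum>w\<in>Z - {z}. indicator C (x - w) * f x) = indicator C (x - z) * f x"
        by simp
    qed
    then show ?thesis using z by simp
  qed simp
  have meas: "(\<lambda>x. indicator C (x - z) * f x) \<in> borel_measurable borel" for z
  proof -
    have "(\<lambda>x. x - z) \<in> borel_measurable (borel :: plane measure)" by simp
    then have "(\<lambda>x. indicator C (x - z) :: real) \<in> borel_measurable borel"
      using Cs by (intro measurable_compose[OF _ borel_measurable_indicator]) auto
    then show ?thesis using f(2) by (intro borel_measurable_times)
  qed
  have int: "integrable lborel (\<lambda>x. indicator C (x - z) * f x)" for z
    by (rule Bochner_Integration.integrable_bound[OF f(1)]) (use meas in \<open>auto simp: indicator_def\<close>)
  have "integral\<^sup>L lborel f = (\<integral>x. (\<Sum>z\<in>Z. indicator C (x - z) * f x) \<partial>lborel)"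
    using split by (intro Bochner_Integration.integral_cong) auto
  also have "\<dots> = (\<Sum>z\<in>Z. \<integral>x. indicator C (x - z) * f x \<partial>lborel)"
    using int by (rule Bochner_Integration.integral_sum)
  also have "\<dots> = (\<Sum>z\<in>Z. \<integral>x. indicator C x * f (z + x) \<partial>lborel)"
  proof (intro sum.cong refl)
    fix z
    show "(\<integral>x. indicator C (x - z) * f x \<partial>lborel) = (\<integral>x. indicator C x * f (z + x) \<partial>lborel)"
      using integral_lborel_shift[OF meas, of z z] by simp
  qed
  also have "\<dots> = (\<integral>x. (\<Sum>z\<in>Z. indicator C x * f (z + x)) \<partial>lborel)"
  proof (rule Bochner_Integration.integral_sum[symmetric])
    show "integrable lborel (\<lambda>x. indicator C x * f (z + x))" if "z \<in> Z" for z
      using int[of z] integrable_lborel_shift[OF meas, of z z] by simp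
  qed
  also have "\<dots> = (\<integral>x. indicator C x * c \<partial>lborel)"
  proof (intro Bochner_Integration.integral_cong refl)
    fix x
    show "(\<Sum>z\<in>Z. indicator C x * f (z + x)) = indicator C x * c"
    proof (cases "x \<in> C")
      case True
      have "((\<lambda>z. f (z + x)) has_sum (\<Sum>z\<in>Z. f (z + x))) (grid \<epsilon>)"
      proof (rule has_sum_finite_neutralI[OF finZ])
        show "f (z + x) = 0" if "z \<in> grid \<epsilon> - Z" for z using inZ[of z x] True that by blast
      qed (auto simp: Z_def)
      then have "(\<Sum>z\<in>Z. f (z + x)) = c" using sum has_sum_unique by blast
      then show ?thesis using True by simp
    qed simp
  qed
  also have "\<dots> = measure lborel C * c" using Cs by simp
  also have "measure lborel C = \<epsilon>\<^sup>2"
  proof -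
    have "emeasure (lborel \<Otimes>\<^sub>M lborel) C = ennreal \<epsilon> * ennreal \<epsilon>"
      unfolding C_def using \<epsilon> by (subst lborel.emeasure_pair_measure_Times) auto
    then have "emeasure lborel C = ennreal (\<epsilon>\<^sup>2)"
      using \<epsilon> by (simp add: lborel_prod ennreal_mult power2_eq_square)
    then show ?thesis by (simp add: measure_def)
  qed
  finally show ?thesis by (simp add: mult.commute)
qed

lemma local_euler_translate: "local_euler \<epsilon> y (translate x A) = local_euler \<epsilon> (y - x) A"
  unfolding local_euler_def mem_translate by (simp add: algebra_simps)

text \<open>The two indicators in the local term are those of the sets measured by the
  polyvariograms. These sets are bounded, and Borel because \<open>A\<close> is closed, which
  permits passing between \<open>lborel\<close> and \<open>lebesgue\<close>.\<close>

lemma local_euler_integral: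
  assumes A: "closed A" "bounded A" and \<epsilon>: "\<epsilon> > 0"
  shows "integrable lebesgue (\<lambda>x. local_euler \<epsilon> x A)"
    and "(LINT x|lebesgue. local_euler \<epsilon> x A) =
      polyvariogram [0] [- (\<epsilon> *\<^sub>R u1), - (\<epsilon> *\<^sub>R u2)] A - polyvariogram [\<epsilon> *\<^sub>R u1, \<epsilon> *\<^sub>R u2] [0] A"
    and "(\<And>x. ((\<lambda>y. local_euler \<epsilon> y (translate x A)) has_sum c) (grid \<epsilon>)) \<Longrightarrow>
      (LINT x|lebesgue. local_euler \<epsilon> x A) = c * \<epsilon>\<^sup>2"
proof -
  let ?S1 = "(\<Inter>x\<in>set [0]. translate x A) \<inter> (\<Inter>y\<in>set [- (\<epsilon> *\<^sub>R u1), - (\<epsilon> *\<^sub>R u2)]. - translate y A)"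
  let ?S2 = "(\<Inter>x\<in>set [\<epsilon> *\<^sub>R u1, \<epsilon> *\<^sub>R u2]. translate x A) \<inter> (\<Inter>y\<in>set [0]. - translate y A)"
  have f: "local_euler \<epsilon> x A = indicat_real ?S1 x - indicat_real ?S2 x" for x
    unfolding local_euler_def by (auto simp: mem_translate indicator_def)
  have Tr: "translate x A \<in> sets borel" for x using closed_translate[OF A(1)] by (rule borel_closed)
  have S: "?S1 \<in> sets borel" "?S2 \<in> sets borel"
    using Tr[of 0] by (auto intro!: sets.Int borel_comp Tr)
  note bd = bounded_translate[OF A(2)]
  have bS: "bounded ?S1" "bounded ?S2"
    by (rule bounded_subset[OF bd[of 0]], force) (rule bounded_subset[OF bd[of "\<epsilon> *\<^sub>R u1"]], force)
  then have fin: "emeasure lborel ?S1 < \<infinity>" "emeasure lborel ?S2 < \<infinity>"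
    using emeasure_bounded_finite by blast+
  have int: "integrable lborel (\<lambda>x. indicat_real ?S1 x)" "integrable lborel (\<lambda>x. indicat_real ?S2 x)"
    using S fin by (auto intro!: integrable_real_indicator)
  have meas: "(\<lambda>x. indicat_real ?S1 x - indicat_real ?S2 x) \<in> borel_measurable borel"
    using S by (intro borel_measurable_diff borel_measurable_indicator)
  have intf: "integrable lborel (\<lambda>x. local_euler \<epsilon> x A)"
    unfolding f using int by (rule Bochner_Integration.integrable_diff)
  have leb: "(LINT x|lebesgue. local_euler \<epsilon> x A) = (LINT x|lborel. local_euler \<epsilon> x A)"
    unfolding f using meas by (intro integral_completion) simp
  show "integrable lebesgue (\<lambda>x. local_euler \<epsilon> x A)"
    using intf meas unfolding f by (subst integrable_completion) auto
  have "(LINT x|lborel. local_euler \<epsilon> x A) = measure lborel ?S1 - measure lborel ?S2"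
    unfolding f using int S by (simp add: Bochner_Integration.integral_diff)
  then show "(LINT x|lebesgue. local_euler \<epsilon> x A) =
      polyvariogram [0] [- (\<epsilon> *\<^sub>R u1), - (\<epsilon> *\<^sub>R u2)] A - polyvariogram [\<epsilon> *\<^sub>R u1, \<epsilon> *\<^sub>R u2] [0] A"
    unfolding leb polyvariogram_def using S by (simp add: measure_completion)
  obtain R where R: "\<And>x. x \<in> ?S1 \<union> ?S2 \<Longrightarrow> norm x \<le> R"
    using bS by (meson bounded_Un bounded_iff)
  assume sum: "\<And>x. ((\<lambda>y. local_euler \<epsilon> y (translate x A)) has_sum c) (grid \<epsilon>)"
  have "(LINT x|lborel. local_euler \<epsilon> x A) = c * \<epsilon>\<^sup>2"
  proof (rule integral_eq_grid_sum[OF \<epsilon> intf])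
    show "(\<lambda>x. local_euler \<epsilon> x A) \<in> borel_measurable borel" unfolding f by (rule meas)
    show "norm x \<le> R" if "local_euler \<epsilon> x A \<noteq> 0" for x
    proof (rule R)
      show "x \<in> ?S1 \<union> ?S2" using that unfolding f by (metis UnCI cancel_comm_monoid_add_class.diff_cancel indicator_simps(2))
    qed
    show "((\<lambda>z. local_euler \<epsilon> (z + x) A) has_sum c) (grid \<epsilon>)" for x
      using sum[of "- x"] by (simp add: local_euler_translate)
  qed
  then show "(LINT x|lebesgue. local_euler \<epsilon> x A) = c * \<epsilon>\<^sup>2" using leb by simp
qed

section \<open>A translation invariant bound on the mesh\<close>

definition euler_identities :: "real \<Rightarrow> plane set \<Rightarrow> bool" where
  "euler_identities \<epsilon> A \<longleftrightarrow> A \<in> euler_class \<and>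
     grid_trace \<epsilon> A \<in> grid_euler_class \<epsilon> \<and>
     euler_char A = grid_euler_char \<epsilon> (grid_trace \<epsilon> A) \<and>
     (\<lambda>x. local_euler \<epsilon> x A) summable_on grid \<epsilon> \<and>
     real_of_int (euler_char A) = (\<Sum>\<^sub>\<infinity>x\<in>grid \<epsilon>. local_euler \<epsilon> x A) \<and>
     integrable lebesgue (\<lambda>x. local_euler \<epsilon> x A) \<and>
     real_of_int (euler_char A) = (LINT x|lebesgue. local_euler \<epsilon> x A) / \<epsilon>\<^sup>2 \<and>
     real_of_int (euler_char A) =
       (polyvariogram [0] [- (\<epsilon> *\<^sub>R u1), - (\<epsilon> *\<^sub>R u2)] A
        - polyvariogram [\<epsilon> *\<^sub>R u1, \<epsilon> *\<^sub>R u2] [0] A) / \<epsilon>\<^sup>2"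

lemma tame_euler_identities:
  assumes "tame A" "bounded A" "closed A"
  shows "\<exists>e>0. \<forall>x \<epsilon>. 0 < \<epsilon> \<and> \<epsilon> < e \<longrightarrow> euler_identities \<epsilon> (translate x A)"
proof -
  obtain e where e: "e > 0"
    and main: "\<And>\<epsilon> x. 0 < \<epsilon> \<and> \<epsilon> < e \<Longrightarrow>
      translate x A \<in> euler_class \<and> grid_trace \<epsilon> (translate x A) \<in> grid_euler_class \<epsilon> \<and>
      euler_char (translate x A) = grid_euler_char \<epsilon> (grid_trace \<epsilon> (translate x A)) \<and>
      ((\<lambda>y. local_euler \<epsilon> y (translate x A)) has_sum of_int (euler_char (translate x A))) (grid \<epsilon>)"
    using tame_grid_euler[OF assms(1,2)] by blast
  have "euler_identities \<epsilon> (translate x A)" if \<epsilon>: "0 < \<epsilon> \<and> \<epsilon> < e" for x \<epsilon>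
  proof -
    let ?B = "translate x A"
    note int = local_euler_integral[OF closed_translate[OF assms(3)] bounded_translate[OF assms(2)] conjunct1[OF \<epsilon>], of x]
    \<comment> \<open>All translates share one Euler characteristic, so the grid sum is constant in
      \<open>t\<close>, as the unfolding of the integral requires.\<close>
    have "((\<lambda>y. local_euler \<epsilon> y (translate t ?B)) has_sum of_int (euler_char ?B)) (grid \<epsilon>)" for t
      using main[OF \<epsilon>, of "x + t"] unfolding translate_translate euler_char_translate by blast
    from int(3)[OF this] have "(LINT x|lebesgue. local_euler \<epsilon> x ?B) = of_int (euler_char ?B) * \<epsilon>\<^sup>2" .
    then have i: "real_of_int (euler_char ?B) = (LINT x|lebesgue. local_euler \<epsilon> x ?B) / \<epsilon>\<^sup>2"
      using \<epsilon> by simp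
    have s: "((\<lambda>y. local_euler \<epsilon> y ?B) has_sum of_int (euler_char ?B)) (grid \<epsilon>)" using main[OF \<epsilon>] by blast
    show ?thesis
      unfolding euler_identities_def
      using main[OF \<epsilon>, of x] has_sum_imp_summable[OF s] infsumI[OF s] int(1) i i[unfolded int(2)]
      by simp
  qed
  then show ?thesis using e by blast
qed

lemma closed_polyrectangle: "polyrectangle \<R> W \<Longrightarrow> closed W"
  unfolding polyrectangle_def admissible_rectangle_def admissible_interval_def
  by (auto intro!: closed_Union closed_Times)

lemma translate_Int: "translate x (A \<inter> B) = translate x A \<inter> translate x B"
  by (auto simp: mem_translate)

text \<open>The condition quantifies over all translates, so it is the same for \<open>A\<close> and
  for a translate of \<open>A\<close>, and the choice operator returns the same number for
  both.\<close>

definition resolution :: "plane set \<Rightarrow> real" where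
  "resolution A = (SOME e. e > 0 \<and> (\<forall>x \<epsilon>. 0 < \<epsilon> \<and> \<epsilon> < e \<longrightarrow> euler_identities \<epsilon> (translate x A)))"

lemma resolution_translate: "resolution (translate y A) = resolution A"
proof -
  have "(\<forall>x \<epsilon>. 0 < \<epsilon> \<and> \<epsilon> < e \<longrightarrow> euler_identities \<epsilon> (translate x (translate y A))) \<longleftrightarrow>
      (\<forall>x \<epsilon>. 0 < \<epsilon> \<and> \<epsilon> < e \<longrightarrow> euler_identities \<epsilon> (translate x A))" for e
    unfolding translate_translate by (metis add_diff_cancel_left' add_diff_eq)
  then show ?thesis unfolding resolution_def by simp
qed

lemma resolution:
  assumes "tame A" "bounded A" "closed A"
  shows "resolution A > 0" "0 < \<epsilon> \<Longrightarrow> \<epsilon> < resolution A \<Longrightarrow> euler_identities \<epsilon> A"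
proof -
  have "resolution A > 0 \<and> (\<forall>x \<epsilon>. 0 < \<epsilon> \<and> \<epsilon> < resolution A \<longrightarrow> euler_identities \<epsilon> (translate x A))"
    unfolding resolution_def by (rule someI_ex) (use tame_euler_identities[OF assms] in blast)
  then have "resolution A > 0" "\<And>\<epsilon>. 0 < \<epsilon> \<Longrightarrow> \<epsilon> < resolution A \<Longrightarrow> euler_identities \<epsilon> (translate 0 A)"
    by blast+
  then show "resolution A > 0" "0 < \<epsilon> \<Longrightarrow> \<epsilon> < resolution A \<Longrightarrow> euler_identities \<epsilon> A" by simp_all
qed

lemma tame_regular_Int_polyrectangle:
  assumes "regular_set \<rho> F" "polyrectangle \<R> W" "bounded (F \<inter> W)" "frontier F \<inter> corners \<R> W = {}"
    "\<And>x. x \<in> frontier F \<inter> frontier W \<Longrightarrow> \<not> collinear {0, outward_normal F x, outward_normal W x}"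
  shows "tame (F \<inter> W)" "closed (F \<inter> W)"
proof -
  have F: "closed F" "\<And>x. x \<in> frontier F \<Longrightarrow> \<exists>n. is_outward_normal F x n"
    using assms(1) unfolding regular_set_def by (auto intro: compact_imp_closed)
  show "tame (F \<inter> W)"
    by (rule tame_of_tame_at[OF assms(3) tame_at_Int[OF F assms(2,4,5)]])
  show "closed (F \<inter> W)" using F(1) closed_polyrectangle[OF assms(2)] by blast
qed

lemma regular_Int_polyrectangle_euler:
  assumes H: "regular_set \<rho> F" "polyrectangle \<R> W" "bounded (F \<inter> W)" "frontier F \<inter> corners \<R> W = {}"
    "\<forall>x \<in> frontier F \<inter> frontier W. \<not> collinear {0, outward_normal F x, outward_normal W x}"
  shows "F \<inter> W \<in> euler_class \<and> resolution (F \<inter> W) > 0 \<and>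
    (\<forall>\<epsilon>. 0 < \<epsilon> \<and> \<epsilon> < resolution (F \<inter> W) \<longrightarrow> euler_identities \<epsilon> (F \<inter> W)) \<and>
    (\<forall>x. resolution (translate x F \<inter> translate x W) = resolution (F \<inter> W))"
proof -
  note tame = tame_regular_Int_polyrectangle[OF H(1-4) H(5)[rule_format]]
  note res = resolution[OF tame(1) H(3) tame(2)]
  \<comment> \<open>Membership in the class does not mention the mesh, so any admissible mesh
    witnesses it.\<close>
  have "F \<inter> W \<in> euler_class"
    using res(2)[of "resolution (F \<inter> W) / 2"] res(1) by (simp add: euler_identities_def)
  moreover have "\<forall>x. resolution (translate x F \<inter> translate x W) = resolution (F \<inter> W)"
    by (simp add: translate_Int[symmetric] resolution_translate)
  moreover have "\<forall>\<epsilon>. 0 < \<epsilon> \<and> \<epsilon> < resolution (F \<inter> W) \<longrightarrow> euler_identities \<epsilon> (F \<inter> W)"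
    using res(2) by blast
  ultimately show ?thesis using res(1) by blast
qed

theorem theorem7:
  shows "\<exists>eps :: plane set \<Rightarrow> plane set \<Rightarrow> real.
    \<forall>(\<rho>::real) (F::plane set) (\<R>::plane set set) (W::plane set).
      \<rho> > 0 \<and> regular_set \<rho> F \<and> polyrectangle \<R> W \<and> bounded (F \<inter> W) \<and>
      frontier F \<inter> corners \<R> W = {} \<and>
      (\<forall>x \<in> frontier F \<inter> frontier W.
         \<not> collinear {0, outward_normal F x, outward_normal W x}) \<longrightarrow>
      F \<inter> W \<in> euler_class \<and>
      eps F W > 0 \<and>
      (\<forall>\<epsilon>. 0 < \<epsilon> \<and> \<epsilon> < eps F W \<longrightarrow>
         grid_trace \<epsilon> (F \<inter> W) \<in> grid_euler_class \<epsilon> \<and>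
         euler_char (F \<inter> W) = grid_euler_char \<epsilon> (grid_trace \<epsilon> (F \<inter> W)) \<and>
         (\<lambda>x. local_euler \<epsilon> x (F \<inter> W)) summable_on grid \<epsilon> \<and>
         real_of_int (euler_char (F \<inter> W)) = (\<Sum>\<^sub>\<infinity>x\<in>grid \<epsilon>. local_euler \<epsilon> x (F \<inter> W)) \<and>
         integrable lebesgue (\<lambda>x. local_euler \<epsilon> x (F \<inter> W)) \<and>
         real_of_int (euler_char (F \<inter> W)) =
           (LINT x|lebesgue. local_euler \<epsilon> x (F \<inter> W)) / \<epsilon>\<^sup>2 \<and>
         real_of_int (euler_char (F \<inter> W)) =
           (polyvariogram [0] [- (\<epsilon> *\<^sub>R u1), - (\<epsilon> *\<^sub>R u2)] (F \<inter> W)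
            - polyvariogram [\<epsilon> *\<^sub>R u1, \<epsilon> *\<^sub>R u2] [0] (F \<inter> W)) / \<epsilon>\<^sup>2) \<and>
      (\<forall>x. eps (translate x F) (translate x W) = eps F W)"
proof (rule exI[of _ "\<lambda>F W. resolution (F \<inter> W)"], intro allI impI, goal_cases)
  case (1 \<rho> F \<R> W)
  then show ?case
    using regular_Int_polyrectangle_euler[of \<rho> F \<R> W] unfolding euler_identities_def by blast
qed

end
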